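(* Let $X=(Y,Z)$ be a two-dimensional affine process with compact state space $E\subseteq\mathbb N\times\mathbb R$ whose affine span is $\mathbb R^2$, such that: $Y$ is an affine and Markov process with state space $\{0,\ldots,N\}$ for some nonzero $N\in\mathbb N$ and jump kernel $F^Y(y,\cdot)=y\alpha\delta_{-1}+(N-y)\beta\delta_1$ for some $\alpha>0$ and $\beta\ge0$; $Z$ can only jump when $Y$ jumps, i.e. $\{t\ge0\colon\Delta Z_t\ne0\}\subseteq\{t\ge0\colon\Delta Y_t\ne0\}$ $\mathbb P_x$-a.s. for every $x\in E$; the jump characteristic of $Z$ is of the form $F^Z(Y_{t-},d\zeta)dt$ for some affine map $F^Z\colon\mathbb R\to\mathfrak M^1_*$; and the coordinate projection $\pi_1\colon(y,z)\mapsto y$ is a normalized jump counter of $X$. If $\beta>0$, then up to an affine transformation of $X$ (i.e. after replacing $X=(Y,Z)$ and $E$ by those of $A(X)$ for some invertible affine map $A\colon\mathbb R^2\to\mathbb R^2$), $Z$ is continuous and we have $$E=\{0,\ldots,N\}\times E^Z$$ for some compact subset $E^Z\subseteq\mathbb R$. If instead $\beta=0$, then $Z$ need not be continuous (there exist two-dimensional affine processes $X=(Y,Z)$ with compact state space $E\subseteq\mathbb N\times\mathbb R$ whose affine span is $\mathbb R^2$, such that $Y$ is an affine and Markov process with state space $\{0,\ldots,N\}$ and jump kernel $F^Y(y,\cdot)=y\alpha\delta_{-1}$ for some nonzero $N\in\mathbb N$ and some $\alpha>0$, $Z$ can only jump when $Y$ jumps $\mathbb P_x$-a.s. for every $x\in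 E$, the jump characteristic of $Z$ is of the form $F^Z(Y_{t-},d\zeta)dt$ for some affine map $F^Z\colon\mathbb R\to\mathfrak M^1_*$, and $\pi_1$ is a normalized jump counter of $X$, for which $Z$ is not continuous), but $Z$ can jump at most $y$ times $\mathbb P_{(y,z)}$-a.s. for each $(y,z)\in E$.
   Context: Setting. $(\Omega,\mathcal F)$ is a measurable space with a right-continuous filtration $(\mathcal F_t)_{t\ge0}$; $d\ge1$ (here $d=2$); $E\subseteq\mathbb R^d$ is nonempty and measurable (the state space); $X=(X_t)_{t\ge0}$ is a càdlàg adapted process with values in $E$, with the convention $X_{0-}=X_0$; $(\mathbb P_x)_{x\in E}$ is a family of probability measures on $\mathcal F$ such that for each $x\in E$, $X$ is a $\mathbb P_x$-semimartingale with $\mathbb P_x(X_0=x)=1$. Notation: $\mathbb N=\{0,1,2,\ldots\}$; $\delta_x$ is the Dirac measure at $x$; $\mathbb S^d$ is the set of symmetric $d\times d$ matrices; $\mathfrak M^d_*$ is the vector space of all signed Radon measures on $\mathbb R^d\setminus\{0\}$, i.e. set functions $\mu_+-\mu_-$ with $\mu_\pm$ positive measures on $\mathbb R^d\setminus\{0\}$ that assign finite mass to compact subsets. Affine process. $X$ is affine with triplet $(b,c,F)$ if $b\colon\mathbb R^d\to\mathbb R^d$, $c\colon\mathbb R^d\to\mathbb S^d$, $F\colon\mathbb R^d\to\mathfrak M^d_*$ are affine maps such that for each $x\in E$: $c(x)$ is positive semidefinite, $F(x,d\xi)$ is a positive measure on $\mathbb R^d\setminus\{0\}$ with $\int(\|\xi\|^2\wedge1)F(x,d\xi)<\infty$,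 and the semimartingale characteristics $(B,C,\nu)$ of $X$ under $\mathbb P_x$ are $B_t=\int_0^tb(X_{s-})ds$, $C_t=\int_0^tc(X_{s-})ds$, $\nu(dt,d\xi)=F(X_{t-},d\xi)dt$ (the choice of truncation function is irrelevant). For an affine image $Y=f(X)$ of $X$, being an affine process is understood in the same sense: under every $\mathbb P_x$, $x\in E$, the characteristics of $Y$ are given by a triplet of affine maps evaluated at $Y_{t-}$, with state space $f(E)$; the third component of the triplet is its jump kernel. Jump counters. The set of possible jump sizes of $X$ is $S=\bigcup_{x\in E}\operatorname{supp}(F(x,\cdot))\setminus\{0\}$. A jump counter corresponding to $u\in S$ is an affine function $\psi_u\colon\mathbb R^d\to\mathbb R$, not identically zero, such that $\psi_u\ge0$ on $E$, and $x\in E$, $\psi_u(x)>0$ imply $x+u\in E$. It is normalized if $\psi_u(u)-\psi_u(0)=-1$. A normalized jump counter of $X$ is one corresponding to some $u\in S$. *)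

theory Defs
  imports "HOL-Probability.Probability"
begin

text \<open>
  Time runs through the nonnegative reals; processes and filtrations are indexed by type
  \<^typ>\<open>real\<close>, and only their values at times \<open>t \<ge> 0\<close> carry information. (A filtration
  \<open>(F t)\<close>, \<open>t \<ge> 0\<close>, is put in the form of the locale \<^locale>\<open>filtration\<close> by setting
  \<open>F t = F 0\<close> for \<open>t < 0\<close>.) The general theory follows Jacod and Shiryaev.
\<close>

section \<open>Paths\<close>

definition cadlag :: "(real \<Rightarrow> 'a::topological_space) \<Rightarrow> bool" where
  "cadlag f \<longleftrightarrow> (\<forall>t\<ge>0. (f \<longlongrightarrow> f t) (at_right t)) \<and> (\<forall>t>0. \<exists>l. (f \<longlongrightarrow> l) (at_left t))"

text \<open>The convention \<open>f(0-) = f(0)\<close> is built in, so that there is never a jump at time 0.\<close>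

definition left_lim :: "(real \<Rightarrow> 'a::t2_space) \<Rightarrow> real \<Rightarrow> 'a" where
  "left_lim f t = (if t \<le> 0 then f 0 else Lim (at_left t) f)"

definition jump :: "(real \<Rightarrow> 'a::real_normed_vector) \<Rightarrow> real \<Rightarrow> 'a" where
  "jump f t = f t - left_lim f t"

definition jump_times :: "(real \<Rightarrow> 'a::real_normed_vector) \<Rightarrow> real set" where
  "jump_times f = {t. 0 \<le> t \<and> jump f t \<noteq> 0}"

definition finite_variation :: "(real \<Rightarrow> real) \<Rightarrow> bool" where
  "finite_variation f \<longleftrightarrow>
    (\<forall>t\<ge>0. \<exists>B. \<forall>(n::nat) p. mono p \<and> range p \<subseteq> {0..t} \<longrightarrow>
      (\<Sum>k<n. \<bar>f (p (Suc k)) - f (p k)\<bar>) \<le> B)"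


section \<open>Martingales and semimartingales\<close>

text \<open>
  The notions of this section are meant for a probability measure \<open>Q\<close> and a filtration \<open>F\<close>
  satisfying the usual conditions. For a right-continuous filtration they are applied to
  \<open>completion Q\<close> and the following augmentation by null sets, which gives the usual notions
  up to indistinguishability.
\<close>

definition augment :: "'w measure \<Rightarrow> (real \<Rightarrow> 'w measure) \<Rightarrow> real \<Rightarrow> 'w measure" where
  "augment Q F t = sigma (space Q) (sets (F t) \<union> null_sets (completion Q))"

definition adapted :: "(real \<Rightarrow> 'w measure) \<Rightarrow> (real \<Rightarrow> 'w \<Rightarrow> 'a::topological_space) \<Rightarrow> bool" where
  "adapted F X \<longleftrightarrow> (\<forall>t\<ge>0. X t \<in> borel_measurable (F t))"

definition martingale ::
    "'w measure \<Rightarrow> (real \<Rightarrow> 'w measure) \<Rightarrow> (real \<Rightarrow> 'w \<Rightarrow> real) \<Rightarrow> bool" where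
  "martingale Q F M \<longleftrightarrow> adapted F M \<and> (\<forall>t\<ge>0. integrable Q (M t)) \<and>
    (\<forall>s\<ge>0. \<forall>t\<ge>s. AE \<omega> in Q. real_cond_exp Q (F s) (M t) \<omega> = M s \<omega>)"

text \<open>
  Taking the localizing stopping times finite is no restriction: replace \<open>T n\<close> by
  \<open>min (T n) n\<close>, which also makes the stopped martingales uniformly integrable.
\<close>

definition local_martingale ::
    "'w measure \<Rightarrow> (real \<Rightarrow> 'w measure) \<Rightarrow> (real \<Rightarrow> 'w \<Rightarrow> real) \<Rightarrow> bool" where
  "local_martingale Q F M \<longleftrightarrow>
    adapted F M \<and> (\<forall>\<omega>\<in>space Q. cadlag (\<lambda>t. M t \<omega>)) \<and>
    (\<exists>T :: nat \<Rightarrow> 'w \<Rightarrow> real.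
      (\<forall>n. stopping_time F (T n) \<and> (\<forall>\<omega>\<in>space Q. 0 \<le> T n \<omega>)) \<and>
      (AE \<omega> in Q. incseq (\<lambda>n. T n \<omega>) \<and> filterlim (\<lambda>n. T n \<omega>) at_top sequentially) \<and>
      (\<forall>n. martingale Q F (\<lambda>t \<omega>. M (min t (T n \<omega>)) \<omega>)))"

definition continuous_local_martingale ::
    "'w measure \<Rightarrow> (real \<Rightarrow> 'w measure) \<Rightarrow> (real \<Rightarrow> 'w \<Rightarrow> real) \<Rightarrow> bool" where
  "continuous_local_martingale Q F M \<longleftrightarrow>
    local_martingale Q F M \<and> (\<forall>\<omega>\<in>space Q. continuous_on {0..} (\<lambda>t. M t \<omega>))"

definition purely_discontinuous ::
    "'w measure \<Rightarrow> (real \<Rightarrow> 'w measure) \<Rightarrow> (real \<Rightarrow> 'w \<Rightarrow> real) \<Rightarrow> bool" where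
  "purely_discontinuous Q F M \<longleftrightarrow>
    local_martingale Q F M \<and> (\<forall>\<omega>\<in>space Q. M 0 \<omega> = 0) \<and>
    (\<forall>N. continuous_local_martingale Q F N \<longrightarrow> local_martingale Q F (\<lambda>t \<omega>. M t \<omega> * N t \<omega>))"

definition fv_process ::
    "'w measure \<Rightarrow> (real \<Rightarrow> 'w measure) \<Rightarrow> (real \<Rightarrow> 'w \<Rightarrow> real) \<Rightarrow> bool" where
  "fv_process Q F A \<longleftrightarrow> adapted F A \<and>
    (\<forall>\<omega>\<in>space Q. A 0 \<omega> = 0 \<and> cadlag (\<lambda>t. A t \<omega>) \<and> finite_variation (\<lambda>t. A t \<omega>))"

definition real_semimartingale ::
    "'w measure \<Rightarrow> (real \<Rightarrow> 'w measure) \<Rightarrow> (real \<Rightarrow> 'w \<Rightarrow> real) \<Rightarrow> bool" where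
  "real_semimartingale Q F X \<longleftrightarrow>
    adapted F X \<and> (\<forall>\<omega>\<in>space Q. cadlag (\<lambda>t. X t \<omega>)) \<and>
    (\<exists>M A. local_martingale Q F M \<and> (\<forall>\<omega>\<in>space Q. M 0 \<omega> = 0) \<and> fv_process Q F A \<and>
      (AE \<omega> in Q. \<forall>t\<ge>0. X t \<omega> = X 0 \<omega> + M t \<omega> + A t \<omega>))"

definition semimartingale ::
    "'w measure \<Rightarrow> (real \<Rightarrow> 'w measure) \<Rightarrow> (real \<Rightarrow> 'w \<Rightarrow> 'a::euclidean_space) \<Rightarrow> bool" where
  "semimartingale Q F X \<longleftrightarrow> (\<forall>i\<in>Basis. real_semimartingale Q F (\<lambda>t \<omega>. X t \<omega> \<bullet> i))"

text \<open>\<open>N\<close> is (a version of) the continuous martingale part of the real semimartingale \<open>X\<close>.\<close>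

definition continuous_martingale_part ::
    "'w measure \<Rightarrow> (real \<Rightarrow> 'w measure) \<Rightarrow> (real \<Rightarrow> 'w \<Rightarrow> real) \<Rightarrow> (real \<Rightarrow> 'w \<Rightarrow> real) \<Rightarrow> bool" where
  "continuous_martingale_part Q F X N \<longleftrightarrow>
    continuous_local_martingale Q F N \<and> (\<forall>\<omega>\<in>space Q. N 0 \<omega> = 0) \<and>
    (\<exists>M A. purely_discontinuous Q F M \<and> fv_process Q F A \<and>
      (AE \<omega> in Q. \<forall>t\<ge>0. X t \<omega> = X 0 \<omega> + N t \<omega> + M t \<omega> + A t \<omega>))"


section \<open>Semimartingale characteristics\<close>

definition predictable_sigma ::
    "'w measure \<Rightarrow> (real \<Rightarrow> 'w measure) \<Rightarrow> (real \<times> 'w) measure" where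
  "predictable_sigma Q F = sigma ({0..} \<times> space Q)
    ({{0} \<times> A | A. A \<in> sets (F 0)} \<union> {{s<..t} \<times> A | s t A. 0 \<le> s \<and> s \<le> t \<and> A \<in> sets (F s)})"

definition predictable ::
    "'w measure \<Rightarrow> (real \<Rightarrow> 'w measure) \<Rightarrow> (real \<Rightarrow> 'w \<Rightarrow> 'a::topological_space) \<Rightarrow> bool" where
  "predictable Q F X \<longleftrightarrow> (\<lambda>(t, \<omega>). X t \<omega>) \<in> borel_measurable (predictable_sigma Q F)"

definition predictable_covariation ::
    "'w measure \<Rightarrow> (real \<Rightarrow> 'w measure) \<Rightarrow> (real \<Rightarrow> 'w \<Rightarrow> real) \<Rightarrow> (real \<Rightarrow> 'w \<Rightarrow> real) \<Rightarrow>
      (real \<Rightarrow> 'w \<Rightarrow> real) \<Rightarrow> bool" where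
  "predictable_covariation Q F M N C \<longleftrightarrow> predictable Q F C \<and> fv_process Q F C \<and>
    local_martingale Q F (\<lambda>t \<omega>. M t \<omega> * N t \<omega> - C t \<omega>)"

text \<open>
  The jump characteristic is the predictable compensator \<open>\<nu>\<close> of the jump measure
  \<open>\<mu> = \<Sum>s>0. [\<Delta>X\<^sub>s \<noteq> 0] \<delta>\<^bsub>(s, \<Delta>X\<^sub>s)\<^esub>\<close>, i.e. the predictable random measure with
  \<open>E[W * \<mu>] = E[W * \<nu>]\<close> for all nonnegative predictable functions \<open>W\<close>. The following says that
  it is given by a predictable kernel, \<open>\<nu>(\<omega>; dt, d\<xi>) = K t \<omega> (d\<xi>) dt\<close>.
\<close>

definition jump_characteristic ::
    "'w measure \<Rightarrow> (real \<Rightarrow> 'w measure) \<Rightarrow> (real \<Rightarrow> 'w \<Rightarrow> 'a::euclidean_space) \<Rightarrow>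
      (real \<Rightarrow> 'w \<Rightarrow> 'a measure) \<Rightarrow> bool" where
  "jump_characteristic Q F X K \<longleftrightarrow>
    (\<forall>t\<ge>0. \<forall>\<omega>\<in>space Q. sets (K t \<omega>) = sets borel) \<and>
    (\<forall>A\<in>sets borel. predictable Q F (\<lambda>t \<omega>. emeasure (K t \<omega>) A)) \<and>
    (\<forall>W :: (real \<times> 'w) \<times> 'a \<Rightarrow> ennreal.
      W \<in> borel_measurable (predictable_sigma Q F \<Otimes>\<^sub>M borel) \<longrightarrow>
      (\<integral>\<^sup>+\<omega>. (\<integral>\<^sup>+s. W ((s, \<omega>), jump (\<lambda>r. X r \<omega>) s) * indicator (jump_times (\<lambda>r. X r \<omega>)) s
          \<partial>count_space {0<..}) \<partial>Q) =
      (\<integral>\<^sup>+\<omega>. (\<integral>\<^sup>+s. (\<integral>\<^sup>+\<xi>. W ((s, \<omega>), \<xi>) \<partial>K s \<omega>) * indicator {0..} s \<partial>lborel) \<partial>Q))"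

definition truncation_function :: "('a::euclidean_space \<Rightarrow> 'a) \<Rightarrow> bool" where
  "truncation_function h \<longleftrightarrow>
    h \<in> borel_measurable borel \<and> bounded (range h) \<and> (\<forall>\<^sub>F \<xi> in nhds 0. h \<xi> = \<xi>)"

text \<open>
  The process \<open>X(h) = X - (\<Sum>s\<le>\<cdot>. \<Delta>X\<^sub>s - h(\<Delta>X\<^sub>s))\<close>; along a cadlag path only finitely many
  summands are nonzero, and the sum is restricted to these.
\<close>

definition big_jumps_removed ::
    "('a::euclidean_space \<Rightarrow> 'a) \<Rightarrow> (real \<Rightarrow> 'w \<Rightarrow> 'a) \<Rightarrow> real \<Rightarrow> 'w \<Rightarrow> 'a" where
  "big_jumps_removed h X t \<omega> = X t \<omega> -
    (let \<Delta> = jump (\<lambda>r. X r \<omega>) in \<Sum>s\<in>{s. 0 < s \<and> s \<le> t \<and> h (\<Delta> s) \<noteq> \<Delta> s}. \<Delta> s - h (\<Delta> s))"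

text \<open>
  \<open>(B, C, \<nu>)\<close> with \<open>\<nu>(dt, d\<xi>) = K t (d\<xi>) dt\<close> are the characteristics of \<open>X\<close> relative to \<open>h\<close>.
  Matrices are given by their entries, with indices running through \<^const>\<open>Basis\<close>.
\<close>

definition characteristics ::
    "'w measure \<Rightarrow> (real \<Rightarrow> 'w measure) \<Rightarrow> ('a::euclidean_space \<Rightarrow> 'a) \<Rightarrow> (real \<Rightarrow> 'w \<Rightarrow> 'a) \<Rightarrow>
      (real \<Rightarrow> 'w \<Rightarrow> 'a) \<Rightarrow> ('a \<Rightarrow> 'a \<Rightarrow> real \<Rightarrow> 'w \<Rightarrow> real) \<Rightarrow> (real \<Rightarrow> 'w \<Rightarrow> 'a measure) \<Rightarrow> bool" where
  "characteristics Q F h X B C K \<longleftrightarrow>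
    truncation_function h \<and> semimartingale Q F X \<and>
    (\<forall>i\<in>Basis. predictable Q F (\<lambda>t \<omega>. B t \<omega> \<bullet> i) \<and> fv_process Q F (\<lambda>t \<omega>. B t \<omega> \<bullet> i) \<and>
      local_martingale Q F (\<lambda>t \<omega>. (big_jumps_removed h X t \<omega> - X 0 \<omega> - B t \<omega>) \<bullet> i)) \<and>
    (\<exists>N. (\<forall>i\<in>Basis. continuous_martingale_part Q F (\<lambda>t \<omega>. X t \<omega> \<bullet> i) (N i)) \<and>
      (\<forall>i\<in>Basis. \<forall>j\<in>Basis. predictable_covariation Q F (N i) (N j) (C i j))) \<and>
    jump_characteristic Q F X K"


section \<open>Signed Radon measures on the punctured space\<close>

text \<open>
  Measures on the space without the origin are represented as Borel measures on the whole space
  without mass at the origin. A difference of two measures that are finite on compact sets is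
  defined only on relatively compact Borel sets; as a function on all sets it is extended by 0.
\<close>

definition relcompact_sets :: "'a::euclidean_space set set" where
  "relcompact_sets = {A \<in> sets borel. compact (closure A) \<and> 0 \<notin> closure A}"

definition radon_measure :: "'a::euclidean_space measure \<Rightarrow> bool" where
  "radon_measure \<mu> \<longleftrightarrow> sets \<mu> = sets borel \<and> emeasure \<mu> {0} = 0 \<and>
    (\<forall>A. compact A \<and> 0 \<notin> A \<longrightarrow> emeasure \<mu> A < \<infinity>)"

definition signed_radon :: "('a::euclidean_space set \<Rightarrow> real) set" where
  "signed_radon = {m. \<exists>\<mu> \<nu>. radon_measure \<mu> \<and> radon_measure \<nu> \<and>
    m = (\<lambda>A. if A \<in> relcompact_sets then measure \<mu> A - measure \<nu> A else 0)}"

definition dirac :: "'a::euclidean_space \<Rightarrow> 'a set \<Rightarrow> real" where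
  "dirac u A = (if A \<in> relcompact_sets then indicator A u else 0)"

text \<open>The positive measure represented by a nonnegative element of \<^const>\<open>signed_radon\<close>.\<close>

definition pos_measure :: "('a::euclidean_space set \<Rightarrow> real) \<Rightarrow> 'a measure" where
  "pos_measure m = (THE \<mu>. radon_measure \<mu> \<and>
    (\<forall>A\<in>relcompact_sets. emeasure \<mu> A = ennreal (m A)))"

definition jump_kernel_measure :: "('a::euclidean_space set \<Rightarrow> real) \<Rightarrow> bool" where
  "jump_kernel_measure m \<longleftrightarrow> m \<in> signed_radon \<and> (\<forall>A. 0 \<le> m A) \<and>
    (\<integral>\<^sup>+\<xi>. ennreal (min ((norm \<xi>)\<^sup>2) 1) \<partial>pos_measure m) < \<infinity>"

definition measure_support :: "'a::topological_space measure \<Rightarrow> 'a set" where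
  "measure_support \<mu> = {\<xi>. \<forall>U. open U \<and> \<xi> \<in> U \<longrightarrow> 0 < emeasure \<mu> U}"


section \<open>Affine processes\<close>

definition affine_map :: "('a::real_vector \<Rightarrow> 'b::real_vector) \<Rightarrow> bool" where
  "affine_map f \<longleftrightarrow> (\<exists>L a. linear L \<and> f = (\<lambda>x. L x + a))"

text \<open>The vector space structure of \<^const>\<open>signed_radon\<close> is pointwise.\<close>

definition affine_kernel :: "('a::real_vector \<Rightarrow> 'b::euclidean_space set \<Rightarrow> real) \<Rightarrow> bool" where
  "affine_kernel K \<longleftrightarrow> (\<forall>x. K x \<in> signed_radon) \<and> (\<forall>A. affine_map (\<lambda>x. K x A))"

definition pos_semidef :: "('a::euclidean_space \<Rightarrow> 'a \<Rightarrow> real) \<Rightarrow> bool" where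
  "pos_semidef m \<longleftrightarrow> (\<forall>v. 0 \<le> (\<Sum>i\<in>Basis. \<Sum>j\<in>Basis. (v \<bullet> i) * m i j * (v \<bullet> j)))"

definition unit_truncation :: "'a::euclidean_space \<Rightarrow> 'a" where
  "unit_truncation \<xi> = (if norm \<xi> \<le> 1 then \<xi> else 0)"

text \<open>
  Under every probability measure in \<open>\<Q>\<close>, the process \<open>X\<close> has the characteristics given by the
  affine triplet \<open>(b, c, K)\<close>, admissible on the state space \<open>D\<close>. Changing the truncation function
  changes \<open>b\<close> by an affine map, so one truncation function may be fixed.
\<close>

definition affine_triplet ::
    "(real \<Rightarrow> 'w measure) \<Rightarrow> 'w measure set \<Rightarrow> 'a::euclidean_space set \<Rightarrow> (real \<Rightarrow> 'w \<Rightarrow> 'a) \<Rightarrow>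
      ('a \<Rightarrow> 'a) \<Rightarrow> ('a \<Rightarrow> 'a \<Rightarrow> 'a \<Rightarrow> real) \<Rightarrow> ('a \<Rightarrow> 'a set \<Rightarrow> real) \<Rightarrow> bool" where
  "affine_triplet F \<Q> D X b c K \<longleftrightarrow>
    affine_map b \<and>
    (\<forall>i\<in>Basis. \<forall>j\<in>Basis. affine_map (\<lambda>x. c x i j) \<and> (\<forall>x. c x i j = c x j i)) \<and>
    affine_kernel K \<and>
    (\<forall>x\<in>D. pos_semidef (c x) \<and> jump_kernel_measure (K x)) \<and>
    (\<forall>Q\<in>\<Q>. characteristics (completion Q) (augment Q F) unit_truncation X
      (\<lambda>t \<omega>. LBINT s:{0..t}. b (left_lim (\<lambda>r. X r \<omega>) s))
      (\<lambda>i j t \<omega>. LBINT s:{0..t}. c (left_lim (\<lambda>r. X r \<omega>) s) i j)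
      (\<lambda>t \<omega>. pos_measure (K (left_lim (\<lambda>r. X r \<omega>) t))))"

text \<open>The standing setting for the process \<open>X\<close> and the family of measures \<open>P x\<close>, \<open>x \<in> E\<close>.\<close>

definition semimartingale_family ::
    "'w measure \<Rightarrow> (real \<Rightarrow> 'w measure) \<Rightarrow> 'a::euclidean_space set \<Rightarrow> ('a \<Rightarrow> 'w measure) \<Rightarrow>
      (real \<Rightarrow> 'w \<Rightarrow> 'a) \<Rightarrow> bool" where
  "semimartingale_family M F E P X \<longleftrightarrow>
    filtration (space M) F \<and> (\<forall>t\<ge>0. subalgebra M (F t)) \<and>
    (\<forall>t\<ge>0. sets (F t) = (\<Inter>s\<in>{t<..}. sets (F s))) \<and>
    E \<noteq> {} \<and> E \<in> sets borel \<and>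
    adapted F X \<and> (\<forall>\<omega>\<in>space M. cadlag (\<lambda>t. X t \<omega>) \<and> (\<forall>t\<ge>0. X t \<omega> \<in> E)) \<and>
    (\<forall>x\<in>E. sets (P x) = sets M \<and> prob_space (P x) \<and> (AE \<omega> in P x. X 0 \<omega> = x) \<and>
      semimartingale (completion (P x)) (augment (P x) F) X)"

definition affine_process ::
    "'w measure \<Rightarrow> (real \<Rightarrow> 'w measure) \<Rightarrow> 'a::euclidean_space set \<Rightarrow> ('a \<Rightarrow> 'w measure) \<Rightarrow>
      (real \<Rightarrow> 'w \<Rightarrow> 'a) \<Rightarrow> ('a \<Rightarrow> 'a) \<Rightarrow> ('a \<Rightarrow> 'a \<Rightarrow> 'a \<Rightarrow> real) \<Rightarrow> ('a \<Rightarrow> 'a set \<Rightarrow> real) \<Rightarrow> bool" where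
  "affine_process M F E P X b c K \<longleftrightarrow>
    semimartingale_family M F E P X \<and> affine_triplet F (P ` E) E X b c K"

text \<open>
  Time-homogeneous Markov property with respect to \<open>F\<close>, with one transition function on the state
  space \<open>D\<close> for all measures in \<open>\<Q>\<close>.
\<close>

definition markov_process ::
    "(real \<Rightarrow> 'w measure) \<Rightarrow> 'w measure set \<Rightarrow> 'a::euclidean_space set \<Rightarrow> (real \<Rightarrow> 'w \<Rightarrow> 'a) \<Rightarrow> bool" where
  "markov_process F \<Q> D Y \<longleftrightarrow>
    (\<exists>p. (\<forall>t\<ge>0. p t \<in> measurable (restrict_space borel D) (prob_algebra (restrict_space borel D))) \<and>
      (\<forall>Q\<in>\<Q>. \<forall>s\<ge>0. \<forall>t\<ge>0. \<forall>A\<in>sets (restrict_space borel D).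
        AE \<omega> in Q. real_cond_exp Q (F s) (\<lambda>\<omega>. indicator A (Y (s + t) \<omega>)) \<omega> = measure (p t (Y s \<omega>)) A))"

definition jump_sizes :: "'a::euclidean_space set \<Rightarrow> ('a \<Rightarrow> 'a set \<Rightarrow> real) \<Rightarrow> 'a set" where
  "jump_sizes E K = (\<Union>x\<in>E. measure_support (pos_measure (K x))) - {0}"

definition jump_counter :: "'a::euclidean_space set \<Rightarrow> 'a \<Rightarrow> ('a \<Rightarrow> real) \<Rightarrow> bool" where
  "jump_counter E u \<psi> \<longleftrightarrow> affine_map \<psi> \<and> \<psi> \<noteq> (\<lambda>x. 0) \<and> (\<forall>x\<in>E. 0 \<le> \<psi> x) \<and>
    (\<forall>x\<in>E. 0 < \<psi> x \<longrightarrow> x + u \<in> E)"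

definition normalized_jump_counter ::
    "'a::euclidean_space set \<Rightarrow> ('a \<Rightarrow> 'a set \<Rightarrow> real) \<Rightarrow> ('a \<Rightarrow> real) \<Rightarrow> bool" where
  "normalized_jump_counter E K \<psi> \<longleftrightarrow>
    (\<exists>u\<in>jump_sizes E K. jump_counter E u \<psi> \<and> \<psi> u - \<psi> 0 = -1)"

text \<open>
  The two-dimensional process \<open>X = (Y, Z)\<close> whose first component is a jump counter. All hypotheses
  of the theorem are collected here because they are used both universally and existentially.
\<close>

definition jump_counter_setting ::
    "'w measure \<Rightarrow> (real \<Rightarrow> 'w measure) \<Rightarrow> (real \<times> real) set \<Rightarrow> (real \<times> real \<Rightarrow> 'w measure) \<Rightarrow>
      (real \<Rightarrow> 'w \<Rightarrow> real \<times> real) \<Rightarrow> nat \<Rightarrow> real \<Rightarrow> real \<Rightarrow> bool" where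
  "jump_counter_setting M F E P X N \<alpha> \<beta> \<longleftrightarrow>
    (let Y = (\<lambda>t \<omega>. fst (X t \<omega>)); Z = (\<lambda>t \<omega>. snd (X t \<omega>)) in
      N \<noteq> 0 \<and> 0 < \<alpha> \<and> 0 \<le> \<beta> \<and>
      compact E \<and> E \<subseteq> \<nat> \<times> UNIV \<and> affine hull E = UNIV \<and>
      (\<exists>b c K. affine_process M F E P X b c K \<and> normalized_jump_counter E K fst) \<and>
      fst ` E = real ` {0..N} \<and>
      (\<exists>b c. affine_triplet F (P ` E) (fst ` E) Y b c
        (\<lambda>y A. y * \<alpha> * dirac (-1) A + (real N - y) * \<beta> * dirac 1 A)) \<and>
      markov_process F (P ` E) (fst ` E) Y \<and>
      (\<forall>x\<in>E. AE \<omega> in P x. jump_times (\<lambda>t. Z t \<omega>) \<subseteq> jump_times (\<lambda>t. Y t \<omega>)) \<and>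
      (\<exists>K\<^sub>Z :: real \<Rightarrow> real set \<Rightarrow> real. affine_kernel K\<^sub>Z \<and>
        (\<forall>y\<in>fst ` E. jump_kernel_measure (K\<^sub>Z y)) \<and>
        (\<forall>x\<in>E. jump_characteristic (completion (P x)) (augment (P x) F) Z
          (\<lambda>t \<omega>. pos_measure (K\<^sub>Z (left_lim (\<lambda>r. Y r \<omega>) t))))))"

definition continuous_process ::
    "(real \<times> real) set \<Rightarrow> (real \<times> real \<Rightarrow> 'w measure) \<Rightarrow> (real \<Rightarrow> 'w \<Rightarrow> real) \<Rightarrow> bool" where
  "continuous_process E P Z \<longleftrightarrow> (\<forall>x\<in>E. AE \<omega> in P x. continuous_on {0..} (\<lambda>t. Z t \<omega>))"

end

theory Submission
  imports Defs
begin

text \<open>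
  Comparing compensators of jumps from states near a given \<open>x \<in> E\<close> transfers pathwise relations
  between the jumps of \<open>X\<close>, \<open>Y\<close> and \<open>Z\<close> to the jump kernels at \<open>x\<close>. Hence the kernel of \<open>X\<close> at
  \<open>x = (y, z)\<close> lives on \<open>{-1, 1} \<times> \<real>\<close>. Its part on \<open>{-1} \<times> \<real>\<close> vanishes for \<open>y = 0\<close>; since the
  fibre of \<open>E\<close> over 0 has at least two points, affinity gives a kernel \<open>y m\<^sub>-\<close> independent of \<open>z\<close>.
  As the jump kernel of \<open>Z\<close> does not depend on \<open>z\<close> either, the part on \<open>{1} \<times> \<real>\<close> is
  \<open>(N - y) m\<^sub>+\<close>. Let \<open>u = (-1, \<zeta>\<^sub>0)\<close> be the jump size of the counter. Every \<open>\<zeta>\<close> in the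
  support of \<open>m\<^sub>+\<close> shifts each fibre of \<open>E\<close> into the next one, and \<open>\<zeta>\<^sub>0\<close> shifts it back; a bounded
  fibre admits no proper translation into itself, so \<open>\<zeta> = - \<zeta>\<^sub>0\<close>. In the same way \<open>m\<^sub>-\<close> is carried
  by \<open>\<zeta>\<^sub>0\<close>, and \<open>Z + \<zeta>\<^sub>0 Y\<close> has no jumps. For \<open>\<beta> = 0\<close> the process \<open>Y\<close> has no upward jumps, so it
  jumps at most \<open>Y\<^sub>0\<close> times. The example is the process that jumps from \<open>(1, 0)\<close> to \<open>(0, 1)\<close> at an
  exponential time.
\<close>

section \<open>Nonnegative signed Radon measures\<close>

text \<open>Characteristics give information only in the mean: a compensator determines expected
  integrals over time, while the claim concerns supports of kernels at single states. The bridge is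
  that \<open>K x A\<close> is affine, hence continuous, in \<open>x\<close>, that the process can
  be started at every \<open>x\<close> of \<open>E\<close>, and that it stays near \<open>x\<close>
  for a positive time. Working on relatively compact sets is forced, since a signed Radon measure is
  a genuine set function only there; compactness of \<open>E\<close> bounds all jumps, so no mass is
  lost. The delicate point is the kernel of \<open>Z\<close>: it does not see jumps of
  \<open>Y\<close> that leave \<open>Z\<close> unchanged. The rate of upward jumps with second
  coordinate near 0 is therefore recovered from the total rate \<open>(N - y) * \<beta>\<close>.
  Almost sure conclusions need a device of their own: a measurable event is placed between the
  absence of forbidden jumps and the wanted property of the path. In the example a third, absorbing
  state \<open>(0, 0)\<close> makes the affine hull the whole plane. One jump time serves all
  initial states, because its nonpositive values encode the constant paths.\<close>

definition annulus :: "nat \<Rightarrow> 'a::euclidean_space set" where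
  "annulus n = {x. inverse (real (Suc n)) \<le> norm x \<and> norm x \<le> real (Suc n)}"

lemma incseq_annulus: "incseq (annulus :: nat \<Rightarrow> 'a::euclidean_space set)"
proof (rule incseq_SucI, unfold annulus_def, safe)
  fix n :: nat and x :: 'a
  assume *: "inverse (real (Suc n)) \<le> norm x" "norm x \<le> real (Suc n)"
  have "inverse (real (Suc (Suc n))) \<le> inverse (real (Suc n))"
    by (rule le_imp_inverse_le) auto
  with * show "inverse (real (Suc (Suc n))) \<le> norm x" by linarith
  show "norm x \<le> real (Suc (Suc n))" using * by simp
qed

lemma compact_annulus: "compact (annulus n :: 'a::euclidean_space set)"
proof -
  have "annulus n = cball 0 (real (Suc n)) \<inter> {x::'a. inverse (real (Suc n)) \<le> norm x}"
    by (auto simp: annulus_def)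
  moreover have "closed {x::'a. inverse (real (Suc n)) \<le> norm x}"
    by (intro closed_Collect_le continuous_intros)
  ultimately show ?thesis by (simp add: compact_Int_closed)
qed

lemma zero_notin_annulus: "0 \<notin> annulus n"
  by (simp add: annulus_def)

lemma annulus_borel [measurable]: "annulus n \<in> sets (borel :: 'a::euclidean_space measure)"
  by (intro borel_closed compact_imp_closed compact_annulus)

lemma UN_annulus: "(\<Union>n. annulus n) = - {0 :: 'a::euclidean_space}"
proof (safe)
  fix x :: 'a assume "x \<notin> (\<Union>n. annulus n)"
  moreover have "\<exists>n. x \<in> annulus n" if "x \<noteq> 0"
  proof -
    have "0 < norm x" using that by simp
    then obtain k where k: "inverse (real (Suc k)) < norm x"
      using reals_Archimedean by blast
    obtain l where l: "norm x \<le> real l" using real_arch_simple by blast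
    have "inverse (real (Suc (max k l))) \<le> inverse (real (Suc k))"
      by (rule le_imp_inverse_le) auto
    moreover have "real l \<le> real (Suc (max k l))" by simp
    ultimately have "x \<in> annulus (max k l)"
      using k l unfolding annulus_def mem_Collect_eq by linarith
    then show ?thesis ..
  qed
  ultimately show "x = 0" by blast
qed (auto simp: annulus_def)

lemma relcompact_subset:
  "A \<in> sets borel \<Longrightarrow> A \<subseteq> B \<Longrightarrow> compact B \<Longrightarrow> 0 \<notin> B \<Longrightarrow> A \<in> relcompact_sets"
  unfolding relcompact_sets_def
  by (auto intro: compact_closure[THEN iffD2] bounded_subset compact_imp_bounded
      dest: closure_minimal[OF _ compact_imp_closed])

text \<open>A set whose compact closure omits 0 is bounded and has positive distance from 0; one
  index serves both bounds. So a set function on relatively compact sets is determined inside the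
  annuli.\<close>

lemma relcompact_imp_annulus:
  assumes "A \<in> relcompact_sets"
  shows "\<exists>n. A \<subseteq> annulus n"
proof -
  have c: "compact (closure A)" "0 \<notin> closure A" using assms by (auto simp: relcompact_sets_def)
  obtain e where e: "e > 0" "\<And>x. x \<in> closure A \<Longrightarrow> e \<le> dist 0 x"
    using separate_point_closed[OF closed_closure c(2)] by blast
  obtain b where b: "\<And>x. x \<in> closure A \<Longrightarrow> norm x \<le> b"
    using compact_imp_bounded[OF c(1)] unfolding bounded_iff by blast
  obtain k where k: "inverse (real (Suc k)) < e" using reals_Archimedean[OF e(1)] by auto
  obtain l where l: "b \<le> real l" using real_arch_simple by blast
  have "inverse (real (Suc (max k l))) \<le> inverse (real (Suc k))"
    by (rule le_imp_inverse_le) auto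
  have nb: "norm x \<le> b" "e \<le> norm x" if "x \<in> A" for x
    using e(2)[of x] b[of x] that closure_subset[of A] by (auto simp: dist_norm)
  then have "x \<in> annulus (max k l)" if "x \<in> A" for x :: 'a
  proof -
    have "real l \<le> real (Suc (max k l))" by simp
    then show ?thesis using k l nb[OF that] \<open>inverse (real (Suc (max k l))) \<le> inverse (real (Suc k))\<close> unfolding annulus_def mem_Collect_eq by linarith
  qed
  then show ?thesis by blast
qed

lemma relcompact_borel: "A \<in> relcompact_sets \<Longrightarrow> A \<in> sets borel"
  by (simp add: relcompact_sets_def)

lemma Int_annulus_relcompact: "A \<in> sets borel \<Longrightarrow> A \<inter> annulus n \<in> relcompact_sets"
  by (rule relcompact_subset[of _ "annulus n"]) (auto intro: compact_annulus simp: zero_notin_annulus)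

text \<open>The annuli increase to the punctured space, and the origin carries no mass.\<close>

lemma emeasure_radon_SUP:
  assumes "radon_measure \<mu>" "A \<in> sets borel"
  shows "emeasure \<mu> A = (SUP n. emeasure \<mu> (A \<inter> annulus n))"
proof -
  have s: "sets \<mu> = sets borel" and z: "emeasure \<mu> {0} = 0"
    using assms by (auto simp: radon_measure_def)
  have "emeasure \<mu> A = emeasure \<mu> (A - {0})"
    using emeasure_Diff_null_set[of "{0}" \<mu> A] s z assms(2) by (simp add: null_setsI)
  also have "A - {0} = (\<Union>n. A \<inter> annulus n)" using UN_annulus by blast
  also have "emeasure \<mu> \<dots> = (SUP n. emeasure \<mu> (A \<inter> annulus n))"
    using incseq_annulus s assms(2)
    by (intro SUP_emeasure_incseq[symmetric]) (auto simp: incseq_def)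
  finally show ?thesis .
qed

lemma radon_measure_eqI:
  assumes "radon_measure \<mu>" "radon_measure \<nu>"
    and "\<And>A. A \<in> relcompact_sets \<Longrightarrow> emeasure \<mu> A = emeasure \<nu> A"
  shows "\<mu> = \<nu>"
proof (rule measure_eqI)
  show "sets \<mu> = sets \<nu>" using assms by (simp add: radon_measure_def)
  fix A assume "A \<in> sets \<mu>"
  then have "A \<in> sets borel" using assms by (simp add: radon_measure_def)
  then show "emeasure \<mu> A = emeasure \<nu> A"
    unfolding emeasure_radon_SUP[OF assms(1) \<open>A \<in> sets borel\<close>]
      emeasure_radon_SUP[OF assms(2) \<open>A \<in> sets borel\<close>]
    by (simp add: assms(3) Int_annulus_relcompact)
qed

text \<open>\<open>pos_measure\<close> is a definite description, so exhibiting one Radon measure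
  with the right values suffices; uniqueness is \<open>radon_measure_eqI\<close>.\<close>

lemma pos_measure_eqI:
  assumes "radon_measure \<mu>" "\<And>A. A \<in> relcompact_sets \<Longrightarrow> emeasure \<mu> A = ennreal (m A)"
  shows "pos_measure m = \<mu>"
  unfolding pos_measure_def
  by (rule the_equality) (use assms in \<open>auto intro: radon_measure_eqI\<close>)

text \<open>Inside one annulus both measures of the difference are finite, so their countable
  additivity may be subtracted.\<close>

lemma signed_radon_sums:
  assumes m: "m \<in> signed_radon" and A: "range A \<subseteq> sets borel" "disjoint_family A"
  shows "(\<lambda>i. m (A i \<inter> annulus n)) sums m ((\<Union>i. A i) \<inter> annulus n)"
proof -
  obtain \<mu> \<nu> where r: "radon_measure \<mu>" "radon_measure \<nu>"
    and m: "m = (\<lambda>A. if A \<in> relcompact_sets then measure \<mu> A - measure \<nu> A else 0)"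
    using assms(1) by (auto simp: signed_radon_def)
  have *: "(\<lambda>i. measure \<rho> (A i \<inter> annulus n)) sums measure \<rho> (\<Union>i. A i \<inter> annulus n)"
    if \<rho>: "radon_measure \<rho>" for \<rho> :: "'a measure"
  proof (rule measure_UNION)
    have s: "sets \<rho> = sets borel" and "emeasure \<rho> (annulus n) < \<infinity>"
      using \<rho> compact_annulus zero_notin_annulus by (auto simp: radon_measure_def)
    moreover have "emeasure \<rho> (\<Union>i. A i \<inter> annulus n) \<le> emeasure \<rho> (annulus n)"
      by (rule emeasure_mono) (auto simp: s)
    ultimately show "emeasure \<rho> (\<Union>i. A i \<inter> annulus n) \<noteq> \<infinity>" by auto
    show "range (\<lambda>i. A i \<inter> annulus n) \<subseteq> sets \<rho>" using A(1) s by auto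
    show "disjoint_family (\<lambda>i. A i \<inter> annulus n)"
      using A(2) by (auto simp: disjoint_family_on_def)
  qed
  have "A i \<inter> annulus n \<in> relcompact_sets" for i using A(1) by (auto intro: Int_annulus_relcompact)
  moreover have "(\<Union>i. A i) \<inter> annulus n \<in> relcompact_sets"
    using A(1) by (intro Int_annulus_relcompact) auto
  ultimately show ?thesis
    using sums_diff[OF *[OF r(1)] *[OF r(2)]] by (simp add: m)
qed

lemma signed_radon_empty: "m \<in> signed_radon \<Longrightarrow> m {} = 0"
  by (auto simp: signed_radon_def)

lemma signed_radon_Un:
  assumes m: "m \<in> signed_radon" and A: "A \<in> relcompact_sets" "B \<in> relcompact_sets" "A \<inter> B = {}"
  shows "m (A \<union> B) = m A + m B"
proof -
  obtain \<mu> \<nu> where r: "radon_measure \<mu>" "radon_measure \<nu>"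
    and m: "m = (\<lambda>A. if A \<in> relcompact_sets then measure \<mu> A - measure \<nu> A else 0)"
    using assms(1) by (auto simp: signed_radon_def)
  have f: "emeasure \<rho> C \<noteq> \<infinity>" if \<rho>: "radon_measure \<rho>" and C: "C \<in> relcompact_sets" 
    for \<rho> :: "'a measure" and C
  proof -
    have "emeasure \<rho> C \<le> emeasure \<rho> (closure C)"
      by (rule emeasure_mono) (use \<rho> in \<open>auto simp: radon_measure_def closure_subset\<close>)
    also have "\<dots> < \<infinity>" using \<rho> C by (auto simp: radon_measure_def relcompact_sets_def)
    finally show ?thesis by auto
  qed
  have u: "A \<union> B \<in> relcompact_sets" using A by (auto simp: relcompact_sets_def)
  have "measure \<rho> (A \<union> B) = measure \<rho> A + measure \<rho> B" if \<rho>: "radon_measure \<rho>" for \<rho> :: "'a measure"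
    by (rule measure_Union) (use f[OF \<rho>] A relcompact_borel \<rho> in \<open>auto simp: radon_measure_def\<close>)
  then show ?thesis using r u A by (simp add: m)
qed

text \<open>No Jordan decomposition is used: nonnegativity makes \<open>m\<close> monotone, so its
  values on the pieces \<open>A \<inter> annulus n\<close> increase with \<open>n\<close>, and their
  supremum is a measure. It extends \<open>m\<close> because a relatively compact set already lies
  in one annulus.\<close>

lemma
  assumes m: "m \<in> signed_radon" and pos: "\<And>A. 0 \<le> m A"
  shows radon_pos_measure: "radon_measure (pos_measure m)"
    and emeasure_pos_measure: "A \<in> relcompact_sets \<Longrightarrow> emeasure (pos_measure m) A = ennreal (m A)"
proof -
  define \<Phi> where "\<Phi> A = (SUP n. ennreal (m (A \<inter> annulus n)))" for A
  define \<mu> where "\<mu> = measure_of UNIV (sets (borel :: 'a measure)) \<Phi>"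
  have mono: "m A \<le> m B" if "A \<in> relcompact_sets" "B \<in> relcompact_sets" "A \<subseteq> B" for A B
  proof -
    have "B - A \<in> relcompact_sets"
      using that closure_mono[of "B - A" B]
      by (auto simp: relcompact_sets_def intro: compact_closure[THEN iffD2] bounded_subset)
    moreover have "A \<union> (B - A) = B" using that(3) by blast
    ultimately show ?thesis using signed_radon_Un[OF m, of A "B - A"] that pos[of "B - A"] by auto
  qed
  have inc: "incseq (\<lambda>n. ennreal (m (A \<inter> annulus n)))" if "A \<in> sets borel" for A
  proof (rule incseq_SucI, intro ennreal_leI mono Int_annulus_relcompact that)
    show "A \<inter> annulus n \<subseteq> A \<inter> annulus (Suc n)" for n
      using incseq_SucD[OF incseq_annulus, of n] by blast
  qed
  have "countably_additive (sets borel) \<Phi>"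
  proof (rule countably_additiveI)
    fix A :: "nat \<Rightarrow> 'a set" assume A: "range A \<subseteq> sets borel" "disjoint_family A"
    \<comment> \<open>Sum and supremum may be interchanged because every summand increases with
      \<open>n\<close>.\<close>
    have "(\<Sum>i. \<Phi> (A i)) = (SUP n. \<Sum>i. ennreal (m (A i \<inter> annulus n)))"
      unfolding \<Phi>_def by (rule ennreal_suminf_SUP_eq) (use A(1) in \<open>auto intro: inc\<close>)
    also have "\<dots> = \<Phi> (\<Union>i. A i)"
      unfolding \<Phi>_def by (simp only: suminf_ennreal_eq[OF pos signed_radon_sums[OF m A]])
    finally show "(\<Sum>i. \<Phi> (A i)) = \<Phi> (\<Union>i. A i)" .
  qed
  moreover have "positive (sets borel) \<Phi>"
    using signed_radon_empty[OF m] by (simp add: positive_def \<Phi>_def)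
  ultimately have e: "emeasure \<mu> A = \<Phi> A" if "A \<in> sets borel" for A
    unfolding \<mu>_def using that sets.sigma_algebra_axioms[of "borel :: 'a measure"]
    by (intro emeasure_measure_of_sigma) auto
  have s: "sets \<mu> = sets borel" unfolding \<mu>_def
    using sets.sigma_sets_eq[of "borel :: 'a measure"] by (simp add: sets_measure_of)
  have rel: "emeasure \<mu> A = ennreal (m A)" if A: "A \<in> relcompact_sets" for A
  proof -
    obtain k where k: "A \<subseteq> annulus k" using relcompact_imp_annulus[OF A] by blast
    have b: "A \<in> sets borel" by (rule relcompact_borel[OF A])
    have "\<Phi> A = ennreal (m A)" unfolding \<Phi>_def
    proof (rule antisym)
      show "(SUP n. ennreal (m (A \<inter> annulus n))) \<le> ennreal (m A)"
        using A b by (intro SUP_least ennreal_leI mono Int_annulus_relcompact) auto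
      have "A \<inter> annulus k = A" using k by blast
      then show "ennreal (m A) \<le> (SUP n. ennreal (m (A \<inter> annulus n)))"
        by (metis UNIV_I SUP_upper)
    qed
    then show ?thesis by (simp add: e b)
  qed
  have "radon_measure \<mu>" unfolding radon_measure_def
  proof (intro conjI allI impI)
    have "{0::'a} \<inter> annulus n = {}" for n :: nat using zero_notin_annulus by auto
    then show "emeasure \<mu> {0} = 0" using signed_radon_empty[OF m] by (simp add: e \<Phi>_def)
    fix A :: "'a set" assume A: "compact A \<and> 0 \<notin> A"
    then have "A \<in> relcompact_sets"
      by (intro relcompact_subset[of _ A]) (auto intro: borel_compact)
    then show "emeasure \<mu> A < \<infinity>" by (simp add: rel)
  qed (rule s)
  moreover from this rel have "pos_measure m = \<mu>" by (rule pos_measure_eqI)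
  ultimately show "radon_measure (pos_measure m)"
    "A \<in> relcompact_sets \<Longrightarrow> emeasure (pos_measure m) A = ennreal (m A)"
    by (simp_all add: rel)
qed

lemma
  assumes "jump_kernel_measure m"
  shows sets_jump_kernel: "sets (pos_measure m) = sets borel"
    and emeasure_jump_kernel: "A \<in> relcompact_sets \<Longrightarrow> emeasure (pos_measure m) A = ennreal (m A)"
  using assms radon_pos_measure[of m] emeasure_pos_measure[of m]
  by (auto simp: jump_kernel_measure_def radon_measure_def)

section \<open>Cadlag paths\<close>

lemma left_lim_eqI:
  fixes f :: "real \<Rightarrow> 'a::t2_space"
  assumes "0 < t" "(f \<longlongrightarrow> l) (at_left t)"
  shows "left_lim f t = l"
  using assms tendsto_Lim[of "at_left t" f l] by (simp add: left_lim_def)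

lemma tendsto_left_lim:
  fixes f :: "real \<Rightarrow> 'a::t2_space"
  assumes "cadlag f" "0 < t"
  shows "(f \<longlongrightarrow> left_lim f t) (at_left t)"
  using assms left_lim_eqI unfolding cadlag_def by metis

lemma left_lim_0 [simp]: "left_lim f 0 = f 0"
  by (simp add: left_lim_def)

lemma jump_0 [simp]: "jump f 0 = 0"
  by (simp add: jump_def)

lemma eventually_at_left_gt: "c < t \<Longrightarrow> eventually (\<lambda>s. c < s \<and> s < t) (at_left (t::real))"
  unfolding eventually_at_left_field by auto

lemma left_lim_closed:
  fixes f :: "real \<Rightarrow> 'a::t2_space"
  assumes "cadlag f" "closed S" "\<And>t. 0 \<le> t \<Longrightarrow> f t \<in> S" "0 \<le> t"
  shows "left_lim f t \<in> S"
proof (cases "t = 0")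
  case False
  have "eventually (\<lambda>s. f s \<in> S) (at_left t)"
    using eventually_at_left_gt[of 0 t] False assms by (auto elim!: eventually_mono)
  then show ?thesis
    using Lim_in_closed_set[OF assms(2) _ _ tendsto_left_lim[OF assms(1)]] False assms(4) by simp
qed (use assms in auto)

lemma
  fixes f :: "real \<Rightarrow> 'a::t2_space" and g :: "'a \<Rightarrow> 'b::t2_space"
  assumes "cadlag f" "continuous_on UNIV g"
  shows cadlag_compose: "cadlag (\<lambda>t. g (f t))"
    and left_lim_compose: "0 \<le> t \<Longrightarrow> left_lim (\<lambda>t. g (f t)) t = g (left_lim f t)"
proof -
  have g: "((\<lambda>t. g (f t)) \<longlongrightarrow> g l) G" if "(f \<longlongrightarrow> l) G" for l G
    using continuous_on_tendsto_compose[OF assms(2) that] by simp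
  then show "cadlag (\<lambda>t. g (f t))" using assms(1) unfolding cadlag_def by blast
  show "left_lim (\<lambda>t. g (f t)) t = g (left_lim f t)" if "0 \<le> t"
  proof (cases "t = 0")
    case False
    then show ?thesis using that
      by (intro left_lim_eqI g tendsto_left_lim assms) auto
  qed simp
qed

lemma jump_linear:
  fixes f :: "real \<Rightarrow> 'a::real_normed_vector" and g :: "'a \<Rightarrow> 'b::real_normed_vector"
  assumes "cadlag f" "bounded_linear g" "0 \<le> t"
  shows "jump (\<lambda>t. g (f t)) t = g (jump f t)"
  using left_lim_compose[OF assms(1) linear_continuous_on[OF assms(2)] assms(3)]
  by (simp add: jump_def bounded_linear.linear[OF assms(2)] linear_diff)

lemma cadlag_continuous:
  fixes f :: "real \<Rightarrow> 'a::real_normed_vector"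
  assumes "cadlag f" "jump_times f = {}"
  shows "continuous_on {0..} f"
  unfolding continuous_on_eq_continuous_within
proof
  fix t :: real assume "t \<in> {0..}"
  then have t: "0 \<le> t" by simp
  have r: "(f \<longlongrightarrow> f t) (at_right t)" using assms(1) t by (auto simp: cadlag_def)
  show "continuous (at t within {0..}) f"
  proof (cases "t = 0")
    case True
    then show ?thesis using r by (simp add: continuous_within at_within_Ici_at_right)
  next
    case False
    have "left_lim f t = f t" using assms(2) t by (auto simp: jump_times_def jump_def)
    then have "(f \<longlongrightarrow> f t) (at_left t)" using tendsto_left_lim[OF assms(1), of t] False t by simp
    then have "(f \<longlongrightarrow> f t) (at t)" using r by (simp add: filterlim_split_at)
    then show ?thesis unfolding continuous_within by (rule tendsto_within_subset) simp
  qed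
qed

text \<open>At time 0 the left limit is the initial value by convention, so an interval including 0
  is controlled. This gives a positive occupation time near the starting point.\<close>

lemma left_lim_near_0:
  fixes f :: "real \<Rightarrow> 'a::metric_space"
  assumes "cadlag f" "0 < e"
  shows "\<exists>d>0. \<forall>t\<in>{0..d}. dist (left_lim f t) (f 0) \<le> e"
proof -
  have "eventually (\<lambda>t. dist (f t) (f 0) < e) (at_right 0)"
    using assms by (auto simp: cadlag_def intro: tendstoD)
  then obtain d where d: "d > 0" "\<And>t. 0 < t \<Longrightarrow> t < d \<Longrightarrow> dist (f t) (f 0) < e"
    unfolding eventually_at_right_field by auto
  have "dist (left_lim f t) (f 0) \<le> e" if t: "0 < t" "t < d" for t
  proof (rule tendsto_upperbound)
    show "((\<lambda>s. dist (f s) (f 0)) \<longlongrightarrow> dist (left_lim f t) (f 0)) (at_left t)"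
      by (intro tendsto_intros tendsto_left_lim assms t)
    show "eventually (\<lambda>s. dist (f s) (f 0) \<le> e) (at_left t)"
      using eventually_at_left_gt[OF t(1)] d t by (fastforce elim!: eventually_mono)
  qed simp
  moreover have "dist (left_lim f 0) (f 0) \<le> e" using assms(2) by simp
  ultimately have "\<forall>t\<in>{0..d/2}. dist (left_lim f t) (f 0) \<le> e"
    using d(1) by (force simp: le_less)
  then show ?thesis using d(1) half_gt_zero by blast
qed

section \<open>Predictability\<close>

text \<open>Conditions are imposed at nonnegative times only; this is what the setting provides for
  \<open>completion (P x)\<close> with the augmented filtration.\<close>

locale filtered =
  fixes Q :: "'w measure" and F :: "real \<Rightarrow> 'w measure"
  assumes space_F: "0 \<le> t \<Longrightarrow> space (F t) = space Q"
    and sets_F: "0 \<le> t \<Longrightarrow> sets (F t) \<subseteq> sets Q"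
    and sets_F_mono: "0 \<le> s \<Longrightarrow> s \<le> t \<Longrightarrow> sets (F s) \<subseteq> sets (F t)"
begin

lemma subalg: "0 \<le> t \<Longrightarrow> subalgebra Q (F t)"
  by (simp add: subalgebra_def space_F sets_F)

lemma adapted_measurable: "adapted F X \<Longrightarrow> 0 \<le> t \<Longrightarrow> X t \<in> borel_measurable Q"
  using measurable_from_subalg[OF subalg] by (auto simp: adapted_def)

lemma predictable_generators:
  "{{0} \<times> A | A. A \<in> sets (F 0)} \<union> {{s<..t} \<times> A | s t A. 0 \<le> s \<and> s \<le> t \<and> A \<in> sets (F s)}
    \<subseteq> Pow ({0..} \<times> space Q)"
proof -
  have "A \<subseteq> space Q" if "A \<in> sets (F t)" "0 \<le> t" for A t
    using sets.sets_into_space[OF that(1)] space_F[OF that(2)] by simp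
  then show ?thesis by force
qed

lemma space_predictable [simp]: "space (predictable_sigma Q F) = {0..} \<times> space Q"
  unfolding predictable_sigma_def using predictable_generators by (rule space_measure_of)

lemma sets_predictable:
  "sets (predictable_sigma Q F) = sigma_sets ({0..} \<times> space Q)
    ({{0} \<times> A | A. A \<in> sets (F 0)} \<union> {{s<..t} \<times> A | s t A. 0 \<le> s \<and> s \<le> t \<and> A \<in> sets (F s)})"
  unfolding predictable_sigma_def using predictable_generators by (rule sets_measure_of)

lemma predictable_setI:
  "A \<in> sets (F 0) \<Longrightarrow> {0} \<times> A \<in> sets (predictable_sigma Q F)"
  "0 \<le> s \<Longrightarrow> s \<le> t \<Longrightarrow> A \<in> sets (F s) \<Longrightarrow> {s<..t} \<times> A \<in> sets (predictable_sigma Q F)"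
  unfolding sets_predictable by (blast intro: sigma_sets.Basic)+

text \<open>The generators of the predictable sigma-algebra are measurable rectangles.\<close>

lemma measurable_predictable_section:
  assumes "f \<in> measurable (predictable_sigma Q F) N"
  shows "f \<in> measurable (restrict_space (borel \<Otimes>\<^sub>M Q) ({0..} \<times> space Q)) N"
proof -
  let ?R = "restrict_space (borel \<Otimes>\<^sub>M Q) ({0::real..} \<times> space Q)"
  have sp: "space ?R = {0..} \<times> space Q" by (auto simp: space_restrict_space space_pair_measure)
  have "sets (predictable_sigma Q F) \<subseteq> sets ?R"
    unfolding sets_predictable
  proof (rule sets.sigma_sets_subset'[of _ ?R, unfolded sp, simplified sp])
    show "{0..} \<times> space Q \<in> sets ?R" using sets.top[of ?R] sp by simp
    have Q: "A \<in> sets Q" "A \<subseteq> space Q" if "A \<in> sets (F t)" "0 \<le> t" for A t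
      using that sets_F sets.sets_into_space[OF that(1)] space_F[OF that(2)] by auto
    have "T \<times> A \<in> sets ?R" if "T \<in> sets borel" "T \<subseteq> {0..}" "A \<in> sets Q" for T :: "real set" and A
      using that sets.sets_into_space[OF that(3)]
      by (subst sets_restrict_space_iff) auto
    then show "{{0} \<times> A | A. A \<in> sets (F 0)} \<union>
        {{s<..t} \<times> A | s t A. 0 \<le> s \<and> s \<le> t \<and> A \<in> sets (F s)} \<subseteq> sets ?R"
      using Q greaterThanAtMost_subseteq_atLeastAtMost_iff by (auto 0 3 simp: subset_iff)
  qed
  moreover have "space ?R = space (predictable_sigma Q F)" by (simp add: sp)
  ultimately show ?thesis using assms by (auto simp: measurable_def)
qed

text \<open>The arguments are swapped and negative times cut off, so that the inner integral over
  \<open>lborel\<close> is measurable in \<open>\<omega>\<close>.\<close>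

lemma measurable_predictable_pair:
  fixes f :: "real \<times> 'w \<Rightarrow> ennreal"
  assumes "f \<in> borel_measurable (predictable_sigma Q F)"
  shows "(\<lambda>(\<omega>, t). f (t, \<omega>) * indicator {0..} t) \<in> borel_measurable (Q \<Otimes>\<^sub>M lborel)"
proof -
  have "(\<lambda>x. if x \<in> {0..} \<times> space Q then f x else 0) \<in> borel_measurable (borel \<Otimes>\<^sub>M Q)"
    using measurable_predictable_section[OF assms]
    by (subst (asm) measurable_restrict_space_iff) auto
  then have "(\<lambda>(\<omega>, t). (if (t, \<omega>) \<in> {0..} \<times> space Q then f (t, \<omega>) else 0)) \<in>
      borel_measurable (Q \<Otimes>\<^sub>M borel)"
    by (rule measurable_pair_swap)
  moreover have "(\<lambda>(\<omega>, t). f (t, \<omega>) * indicator {0..} t) \<in> borel_measurable (Q \<Otimes>\<^sub>M borel) \<longleftrightarrow>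
    (\<lambda>(\<omega>, t). (if (t, \<omega>) \<in> {0..} \<times> space Q then f (t, \<omega>) else 0)) \<in> borel_measurable (Q \<Otimes>\<^sub>M borel)"
    by (rule measurable_cong) (auto simp: space_pair_measure indicator_def)
  ultimately show ?thesis by (simp cong: measurable_cong_sets)
qed

text \<open>Sampling at the last grid point strictly before \<open>t\<close> gives a process that is
  constant in time on left-open intervals and known at their left ends, hence predictable. It
  converges to the left limit as the mesh shrinks.\<close>

lemma predictable_left_lim:
  fixes X :: "real \<Rightarrow> 'w \<Rightarrow> 'a::metric_space"
  assumes X: "adapted F X" and c: "\<And>\<omega>. \<omega> \<in> space Q \<Longrightarrow> cadlag (\<lambda>t. X t \<omega>)"
  shows "predictable Q F (\<lambda>t \<omega>. left_lim (\<lambda>r. X r \<omega>) t)"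
proof -
  \<comment> \<open>\<open>k n t / (n + 1)\<close> is the largest grid point strictly below
    \<open>t\<close>; a ceiling minus 1 replaces the floor to keep it strict. At
    \<open>t = 0\<close> the value -1 is cut to 0 by \<open>nat\<close>, which yields
    \<open>X 0\<close>.\<close>
  define k where "k n t = nat (\<lceil>t * real (Suc n)\<rceil> - 1)" for n and t :: real
  define s where "s n t = real (k n t) / real (Suc n)" for n t
  have "(\<lambda>(t, \<omega>). X (s n t) \<omega>) \<in> borel_measurable (predictable_sigma Q F)" for n
  proof (rule measurableI)
    fix B :: "'a set" assume B: "B \<in> sets borel"
    define D where "D j = {t. 0 \<le> t \<and> k n t = j}" for j
    define A where "A j = X (real j / real (Suc n)) -` B \<inter> space Q" for j
    have A: "A j \<in> sets (F (real j / real (Suc n)))" for j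
      using X B measurable_sets[of "X (real j / real (Suc n))" _ borel B]
      unfolding A_def adapted_def
      by (metis divide_nonneg_nonneg of_nat_0_le_iff space_F)
    have D0: "D 0 = {0} \<union> {0<..1 / real (Suc n)}"
      unfolding D_def k_def by (auto simp: field_simps ceiling_le_iff)
    have DS: "D (Suc j) = {real (Suc j) / real (Suc n)<..real (Suc (Suc j)) / real (Suc n)}" for j
    proof -
      have "k n t = Suc j \<longleftrightarrow> \<lceil>t * real (Suc n)\<rceil> = int j + 2" for t
        unfolding k_def by linarith
      also have "\<dots> t \<longleftrightarrow> real (Suc j) < t * real (Suc n) \<and> t * real (Suc n) \<le> real (Suc (Suc j))" for t
        by (simp add: ceiling_eq_iff) linarith
      finally show ?thesis
        unfolding D_def using less_le_trans[of 0 "real (Suc j) / real (Suc n)"]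
        by (auto simp: pos_divide_less_eq pos_le_divide_eq simp del: of_nat_Suc intro: less_imp_le)
           (metis divide_less_eq divide_pos_pos less_le_not_le less_trans linorder_not_le of_nat_0_less_iff zero_less_Suc)
    qed
    have "D j \<times> A j \<in> sets (predictable_sigma Q F)" for j
    proof (cases j)
      case 0
      have "{0} \<times> A 0 \<union> {0<..1 / real (Suc n)} \<times> A 0 \<in> sets (predictable_sigma Q F)"
        using A[of 0] by (intro sets.Un predictable_setI) auto
      then show ?thesis unfolding 0 D0 Sigma_Un_distrib1 .
    next
      case (Suc i)
      show ?thesis unfolding Suc DS
        by (intro predictable_setI) (use A[of "Suc i"] in \<open>auto simp: divide_right_mono simp del: of_nat_Suc\<close>)
    qed
    then have "(\<Union>j. D j \<times> A j) \<in> sets (predictable_sigma Q F)" by blast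
    also have "(\<Union>j. D j \<times> A j) = (\<lambda>(t, \<omega>). X (s n t) \<omega>) -` B \<inter> space (predictable_sigma Q F)"
      by (auto simp: D_def A_def s_def)
    finally show "(\<lambda>(t, \<omega>). X (s n t) \<omega>) -` B \<inter> space (predictable_sigma Q F) \<in> sets (predictable_sigma Q F)" .
  qed auto
  then have "(\<lambda>(t, \<omega>). left_lim (\<lambda>r. X r \<omega>) t) \<in> borel_measurable (predictable_sigma Q F)"
  proof (rule borel_measurable_LIMSEQ_metric)
    fix x assume "x \<in> space (predictable_sigma Q F)"
    then obtain t \<omega> where x: "x = (t, \<omega>)" "0 \<le> t" "\<omega> \<in> space Q" by auto
    show "(\<lambda>n. case x of (t, \<omega>) \<Rightarrow> X (s n t) \<omega>) \<longlonglongrightarrow> (case x of (t, \<omega>) \<Rightarrow> left_lim (\<lambda>r. X r \<omega>) t)"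
    proof (cases "t = 0")
      case True
      then show ?thesis by (simp add: x s_def k_def)
    next
      case False
      then have t: "0 < t" using x by simp
      have bd: "t - 1 / real (Suc n) \<le> s n t \<and> s n t < t" for n
      proof -
        have "0 < t * real (Suc n)" using t by simp
        then have "real (k n t) = of_int \<lceil>t * real (Suc n)\<rceil> - 1"
          unfolding k_def by (simp add: of_nat_nat)
        then have "t * real (Suc n) - 1 \<le> real (k n t)" "real (k n t) < t * real (Suc n)"
          by linarith+
        then have "(t * real (Suc n) - 1) / real (Suc n) \<le> real (k n t) / real (Suc n)"
            "real (k n t) / real (Suc n) < t * real (Suc n) / real (Suc n)"
          by (simp_all only: divide_right_mono divide_strict_right_mono of_nat_0_less_iff of_nat_0_le_iff zero_less_Suc)
        then show ?thesis unfolding s_def by (simp add: diff_divide_distrib del: of_nat_Suc)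
      qed
      have "(\<lambda>n. s n t) \<longlonglongrightarrow> t"
      proof (rule tendsto_sandwich[of "\<lambda>n. t - 1 / real (Suc n)" _ _ "\<lambda>_. t"])
        show "(\<lambda>n. t - 1 / real (Suc n)) \<longlonglongrightarrow> t"
          using tendsto_diff[OF tendsto_const LIMSEQ_inverse_real_of_nat, of t]
          by (simp add: inverse_eq_divide)
      qed (use bd in \<open>auto intro!: always_eventually less_imp_le simp del: of_nat_Suc\<close>)
      then have "filterlim (\<lambda>n. s n t) (at_left t) sequentially"
        unfolding filterlim_at using bd by (auto simp: less_le)
      from filterlim_compose[OF tendsto_left_lim[OF c[OF x(3)] t] this] show ?thesis
        by (simp add: x)
    qed
  qed
  then show ?thesis by (simp add: predictable_def)
qed

end

lemma rational_right:
  fixes f :: "real \<Rightarrow> 'a::metric_space"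
  assumes "cadlag f" "0 \<le> t" "0 < e" "0 < d"
  shows "\<exists>p::rat. t < real_of_rat p \<and> real_of_rat p < t + d \<and> dist (f (real_of_rat p)) (f t) < e"
proof -
  have "eventually (\<lambda>s. dist (f s) (f t) < e) (at_right t)"
    using assms by (auto simp: cadlag_def intro: tendstoD)
  then obtain b where b: "b > t" "\<And>s. t < s \<Longrightarrow> s < b \<Longrightarrow> dist (f s) (f t) < e"
    unfolding eventually_at_right_field by auto
  obtain p :: rat where "t < real_of_rat p" "real_of_rat p < min b (t + d)"
    using of_rat_dense[of t "min b (t + d)"] b(1) assms(4) by auto
  then show ?thesis using b(2) by auto
qed

lemma rational_left:
  fixes f :: "real \<Rightarrow> 'a::metric_space"
  assumes "cadlag f" "0 < t" "0 < e" "0 < d"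
  shows "\<exists>p::rat. 0 < real_of_rat p \<and> real_of_rat p < t \<and> t - d < real_of_rat p \<and>
    dist (f (real_of_rat p)) (left_lim f t) < e"
proof -
  have "eventually (\<lambda>s. dist (f s) (left_lim f t) < e) (at_left t)"
    using assms tendsto_left_lim[OF assms(1,2)] by (auto intro: tendstoD)
  then obtain b where b: "b < t" "\<And>s. b < s \<Longrightarrow> s < t \<Longrightarrow> dist (f s) (left_lim f t) < e"
    unfolding eventually_at_left_field by auto
  obtain p :: rat where "max 0 (max b (t - d)) < real_of_rat p" "real_of_rat p < t"
    using of_rat_dense[of "max 0 (max b (t - d))" t] b(1) assms by auto
  then show ?thesis using b(2) by auto
qed

text \<open>Supplies a measurable \<open>D\<close> as required by \<open>AE_no_jumps\<close>.
  Uniform continuity along rational times in bounded intervals is a countable condition; absence of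
  jumps implies it, and for cadlag paths it implies continuity.\<close>

lemma continuity_event:
  fixes V :: "real \<Rightarrow> 'w \<Rightarrow> real"
  assumes V: "\<And>t. 0 \<le> t \<Longrightarrow> V t \<in> borel_measurable Q"
    and c: "\<And>\<omega>. \<omega> \<in> space Q \<Longrightarrow> cadlag (\<lambda>t. V t \<omega>)"
  shows "\<exists>D. Measurable.pred Q D \<and>
    (\<forall>\<omega>\<in>space Q. jump_times (\<lambda>t. V t \<omega>) = {} \<longrightarrow> D \<omega>) \<and>
    (\<forall>\<omega>\<in>space Q. D \<omega> \<longrightarrow> continuous_on {0..} (\<lambda>t. V t \<omega>))"
proof (intro exI conjI ballI impI)
  define r where "r p = max 0 (real_of_rat p)" for p
  define D where "D \<omega> \<longleftrightarrow> (\<forall>T m. \<exists>n. \<forall>p q. r p \<le> real T \<and> r q \<le> real T \<and> \<bar>r p - r q\<bar> < 1 / real (Suc n)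
    \<longrightarrow> \<bar>V (r p) \<omega> - V (r q) \<omega>\<bar> \<le> 1 / real (Suc m))" for \<omega>
  have [measurable]: "V (r p) \<in> borel_measurable Q" for p by (intro V) (simp add: r_def)
  show "Measurable.pred Q D" unfolding D_def by measurable
  show "D \<omega>" if \<omega>: "\<omega> \<in> space Q" "jump_times (\<lambda>t. V t \<omega>) = {}" for \<omega>
    unfolding D_def
  proof (intro allI)
    fix T m :: nat
    have cont: "continuous_on {0..} (\<lambda>t. V t \<omega>)" by (rule cadlag_continuous[OF c[OF \<omega>(1)] \<omega>(2)])
    have "uniformly_continuous_on {0..real T} (\<lambda>t. V t \<omega>)"
      by (rule compact_uniformly_continuous) (auto intro: continuous_on_subset[OF cont])
    then obtain d where d: "d > 0" "\<And>s t. s \<in> {0..real T} \<Longrightarrow> t \<in> {0..real T} \<Longrightarrow> dist t s < d \<Longrightarrow>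
        dist (V t \<omega>) (V s \<omega>) < 1 / real (Suc m)"
      unfolding uniformly_continuous_on_def by (metis of_nat_0_less_iff zero_less_Suc zero_less_divide_1_iff)
    obtain n where "1 / real (Suc n) < d" using nat_approx_posE[OF d(1)] by metis
    then show "\<exists>n. \<forall>p q. r p \<le> real T \<and> r q \<le> real T \<and> \<bar>r p - r q\<bar> < 1 / real (Suc n)
      \<longrightarrow> \<bar>V (r p) \<omega> - V (r q) \<omega>\<bar> \<le> 1 / real (Suc m)"
      using d(2)[of "r _" "r _"]
      by (intro exI[of _ n]) (fastforce simp: dist_real_def r_def intro: less_imp_le less_trans)
  qed
  show "continuous_on {0..} (\<lambda>t. V t \<omega>)" if \<omega>: "\<omega> \<in> space Q" "D \<omega>" for \<omega>
  proof (rule cadlag_continuous[OF c[OF \<omega>(1)]], rule ccontr)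
    let ?f = "\<lambda>t. V t \<omega>"
    assume "jump_times ?f \<noteq> {}"
    then obtain s where s: "0 \<le> s" "jump ?f s \<noteq> 0" by (auto simp: jump_times_def)
    then have s0: "0 < s" by (cases "s = 0") auto
    \<comment> \<open>With a third of the jump, values within \<open>e\<close> of the two one-sided
      limits still differ by more than \<open>e\<close>, against the modulus at level
      \<open>1 / Suc m\<close>.\<close>
    define e where "e = \<bar>jump ?f s\<bar> / 3"
    have e: "0 < e" using s by (simp add: e_def)
    obtain m where m: "1 / real (Suc m) < e" using nat_approx_posE[OF e] by metis
    obtain T where T: "s + 1 \<le> real T" using real_arch_simple by blast
    obtain n where n: "\<And>p q. r p \<le> real T \<Longrightarrow> r q \<le> real T \<Longrightarrow> \<bar>r p - r q\<bar> < 1 / real (Suc n)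
        \<Longrightarrow> \<bar>V (r p) \<omega> - V (r q) \<omega>\<bar> \<le> 1 / real (Suc m)"
      using \<omega>(2) unfolding D_def by meson
    define d where "d = 1 / real (Suc n) / 2"
    have d: "0 < d" "2 * d = 1 / real (Suc n)" "d \<le> 1" by (auto simp: d_def field_simps)
    obtain p where p: "0 < real_of_rat p" "real_of_rat p < s" "s - d < real_of_rat p"
        "dist (?f (real_of_rat p)) (left_lim ?f s) < e"
      using rational_left[OF c[OF \<omega>(1)] s0 e d(1)] by blast
    obtain q where q: "s < real_of_rat q" "real_of_rat q < s + d" "dist (?f (real_of_rat q)) (?f s) < e"
      using rational_right[OF c[OF \<omega>(1)] s(1) e d(1)] by blast
    have rp: "r p = real_of_rat p" "r q = real_of_rat q" using p q s0 by (auto simp: r_def)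
    have "\<bar>?f (real_of_rat p) - ?f (real_of_rat q)\<bar> \<le> 1 / real (Suc m)"
      using n[of p q] p q d T unfolding rp by (simp add: abs_real_def)
    moreover have "3 * e = \<bar>?f s - left_lim ?f s\<bar>" by (simp add: e_def jump_def)
    ultimately show False using p(4) q(3) m unfolding dist_real_def by linarith
  qed
qed

section \<open>Integer-valued paths\<close>

text \<open>Consider the infimum \<open>u\<close> of the times at which \<open>f\<close> exceeds
  \<open>f s\<close>. If \<open>f u\<close> exceeds it, there is an upward jump at \<open>u\<close>;
  otherwise right continuity and integrality keep \<open>f\<close> at or below \<open>f u\<close>
  just after \<open>u\<close>.\<close>

lemma integer_path_antimono:
  fixes f :: "real \<Rightarrow> real"
  assumes f: "cadlag f" "\<And>t. 0 \<le> t \<Longrightarrow> f t \<in> \<int>" and j: "\<And>s. 0 < s \<Longrightarrow> jump f s \<le> 0"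
    and st: "0 \<le> s" "s \<le> t"
  shows "f t \<le> f s"
proof (rule ccontr)
  assume "\<not> f t \<le> f s"
  define S where "S = {u. s \<le> u \<and> u \<le> t \<and> f s < f u}"
  define u where "u = Inf S"
  have S: "t \<in> S" "bdd_below S" using \<open>\<not> f t \<le> f s\<close> st by (auto simp: S_def)
  have su: "s \<le> u" unfolding u_def using S by (intro cInf_greatest) (auto simp: S_def)
  have below: "f v \<le> f s" if "s \<le> v" "v < u" for v
    using that cInf_lower[OF _ S(2), of v] cInf_lower[OF S] unfolding S_def u_def by force
  show False
  proof (cases "f s < f u")
    case True
    then have u: "s < u" using su by (cases "s = u") auto
    have "left_lim f u \<le> f s"
    proof (rule tendsto_upperbound[OF tendsto_left_lim[OF f(1)]])
      show "eventually (\<lambda>v. f v \<le> f s) (at_left u)"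
        using eventually_at_left_gt[OF u] by (rule eventually_mono) (auto intro: below)
    qed (use u st in auto)
    then show False using j[of u] True u st by (simp add: jump_def)
  next
    case False
    have "(f \<longlongrightarrow> f u) (at_right u)" using f(1) su st by (auto simp: cadlag_def)
    then have "eventually (\<lambda>v. f v < f u + 1) (at_right u)" by (rule order_tendstoD) simp
    then obtain b where b: "b > u" "\<And>v. u < v \<Longrightarrow> v < b \<Longrightarrow> f v < f u + 1"
      unfolding eventually_at_right_field by auto
    obtain v where v: "v \<in> S" "v < b" using cInf_lessD[of S b] S b(1) unfolding u_def by auto
    have "u \<le> v" using cInf_lower[OF v(1) S(2)] by (simp add: u_def)
    then have "u < v" using v(1) False by (cases "u = v") (auto simp: S_def)
    then have "f v < f u + 1" "f v \<in> \<int>" "f u \<in> \<int>" using b v su st f(2) by auto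
    then have "f v \<le> f u" by (auto elim!: Ints_cases)
    then show False using v(1) False by (auto simp: S_def)
  qed
qed

text \<open>Every jump lowers the path by at least 1, and the path stays nonnegative. The bound for
  finite sets of jump times then excludes infinitely many of them.\<close>

lemma antimono_integer_path_jumps:
  fixes f :: "real \<Rightarrow> real"
  assumes f: "cadlag f" "\<And>t. 0 \<le> t \<Longrightarrow> f t \<in> \<nat>" and anti: "\<And>s t. 0 \<le> s \<Longrightarrow> s \<le> t \<Longrightarrow> f t \<le> f s"
  shows "finite (jump_times f) \<and> real (card (jump_times f)) \<le> f 0"
proof -
  \<comment> \<open>Strengthened for the induction on the largest element: jumps up to
    \<open>T\<close> are paid for by the decrease of \<open>f\<close> up to
    \<open>T\<close>.\<close>
  have step: "\<forall>T\<ge>0. (\<forall>x\<in>J. x \<le> T) \<longrightarrow> real (card J) \<le> f 0 - f T"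
    if "finite J" "J \<subseteq> jump_times f" for J
    using that
  proof (induction rule: finite_linorder_max_induct)
    case empty
    then show ?case using anti by auto
  next
    case (insert b J)
    have b: "0 \<le> b" "jump f b \<noteq> 0" using insert.prems by (auto simp: jump_times_def)
    then have b0: "0 < b" by (cases "b = 0") auto
    define m where "m = Max (insert 0 J)"
    have m: "0 \<le> m" "\<forall>x\<in>J. x \<le> m" "m < b" using insert.hyps b0 by (auto simp: m_def)
    have "eventually (\<lambda>u. f u \<noteq> f b) (at_left b)"
      by (rule tendsto_imp_eventually_ne[OF tendsto_left_lim[OF f(1) b0]]) (use b in \<open>auto simp: jump_def\<close>)
    then obtain c where c: "c < b" "\<And>u. c < u \<Longrightarrow> u < b \<Longrightarrow> f u \<noteq> f b"
      unfolding eventually_at_left_field by auto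
    \<comment> \<open>A time not before any earlier jump in \<open>J\<close> and so close to
      \<open>b\<close> that \<open>f u\<close> differs from \<open>f b\<close>; integrality turns
      the difference into at least 1.\<close>
    define u where "u = (max m c + b) / 2"
    have u: "m \<le> u" "c < u" "u < b" using m c by (auto simp: u_def)
    have "f u \<noteq> f b" "f b \<le> f u" "f u \<in> \<nat>" "f b \<in> \<nat>" using c(2)[of u] u m anti f(2) b0 by auto
    then have "f b + 1 \<le> f u" by (auto elim!: Nats_cases)
    moreover have "real (card J) \<le> f 0 - f u"
    proof (rule insert.IH[rule_format])
      show "J \<subseteq> jump_times f" "0 \<le> u" using insert.prems u m by auto
      show "x \<le> u" if "x \<in> J" for x using that m(2) u(1) by force
    qed
    moreover have "real (card (insert b J)) = real (card J) + 1"
      using insert.hyps by (subst card_insert_disjoint) auto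
    ultimately have *: "real (card (insert b J)) \<le> f 0 - f b" by linarith
    show ?case
    proof (intro allI impI)
      fix T assume "0 \<le> T" "\<forall>x\<in>insert b J. x \<le> T"
      then show "real (card (insert b J)) \<le> f 0 - f T" using anti[OF b(1), of T] * by simp
    qed
  qed
  have le: "real (card J) \<le> f 0" if J: "finite J" "J \<subseteq> jump_times f" for J
  proof -
    have "f (Max (insert 0 J)) \<in> \<nat>" using J by (intro f) auto
    then have "0 \<le> f (Max (insert 0 J))" by (auto elim!: Nats_cases)
    moreover have "real (card J) \<le> f 0 - f (Max (insert 0 J))"
      using step[OF J] J by auto
    ultimately show ?thesis by linarith
  qed
  have "finite (jump_times f)"
  proof (rule ccontr)
    assume "infinite (jump_times f)"
    moreover obtain n :: nat where "f 0 < real n" using reals_Archimedean2 by blast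
    ultimately obtain J where "finite J" "card J = n" "J \<subseteq> jump_times f"
      using infinite_arbitrarily_large by metis
    then show False using le[of J] \<open>f 0 < real n\<close> by simp
  qed
  then show ?thesis using le by blast
qed

text \<open>Another measurable \<open>D\<close> for \<open>AE_no_jumps\<close>: monotonicity is
  tested at rational times and extended by right continuity.\<close>

lemma antimono_event:
  fixes V :: "real \<Rightarrow> 'w \<Rightarrow> real"
  assumes V: "\<And>t. 0 \<le> t \<Longrightarrow> V t \<in> borel_measurable Q"
    and c: "\<And>\<omega>. \<omega> \<in> space Q \<Longrightarrow> cadlag (\<lambda>t. V t \<omega>)"
    and i: "\<And>\<omega> t. \<omega> \<in> space Q \<Longrightarrow> 0 \<le> t \<Longrightarrow> V t \<omega> \<in> \<int>"
  shows "\<exists>D. Measurable.pred Q D \<and>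
    (\<forall>\<omega>\<in>space Q. (\<forall>s>0. jump (\<lambda>t. V t \<omega>) s \<le> 0) \<longrightarrow> D \<omega>) \<and>
    (\<forall>\<omega>\<in>space Q. D \<omega> \<longrightarrow> (\<forall>s\<ge>0. \<forall>t\<ge>s. V t \<omega> \<le> V s \<omega>))"
proof (intro exI conjI ballI impI allI)
  define r where "r p = max 0 (real_of_rat p)" for p
  define D where "D \<omega> \<longleftrightarrow> (\<forall>p q. r p \<le> r q \<longrightarrow> V (r q) \<omega> \<le> V (r p) \<omega>)" for \<omega>
  have [measurable]: "V (r p) \<in> borel_measurable Q" for p by (intro V) (simp add: r_def)
  show "Measurable.pred Q D" unfolding D_def by measurable
  show "D \<omega>" if \<omega>: "\<omega> \<in> space Q" and j: "\<forall>s>0. jump (\<lambda>t. V t \<omega>) s \<le> 0" for \<omega>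
    unfolding D_def using integer_path_antimono[OF c[OF \<omega>] i[OF \<omega>]] j by (auto simp: r_def)
  show "V t \<omega> \<le> V s \<omega>" if \<omega>: "\<omega> \<in> space Q" "D \<omega>" and st: "0 \<le> s" "s \<le> t" for \<omega> s t
  proof (cases "s = t")
    case False
    show ?thesis
    proof (rule field_le_epsilon)
      fix e :: real assume e: "0 < e"
      have "0 < e / 2" "0 < t - s" "0 \<le> t" using e False st by auto
      from rational_right[OF c[OF \<omega>(1)] st(1) this(1,2)] rational_right[OF c[OF \<omega>(1)] this(3,1) zero_less_one]
      obtain p q where "s < real_of_rat p" "real_of_rat p < t" "\<bar>V (real_of_rat p) \<omega> - V s \<omega>\<bar> < e / 2"
         "t < real_of_rat q" "\<bar>V (real_of_rat q) \<omega> - V t \<omega>\<bar> < e / 2"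
        by (auto simp: dist_real_def)
      moreover from this have "V (real_of_rat q) \<omega> \<le> V (real_of_rat p) \<omega>"
        using \<omega>(2)[unfolded D_def, rule_format, of p q] st unfolding r_def
        by (simp only: max_absorb2)
      ultimately show "V t \<omega> \<le> V s \<omega> + e" by linarith
    qed
  qed simp
qed

section \<open>Comparison of jump kernels\<close>

context filtered
begin

lemma adapted_time: "adapted F (\<lambda>t \<omega>. t :: real)"
  by (simp add: adapted_def)

text \<open>The clock is its own left-limit process.\<close>

lemma predictable_time: "(\<lambda>(t, \<omega>). t) \<in> borel_measurable (predictable_sigma Q F)"
proof -
  have "cadlag (\<lambda>t. t :: real)" by (auto simp: cadlag_def)
  moreover from this have "left_lim (\<lambda>t. t) t = t" if "0 \<le> t" for t :: real
    using that by (cases "t = 0") (auto intro: left_lim_eqI)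
  ultimately have "(\<lambda>(t, \<omega>). left_lim (\<lambda>r. r :: real) t) \<in> borel_measurable (predictable_sigma Q F)"
    and "\<And>t. 0 \<le> t \<Longrightarrow> left_lim (\<lambda>r. r :: real) t = t"
    using predictable_left_lim[OF adapted_time] by (auto simp: predictable_def)
  then show ?thesis by (subst (asm) measurable_cong[where g = "\<lambda>(t, \<omega>). t"]) auto
qed

lemma predictable_near_set:
  fixes X :: "real \<Rightarrow> 'w \<Rightarrow> 'a::{metric_space, second_countable_topology}"
  assumes X: "adapted F X" and c: "\<And>\<omega>. \<omega> \<in> space Q \<Longrightarrow> cadlag (\<lambda>t. X t \<omega>)"
  shows "{(t, \<omega>) \<in> space (predictable_sigma Q F). t \<le> 1 \<and> dist (left_lim (\<lambda>r. X r \<omega>) t) x < d}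
    \<in> sets (predictable_sigma Q F)"
proof -
  note [measurable] = predictable_time predictable_left_lim[OF X c, unfolded predictable_def]
  have "{p \<in> space (predictable_sigma Q F). (\<lambda>(t, \<omega>). t) p \<le> 1 \<and>
      dist ((\<lambda>(t, \<omega>). left_lim (\<lambda>r. X r \<omega>) t) p) x < d} \<in> sets (predictable_sigma Q F)"
    by measurable
  also have "{p \<in> space (predictable_sigma Q F). (\<lambda>(t, \<omega>). t) p \<le> 1 \<and>
      dist ((\<lambda>(t, \<omega>). left_lim (\<lambda>r. X r \<omega>) t) p) x < d} =
    {(t, \<omega>) \<in> space (predictable_sigma Q F). t \<le> 1 \<and> dist (left_lim (\<lambda>r. X r \<omega>) t) x < d}"
    by auto
  finally show ?thesis .
qed

text \<open>Specializes the defining identity to the test function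
  \<open>indicator (G \<times> B)\<close>, the kind used in all comparisons of kernels.\<close>

lemma jump_characteristic_indicator:
  fixes V :: "real \<Rightarrow> 'w \<Rightarrow> 'b::euclidean_space"
  assumes V: "jump_characteristic Q F V K" and G: "G \<in> sets (predictable_sigma Q F)"
    and B: "B \<in> sets borel"
  shows "(\<integral>\<^sup>+\<omega>. (\<integral>\<^sup>+s. indicator G (s, \<omega>) * indicator B (jump (\<lambda>r. V r \<omega>) s) *
        indicator (jump_times (\<lambda>r. V r \<omega>)) s \<partial>count_space {0<..}) \<partial>Q) =
    (\<integral>\<^sup>+\<omega>. (\<integral>\<^sup>+s. indicator G (s, \<omega>) * emeasure (K s \<omega>) B * indicator {0..} s \<partial>lborel) \<partial>Q)"
proof -
  define W :: "(real \<times> 'w) \<times> 'b \<Rightarrow> ennreal" where "W = (\<lambda>((s, \<omega>), \<xi>). indicator G (s, \<omega>) * indicator B \<xi>)"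
  have "W = indicator (G \<times> B)" by (auto simp: W_def indicator_def fun_eq_iff)
  then have "W \<in> borel_measurable (predictable_sigma Q F \<Otimes>\<^sub>M borel)" using G B by simp
  then have "(\<integral>\<^sup>+\<omega>. (\<integral>\<^sup>+s. W ((s, \<omega>), jump (\<lambda>r. V r \<omega>) s) * indicator (jump_times (\<lambda>r. V r \<omega>)) s
          \<partial>count_space {0<..}) \<partial>Q) =
      (\<integral>\<^sup>+\<omega>. (\<integral>\<^sup>+s. (\<integral>\<^sup>+\<xi>. W ((s, \<omega>), \<xi>) \<partial>K s \<omega>) * indicator {0..} s \<partial>lborel) \<partial>Q)"
    using V unfolding jump_characteristic_def by blast
  also have "\<dots> = (\<integral>\<^sup>+\<omega>. (\<integral>\<^sup>+s. indicator G (s, \<omega>) * emeasure (K s \<omega>) B * indicator {0..} s \<partial>lborel) \<partial>Q)"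
  proof (intro nn_integral_cong)
    fix \<omega> and s :: real assume "\<omega> \<in> space Q"
    show "(\<integral>\<^sup>+\<xi>. W ((s, \<omega>), \<xi>) \<partial>K s \<omega>) * indicator {0..} s =
        indicator G (s, \<omega>) * emeasure (K s \<omega>) B * indicator {0..} s"
    proof (cases "0 \<le> s")
      case True
      then have "sets (K s \<omega>) = sets borel"
        using V \<open>\<omega> \<in> space Q\<close> by (auto simp: jump_characteristic_def)
      then show ?thesis using B by (simp add: W_def nn_integral_cmult)
    qed simp
  qed
  finally show ?thesis by (simp add: W_def)
qed

text \<open>The number of jumps of a path need not be a measurable function of the path a priori, and the
  integral of a nonmeasurable function is only a lower integral. This is why a measurable \<open>D\<close> has to
  be provided.\<close>

lemma AE_no_jumps:
  fixes V :: "real \<Rightarrow> 'w \<Rightarrow> 'b::euclidean_space"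
  assumes V: "jump_characteristic Q F V K" and B: "B \<in> sets borel"
    and null: "\<And>t \<omega>. 0 \<le> t \<Longrightarrow> \<omega> \<in> space Q \<Longrightarrow> emeasure (K t \<omega>) B = 0"
    and [measurable]: "Measurable.pred Q D"
    and D: "\<And>\<omega>. \<omega> \<in> space Q \<Longrightarrow>
      (\<And>s. 0 < s \<Longrightarrow> jump (\<lambda>r. V r \<omega>) s \<noteq> 0 \<Longrightarrow> jump (\<lambda>r. V r \<omega>) s \<notin> B) \<Longrightarrow> D \<omega>"
  shows "AE \<omega> in Q. D \<omega>"
proof -
  let ?S = "predictable_sigma Q F"
  define g :: "'w \<Rightarrow> ennreal" where "g \<omega> = (\<integral>\<^sup>+s. indicator (space ?S) (s, \<omega>) * indicator B (jump (\<lambda>r. V r \<omega>) s) *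
        indicator (jump_times (\<lambda>r. V r \<omega>)) s \<partial>count_space {0<..})" for \<omega>
  have "(\<integral>\<^sup>+\<omega>. g \<omega> \<partial>Q) = (\<integral>\<^sup>+\<omega>. (\<integral>\<^sup>+s. indicator (space ?S) (s, \<omega>) * emeasure (K s \<omega>) B *
      indicator {0..} s \<partial>lborel) \<partial>Q)"
    unfolding g_def by (rule jump_characteristic_indicator[OF V sets.top B])
  also have "\<dots> = (\<integral>\<^sup>+\<omega>. (\<integral>\<^sup>+s. 0 \<partial>(lborel :: real measure)) \<partial>Q)"
    by (intro nn_integral_cong) (auto simp: indicator_def null)
  finally have g0: "(\<integral>\<^sup>+\<omega>. g \<omega> \<partial>Q) = 0" by simp
  have "1 \<le> g \<omega>" if \<omega>: "\<omega> \<in> space Q" "\<not> D \<omega>" for \<omega>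
  proof -
    obtain s where s: "0 < s" "jump (\<lambda>r. V r \<omega>) s \<noteq> 0" "jump (\<lambda>r. V r \<omega>) s \<in> B" using D \<omega> by blast
    then have "indicator {s} r \<le> (indicator (space ?S) (r, \<omega>) * indicator B (jump (\<lambda>r. V r \<omega>) r) *
        indicator (jump_times (\<lambda>r. V r \<omega>)) r :: ennreal)" for r
      using \<omega> by (auto simp: indicator_def jump_times_def)
    then have "(\<integral>\<^sup>+r. indicator {s} r \<partial>count_space {0<..}) \<le> g \<omega>"
      unfolding g_def by (intro nn_integral_mono)
    then show ?thesis using s(1) by simp
  qed
  then have "(\<integral>\<^sup>+\<omega>. indicator {\<omega>\<in>space Q. \<not> D \<omega>} \<omega> \<partial>Q) \<le> (\<integral>\<^sup>+\<omega>. g \<omega> \<partial>Q)"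
    by (intro nn_integral_mono) (auto simp: indicator_def)
  then have "emeasure Q {\<omega>\<in>space Q. \<not> D \<omega>} = 0" using g0 by simp
  then show ?thesis by (subst AE_iff_measurable[OF _ refl]) auto
qed

end

text \<open>Otherwise \<open>f > c\<^sub>2 > c\<^sub>1 > f'\<close> near \<open>x\<close>, and comparing the compensators of the jumps from states
  near \<open>x\<close> shows that the time spent there by \<open>X\<close> up to time 1 has expectation 0. No limit theorem
  is needed.\<close>

lemma (in filtered) compare_jump_intensities:
  fixes X :: "real \<Rightarrow> 'w \<Rightarrow> 'a::{metric_space, second_countable_topology}"
    and V :: "real \<Rightarrow> 'w \<Rightarrow> 'b::euclidean_space" and V' :: "real \<Rightarrow> 'w \<Rightarrow> 'c::euclidean_space"
  assumes Q: "prob_space Q" and X: "adapted F X"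
    and c: "\<And>\<omega>. \<omega> \<in> space Q \<Longrightarrow> cadlag (\<lambda>t. X t \<omega>)"
    and E: "closed E" "\<And>\<omega> t. \<omega> \<in> space Q \<Longrightarrow> 0 \<le> t \<Longrightarrow> X t \<omega> \<in> E" "x \<in> E"
    and x: "AE \<omega> in Q. X 0 \<omega> = x"
    and V: "jump_characteristic Q F V (\<lambda>t \<omega>. K (left_lim (\<lambda>r. X r \<omega>) t))"
      "B \<in> sets borel" "\<And>y. y \<in> E \<Longrightarrow> emeasure (K y) B = ennreal (f y)" "isCont f x"
    and V': "jump_characteristic Q F V' (\<lambda>t \<omega>. K' (left_lim (\<lambda>r. X r \<omega>) t))"
      "B' \<in> sets borel" "\<And>y. y \<in> E \<Longrightarrow> emeasure (K' y) B' = ennreal (f' y)" "isCont f' x" "0 \<le> f' x"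
    and d: "0 < d" and jumps: "AE \<omega> in Q. \<forall>s>0. dist (left_lim (\<lambda>r. X r \<omega>) s) x < d \<longrightarrow>
      s \<in> jump_times (\<lambda>r. V r \<omega>) \<longrightarrow> jump (\<lambda>r. V r \<omega>) s \<in> B \<longrightarrow>
      s \<in> jump_times (\<lambda>r. V' r \<omega>) \<and> jump (\<lambda>r. V' r \<omega>) s \<in> B'"
  shows "f x \<le> f' x"
proof (rule ccontr)
  interpret prob_space Q by (rule Q)
  assume "\<not> f x \<le> f' x"
  \<comment> \<open>The levels cut the interval from \<open>f' x\<close> to \<open>f x\<close> into
    thirds, so that strict inequalities hold in a whole neighbourhood of \<open>x\<close>.\<close>
  define c1 where "c1 = (2 * f' x + f x) / 3"
  define c2 where "c2 = (f' x + 2 * f x) / 3"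
  have c12: "0 \<le> c1" "f' x < c1" "c1 < c2" "c2 < f x"
    using \<open>\<not> f x \<le> f' x\<close> V'(5) by (auto simp: c1_def c2_def)
  have "eventually (\<lambda>y. c2 < f y \<and> f' y < c1) (nhds x)"
    using V(4) V'(4) c12 unfolding isCont_def tendsto_at_iff_tendsto_nhds
    by (intro eventually_conj order_tendstoD)
  then obtain e where e: "e > 0" "\<And>y. dist y x < e \<Longrightarrow> c2 < f y \<and> f' y < c1"
    by (auto simp: eventually_nhds_metric)
  define d' where "d' = min d e"
  \<comment> \<open>The cutoff at time 1 bounds the occupation time \<open>I\<close>, so that its
    expectation is finite and can be cancelled.\<close>
  define G where "G = {(t, \<omega>) \<in> space (predictable_sigma Q F). t \<le> 1 \<and> dist (left_lim (\<lambda>r. X r \<omega>) t) x < d'}"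
  have G: "G \<in> sets (predictable_sigma Q F)" unfolding G_def by (rule predictable_near_set[OF X c])
  define I where "I \<omega> = (\<integral>\<^sup>+s. indicator G (s, \<omega>) * indicator {0..} s \<partial>lborel)" for \<omega>
  have "(\<lambda>(\<omega>, t). indicator G (t, \<omega>) * indicator {0..} t :: ennreal) \<in> borel_measurable (Q \<Otimes>\<^sub>M lborel)"
    by (rule measurable_predictable_pair) (use G in simp)
  then have I[measurable]: "I \<in> borel_measurable Q"
    unfolding I_def by (rule lborel.borel_measurable_nn_integral)
  have Im: "(\<lambda>s. indicator G (s, \<omega>) * indicator {0..} s :: ennreal) \<in> borel_measurable lborel"
    if "\<omega> \<in> space Q" for \<omega>
    using measurable_compose[OF measurable_Pair1'[OF that],
        OF \<open>(\<lambda>(\<omega>, t). indicator G (t, \<omega>) * indicator {0..} t :: ennreal) \<in> borel_measurable (Q \<Otimes>\<^sub>M lborel)\<close>]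
    by simp
  have state: "left_lim (\<lambda>r. X r \<omega>) s \<in> E" if "\<omega> \<in> space Q" "0 \<le> s" for \<omega> s
    by (rule left_lim_closed[OF c E(1)]) (use that E(2) in auto)
  have "(\<integral>\<^sup>+\<omega>. ennreal c2 * I \<omega> \<partial>Q) =
      (\<integral>\<^sup>+\<omega>. (\<integral>\<^sup>+s. ennreal c2 * (indicator G (s, \<omega>) * indicator {0..} s) \<partial>lborel) \<partial>Q)"
    unfolding I_def by (intro nn_integral_cong nn_integral_cmult[symmetric] Im)
  also have "\<dots> \<le> (\<integral>\<^sup>+\<omega>. (\<integral>\<^sup>+s. indicator G (s, \<omega>) * emeasure (K (left_lim (\<lambda>r. X r \<omega>) s)) B *
      indicator {0..} s \<partial>lborel) \<partial>Q)"
  proof (intro nn_integral_mono)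
    fix \<omega> and s :: real assume \<omega>: "\<omega> \<in> space Q"
    show "ennreal c2 * (indicator G (s, \<omega>) * indicator {0..} s) \<le>
      indicator G (s, \<omega>) * emeasure (K (left_lim (\<lambda>r. X r \<omega>) s)) B * indicator {0..} s"
      using e(2)[of "left_lim (\<lambda>r. X r \<omega>) s"] state[OF \<omega>, of s] \<omega>
      by (auto simp: indicator_def G_def V(3) d'_def intro!: ennreal_leI)
  qed
  also have "\<dots> = (\<integral>\<^sup>+\<omega>. (\<integral>\<^sup>+s. indicator G (s, \<omega>) * indicator B (jump (\<lambda>r. V r \<omega>) s) *
        indicator (jump_times (\<lambda>r. V r \<omega>)) s \<partial>count_space {0<..}) \<partial>Q)"
    by (rule jump_characteristic_indicator[OF V(1) G V(2), symmetric])
  \<comment> \<open>Here the pathwise inclusion of jumps enters. Only monotonicity of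
    \<open>nn_integral\<close> is applied to the two possibly nonmeasurable jump counts.\<close>
  also have "\<dots> \<le> (\<integral>\<^sup>+\<omega>. (\<integral>\<^sup>+s. indicator G (s, \<omega>) * indicator B' (jump (\<lambda>r. V' r \<omega>) s) *
        indicator (jump_times (\<lambda>r. V' r \<omega>)) s \<partial>count_space {0<..}) \<partial>Q)"
    using jumps
  proof (intro nn_integral_mono_AE, eventually_elim, intro nn_integral_mono)
    fix \<omega> and s :: real
    assume *: "\<forall>s>0. dist (left_lim (\<lambda>r. X r \<omega>) s) x < d \<longrightarrow>
      s \<in> jump_times (\<lambda>r. V r \<omega>) \<longrightarrow> jump (\<lambda>r. V r \<omega>) s \<in> B \<longrightarrow>
      s \<in> jump_times (\<lambda>r. V' r \<omega>) \<and> jump (\<lambda>r. V' r \<omega>) s \<in> B'"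
      and s: "s \<in> space (count_space {0<..})"
    show "indicator G (s, \<omega>) * indicator B (jump (\<lambda>r. V r \<omega>) s) * indicator (jump_times (\<lambda>r. V r \<omega>)) s
      \<le> (indicator G (s, \<omega>) * indicator B' (jump (\<lambda>r. V' r \<omega>) s) *
        indicator (jump_times (\<lambda>r. V' r \<omega>)) s :: ennreal)"
      using *[rule_format, of s] s by (auto simp: indicator_def G_def d'_def)
  qed
  also have "\<dots> = (\<integral>\<^sup>+\<omega>. (\<integral>\<^sup>+s. indicator G (s, \<omega>) * emeasure (K' (left_lim (\<lambda>r. X r \<omega>) s)) B' *
      indicator {0..} s \<partial>lborel) \<partial>Q)"
    by (rule jump_characteristic_indicator[OF V'(1) G V'(2)])
  also have "\<dots> \<le> (\<integral>\<^sup>+\<omega>. (\<integral>\<^sup>+s. ennreal c1 * (indicator G (s, \<omega>) * indicator {0..} s) \<partial>lborel) \<partial>Q)"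
  proof (intro nn_integral_mono)
    fix \<omega> and s :: real assume \<omega>: "\<omega> \<in> space Q"
    show "indicator G (s, \<omega>) * emeasure (K' (left_lim (\<lambda>r. X r \<omega>) s)) B' * indicator {0..} s \<le>
      ennreal c1 * (indicator G (s, \<omega>) * indicator {0..} s)"
      using e(2)[of "left_lim (\<lambda>r. X r \<omega>) s"] state[OF \<omega>, of s] \<omega>
      by (auto simp: indicator_def G_def V'(3) d'_def intro!: ennreal_leI)
  qed
  also have "\<dots> = (\<integral>\<^sup>+\<omega>. ennreal c1 * I \<omega> \<partial>Q)"
    unfolding I_def by (intro nn_integral_cong nn_integral_cmult Im)
  finally have le: "ennreal c2 * (\<integral>\<^sup>+\<omega>. I \<omega> \<partial>Q) \<le> ennreal c1 * (\<integral>\<^sup>+\<omega>. I \<omega> \<partial>Q)"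
    by (simp add: nn_integral_cmult)
  have "I \<omega> \<le> (\<integral>\<^sup>+s. indicator {0..1} (s::real) \<partial>lborel)" for \<omega>
    unfolding I_def by (intro nn_integral_mono) (auto simp: indicator_def G_def)
  then have "(\<integral>\<^sup>+\<omega>. I \<omega> \<partial>Q) \<le> (\<integral>\<^sup>+\<omega>. 1 \<partial>Q)" by (intro nn_integral_mono) simp
  then have "(\<integral>\<^sup>+\<omega>. I \<omega> \<partial>Q) < \<infinity>" using emeasure_space_1 by (simp add: le_less_trans[OF _ ennreal_one_less_top])
  then obtain j where j: "(\<integral>\<^sup>+\<omega>. I \<omega> \<partial>Q) = ennreal j" "0 \<le> j" by (cases "\<integral>\<^sup>+\<omega>. I \<omega> \<partial>Q") auto
  have "ennreal (c2 * j) \<le> ennreal (c1 * j)" using le c12 j(2) unfolding j by (simp add: ennreal_mult)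
  then have "c2 * j \<le> c1 * j" using c12 j(2) by (simp add: ennreal_le_iff)
  then have "j = 0" using c12 j(2) by (metis less_eq_real_def mult_less_cancel_right not_less_iff_gr_or_eq)
  then have "AE \<omega> in Q. I \<omega> = 0" using j(1) by (simp add: nn_integral_0_iff_AE)
  \<comment> \<open>Almost surely the left limits stay within \<open>d' / 2\<close> of
    \<open>x\<close> on some interval \<open>{0..t}\<close>, so the occupation time cannot
    vanish.\<close>
  with x AE_space have "AE \<omega> in Q. False"
  proof (eventually_elim, goal_cases)
    case (1 \<omega>)
    have "0 < d' / 2" using d e(1) by (simp add: d'_def)
    then obtain t where t: "t > 0" "\<And>s. s \<in> {0..t} \<Longrightarrow> dist (left_lim (\<lambda>r. X r \<omega>) s) (X 0 \<omega>) \<le> d' / 2"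
      using left_lim_near_0[OF c[OF 1(2)]] by blast
    have "ennreal (min 1 t) = (\<integral>\<^sup>+s. indicator {0..min 1 t} (s::real) \<partial>lborel)" using t(1) by simp
    also have "\<dots> \<le> I \<omega>" unfolding I_def
    proof (intro nn_integral_mono)
      fix s :: real
      show "indicator {0..min 1 t} s \<le> (indicator G (s, \<omega>) * indicator {0..} s :: ennreal)"
        using t(2)[of s] 1 \<open>0 < d' / 2\<close> by (auto simp: indicator_def G_def)
    qed
    finally show ?case using 1 t(1) by simp
  qed
  then show False by simp
qed

section \<open>The setting\<close>

lemma sets_augment:
  assumes "subalgebra Q (F t)"
  shows "sets (augment Q F t) = sigma_sets (space Q) (sets (F t) \<union> null_sets (completion Q))"
proof -
  have "sets (F t) \<union> null_sets (completion Q) \<subseteq> Pow (space Q)"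
    using assms sets.sets_into_space[of _ "completion Q"] sets.sets_into_space[of _ "F t"]
    by (auto simp: subalgebra_def null_sets_def dest: subsetD)
  then show ?thesis unfolding augment_def by (rule sets_measure_of)
qed

lemma space_augment [simp]: "space (augment Q F t) = space Q"
  by (simp add: augment_def space_measure_of_conv)

lemma filtered_augment:
  assumes F: "filtration (space Q) F" and s: "\<And>t. 0 \<le> t \<Longrightarrow> subalgebra Q (F t)"
  shows "filtered (completion Q) (augment Q F)"
proof
  show "sets (augment Q F t) \<subseteq> sets (completion Q)" if "0 \<le> t" for t
    unfolding sets_augment[of Q F t, OF s[OF that]] space_completion[of Q, symmetric]
    using s[OF that] by (intro sets.sigma_sets_subset) (auto simp: subalgebra_def null_sets_def)
  show "sets (augment Q F r) \<subseteq> sets (augment Q F t)" if "0 \<le> r" "r \<le> t" for r t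
  proof -
    have "0 \<le> t" using that by simp
    then show ?thesis
      unfolding sets_augment[of Q F r, OF s[OF that(1)]] sets_augment[of Q F t, OF s[OF \<open>0 \<le> t\<close>]]
      using filtration.sets_F_mono[OF F that(2)] by (intro sigma_sets_mono') auto
  qed
qed simp

lemma measurable_augment:
  assumes "subalgebra Q (F t)" "f \<in> measurable (F t) N"
  shows "f \<in> measurable (augment Q F t) N"
proof (rule measurable_from_subalg[OF _ assms(2)])
  show "subalgebra (augment Q F t) (F t)"
    unfolding subalgebra_def sets_augment[of Q F t, OF assms(1)]
    using assms(1) by (auto simp: subalgebra_def)
qed

text \<open>Kernels enter only through nonnegative times and points of the space. This allows
  replacing the left limit of a coordinate by the coordinate of the left limit, an identity
  available just there.\<close>

lemma (in filtered) jump_characteristic_cong: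
  fixes V :: "real \<Rightarrow> 'w \<Rightarrow> 'b::euclidean_space"
  assumes "jump_characteristic Q F V K"
    and eq: "\<And>t \<omega>. 0 \<le> t \<Longrightarrow> \<omega> \<in> space Q \<Longrightarrow> K t \<omega> = K' t \<omega>"
  shows "jump_characteristic Q F V K'"
  unfolding jump_characteristic_def
proof (intro conjI allI ballI impI)
  show "sets (K' t \<omega>) = sets borel" if "0 \<le> t" "\<omega> \<in> space Q" for t \<omega>
    using assms that by (auto simp: jump_characteristic_def)
  show "predictable Q F (\<lambda>t \<omega>. emeasure (K' t \<omega>) A)" if "A \<in> sets borel" for A
  proof -
    have "predictable Q F (\<lambda>t \<omega>. emeasure (K t \<omega>) A)"
      using assms(1) that by (auto simp: jump_characteristic_def)
    then show ?thesis unfolding predictable_def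
      by (subst (asm) measurable_cong[where g = "\<lambda>(t, \<omega>). emeasure (K' t \<omega>) A"]) (auto simp: eq)
  qed
  fix W :: "(real \<times> 'w) \<times> 'b \<Rightarrow> ennreal"
  assume "W \<in> borel_measurable (predictable_sigma Q F \<Otimes>\<^sub>M borel)"
  then have "(\<integral>\<^sup>+\<omega>. (\<integral>\<^sup>+s. W ((s, \<omega>), jump (\<lambda>r. V r \<omega>) s) * indicator (jump_times (\<lambda>r. V r \<omega>)) s
          \<partial>count_space {0<..}) \<partial>Q) =
      (\<integral>\<^sup>+\<omega>. (\<integral>\<^sup>+s. (\<integral>\<^sup>+\<xi>. W ((s, \<omega>), \<xi>) \<partial>K s \<omega>) * indicator {0..} s \<partial>lborel) \<partial>Q)"
    using assms(1) unfolding jump_characteristic_def by blast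
  also have "\<dots> = (\<integral>\<^sup>+\<omega>. (\<integral>\<^sup>+s. (\<integral>\<^sup>+\<xi>. W ((s, \<omega>), \<xi>) \<partial>K' s \<omega>) * indicator {0..} s \<partial>lborel) \<partial>Q)"
    by (intro nn_integral_cong) (auto simp: indicator_def eq)
  finally show "(\<integral>\<^sup>+\<omega>. (\<integral>\<^sup>+s. W ((s, \<omega>), jump (\<lambda>r. V r \<omega>) s) * indicator (jump_times (\<lambda>r. V r \<omega>)) s
          \<partial>count_space {0<..}) \<partial>Q) =
      (\<integral>\<^sup>+\<omega>. (\<integral>\<^sup>+s. (\<integral>\<^sup>+\<xi>. W ((s, \<omega>), \<xi>) \<partial>K' s \<omega>) * indicator {0..} s \<partial>lborel) \<partial>Q)" .
qed

lemma affine_map_continuous: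
  fixes f :: "'a::euclidean_space \<Rightarrow> 'b::real_normed_vector"
  assumes "affine_map f"
  shows "isCont f x"
proof -
  obtain L a where L: "linear L" "f = (\<lambda>x. L x + a)" using assms by (auto simp: affine_map_def)
  then have "isCont L x" by (simp add: linear_continuous_at linear_conv_bounded_linear)
  then show ?thesis unfolding L(2) by (intro continuous_intros)
qed

lemma affine_map_real_pair:
  fixes f :: "real \<times> real \<Rightarrow> real"
  assumes "affine_map f"
  obtains a b c where "\<And>y z. f (y, z) = a + b * y + c * z"
proof -
  obtain L a where L: "linear L" "f = (\<lambda>x. L x + a)" using assms by (auto simp: affine_map_def)
  have *: "L (y, z) = y * L (1, 0) + z * L (0, 1)" for y z
  proof -
    have "L (y, z) = L (y *\<^sub>R (1, 0) + z *\<^sub>R (0, 1))" by simp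
    also have "\<dots> = y * L (1, 0) + z * L (0, 1)"
      unfolding linear_add[OF L(1)] linear_scale[OF L(1)] by simp
    finally show ?thesis .
  qed
  show ?thesis
  proof (rule that)
    show "f (y, z) = a + L (1, 0) * y + L (0, 1) * z" for y z unfolding L(2) *[of y z] by simp
  qed
qed

text \<open>By Lindelof's theorem countably many null open sets cover \<open>S\<close>. This turns
  pointwise statements about supports into null sets.\<close>

lemma emeasure_zero_locally:
  fixes \<mu> :: "'a::second_countable_topology measure"
  assumes s: "sets \<mu> = sets borel" and S: "S \<in> sets borel"
    and loc: "\<And>\<xi>. \<xi> \<in> S \<Longrightarrow> \<exists>U. open U \<and> \<xi> \<in> U \<and> emeasure \<mu> U = 0"
  shows "emeasure \<mu> S = 0"
proof -
  let ?\<U> = "{U. open U \<and> emeasure \<mu> U = 0}"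
  obtain \<F> where F: "\<F> \<subseteq> ?\<U>" "countable \<F>" "\<Union>\<F> = \<Union>?\<U>"
    using Lindelof[of ?\<U>] by auto
  have "(\<Union>U\<in>\<F>. U) \<in> null_sets \<mu>"
    using F by (intro null_sets_UN') (auto simp: null_sets_def s)
  moreover have "S \<subseteq> (\<Union>U\<in>\<F>. U)" unfolding image_ident F(3) using loc by blast
  ultimately have "S \<in> null_sets \<mu>" using null_sets_subset S s by metis
  then show ?thesis by auto
qed

text \<open>The iterates of a proper translation leave every bounded set.\<close>

lemma translation_invariant_bounded:
  fixes S :: "real set"
  assumes "bounded S" "S \<noteq> {}" "\<And>z. z \<in> S \<Longrightarrow> z + \<delta> \<in> S"
  shows "\<delta> = 0"
proof (rule ccontr)
  assume "\<delta> \<noteq> 0"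
  obtain z where z: "z \<in> S" using assms(2) by blast
  have n: "z + real n * \<delta> \<in> S" for n
  proof (induction n)
    case (Suc n)
    from assms(3)[OF this] show ?case by (simp add: algebra_simps)
  qed (simp add: z)
  obtain b where b: "\<And>z. z \<in> S \<Longrightarrow> \<bar>z\<bar> \<le> b" using assms(1) by (auto simp: bounded_iff)
  obtain n :: nat where "(b + \<bar>z\<bar>) / \<bar>\<delta>\<bar> < real n" using reals_Archimedean2 by blast
  then have "b + \<bar>z\<bar> < real n * \<bar>\<delta>\<bar>" using \<open>\<delta> \<noteq> 0\<close> by (simp add: pos_divide_less_eq)
  moreover have "\<bar>real n * \<delta>\<bar> = real n * \<bar>\<delta>\<bar>" by (simp add: abs_mult)
  ultimately show False using b[OF n[of n]] by linarith
qed

text \<open>Fixes as parameters the witnesses that \<open>jump_counter_setting\<close> asserts to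
  exist. \<open>\<zeta>\<^sub>0\<close> is the second coordinate of the jump size of the counter;
  normalization makes the first one -1.\<close>

locale jump_counter_process =
  fixes M :: "'w measure" and F E P and X :: "real \<Rightarrow> 'w \<Rightarrow> real \<times> real" and N :: nat and \<alpha> \<beta> :: real
    and K K\<^sub>Z and \<zeta>\<^sub>0 :: real
  assumes fam: "semimartingale_family M F E P X"
    and N: "N \<noteq> 0" and \<alpha>: "0 < \<alpha>" and \<beta>: "0 \<le> \<beta>"
    and E: "compact E" "E \<subseteq> \<nat> \<times> UNIV" "affine hull E = UNIV" "fst ` E = real ` {0..N}"
    and K: "affine_kernel K" "\<And>x. x \<in> E \<Longrightarrow> jump_kernel_measure (K x)"
      "\<And>x. x \<in> E \<Longrightarrow> jump_characteristic (completion (P x)) (augment (P x) F) X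
          (\<lambda>t \<omega>. pos_measure (K (left_lim (\<lambda>r. X r \<omega>) t)))"
    and K\<^sub>Y: "\<And>y. y \<in> fst ` E \<Longrightarrow>
        jump_kernel_measure (\<lambda>A :: real set. y * \<alpha> * dirac (-1) A + (real N - y) * \<beta> * dirac 1 A)"
      "\<And>x. x \<in> E \<Longrightarrow> jump_characteristic (completion (P x)) (augment (P x) F) (\<lambda>t \<omega>. fst (X t \<omega>))
          (\<lambda>t \<omega>. pos_measure (\<lambda>A. left_lim (\<lambda>r. fst (X r \<omega>)) t * \<alpha> * dirac (-1) A +
            (real N - left_lim (\<lambda>r. fst (X r \<omega>)) t) * \<beta> * dirac 1 A))"
    and K\<^sub>Z: "affine_kernel K\<^sub>Z" "\<And>y. y \<in> fst ` E \<Longrightarrow> jump_kernel_measure (K\<^sub>Z y)"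
      "\<And>x. x \<in> E \<Longrightarrow> jump_characteristic (completion (P x)) (augment (P x) F) (\<lambda>t \<omega>. snd (X t \<omega>))
          (\<lambda>t \<omega>. pos_measure (K\<^sub>Z (left_lim (\<lambda>r. fst (X r \<omega>)) t)))"
    and ZY: "\<And>x. x \<in> E \<Longrightarrow>
        AE \<omega> in P x. jump_times (\<lambda>t. snd (X t \<omega>)) \<subseteq> jump_times (\<lambda>t. fst (X t \<omega>))"
    and counter: "\<And>x. x \<in> E \<Longrightarrow> 0 < fst x \<Longrightarrow> x + (-1, \<zeta>\<^sub>0) \<in> E"
begin

text \<open>Brings the kernels of \<open>X\<close>, \<open>Y\<close> and \<open>Z\<close> into one
  form, as functions of the full state, so that one lemma compares any two of them. Continuity in
  the state is what the comparison takes from affinity.\<close>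

definition kernel_of :: "(real \<Rightarrow> 'w \<Rightarrow> 'b::euclidean_space) \<Rightarrow> (real \<times> real \<Rightarrow> 'b set \<Rightarrow> real) \<Rightarrow> bool" where
  "kernel_of V k \<longleftrightarrow> (\<forall>x\<in>E. jump_kernel_measure (k x) \<and> (\<forall>A. isCont (\<lambda>x. k x A) x) \<and>
    jump_characteristic (completion (P x)) (augment (P x) F) V
      (\<lambda>t \<omega>. pos_measure (k (left_lim (\<lambda>r. X r \<omega>) t))))"

lemma
  assumes "x \<in> E"
  shows space_P: "space (P x) = space M" and prob_P: "prob_space (P x)"
    and filtered_P: "filtered (completion (P x)) (augment (P x) F)"
    and adapted_P: "adapted (augment (P x) F) X"
    and start_P: "AE \<omega> in P x. X 0 \<omega> = x"
proof -
  have s: "sets (P x) = sets M" and p: "prob_space (P x)" and "AE \<omega> in P x. X 0 \<omega> = x"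
    and F: "filtration (space M) F" "\<forall>t\<ge>0. subalgebra M (F t)" and X: "adapted F X"
    using fam assms by (auto simp: semimartingale_family_def)
  show sp: "space (P x) = space M" by (rule sets_eq_imp_space_eq[OF s])
  show "prob_space (P x)" "AE \<omega> in P x. X 0 \<omega> = x" by fact+
  have sub: "subalgebra (P x) (F t)" if "0 \<le> t" for t
    using F(2) that s sp by (auto simp: subalgebra_def)
  then show "filtered (completion (P x)) (augment (P x) F)"
    using F(1) sp by (intro filtered_augment) auto
  show "adapted (augment (P x) F) X"
    using X sub measurable_augment unfolding adapted_def by blast
qed

lemma
  assumes "\<omega> \<in> space M"
  shows cadlag_X: "cadlag (\<lambda>t. X t \<omega>)" and X_in_E: "0 \<le> t \<Longrightarrow> X t \<omega> \<in> E"
    and cadlag_Y: "cadlag (\<lambda>t. fst (X t \<omega>))"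
    and left_lim_X: "0 \<le> t \<Longrightarrow> left_lim (\<lambda>t. X t \<omega>) t \<in> E"
    and left_lim_Y: "0 \<le> t \<Longrightarrow> left_lim (\<lambda>t. fst (X t \<omega>)) t = fst (left_lim (\<lambda>t. X t \<omega>) t)"
    and jump_Y: "0 \<le> t \<Longrightarrow> jump (\<lambda>t. fst (X t \<omega>)) t = fst (jump (\<lambda>t. X t \<omega>) t)"
    and jump_Z: "0 \<le> t \<Longrightarrow> jump (\<lambda>t. snd (X t \<omega>)) t = snd (jump (\<lambda>t. X t \<omega>) t)"
proof -
  show c: "cadlag (\<lambda>t. X t \<omega>)" and XE: "\<And>t. 0 \<le> t \<Longrightarrow> X t \<omega> \<in> E"
    using fam assms by (auto simp: semimartingale_family_def)
  show "cadlag (\<lambda>t. fst (X t \<omega>))"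
    by (intro cadlag_compose[OF c] continuous_intros)
  show "left_lim (\<lambda>t. X t \<omega>) t \<in> E" if "0 \<le> t"
    by (rule left_lim_closed[OF c compact_imp_closed[OF E(1)] XE that])
  show "left_lim (\<lambda>t. fst (X t \<omega>)) t = fst (left_lim (\<lambda>t. X t \<omega>) t)" if "0 \<le> t"
    by (intro left_lim_compose[OF c _ that] continuous_intros)
  show "jump (\<lambda>t. fst (X t \<omega>)) t = fst (jump (\<lambda>t. X t \<omega>) t)" if "0 \<le> t"
    by (rule jump_linear[OF c bounded_linear_fst that])
  show "jump (\<lambda>t. snd (X t \<omega>)) t = snd (jump (\<lambda>t. X t \<omega>) t)" if "0 \<le> t"
    by (rule jump_linear[OF c bounded_linear_snd that])
qed

lemma kernel_X: "kernel_of X K"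
  unfolding kernel_of_def
proof (intro ballI conjI allI)
  fix x A assume x: "x \<in> E"
  show "jump_kernel_measure (K x)" by (rule K(2)[OF x])
  show "isCont (\<lambda>x. K x A) x"
    using K(1) by (intro affine_map_continuous) (simp add: affine_kernel_def)
  show "jump_characteristic (completion (P x)) (augment (P x) F) X
     (\<lambda>t \<omega>. pos_measure (K (left_lim (\<lambda>r. X r \<omega>) t)))"
    by (rule K(3)[OF x])
qed

lemma kernel_Y: "kernel_of (\<lambda>t \<omega>. fst (X t \<omega>))
    (\<lambda>x A. fst x * \<alpha> * dirac (-1) A + (real N - fst x) * \<beta> * dirac 1 A)"
  unfolding kernel_of_def
proof (intro ballI conjI allI)
  fix x and A :: "real set" assume x: "x \<in> E"
  show "jump_kernel_measure (\<lambda>A :: real set.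
      fst x * \<alpha> * dirac (-1) A + (real N - fst x) * \<beta> * dirac 1 A)"
    by (rule K\<^sub>Y(1)) (use x in simp)
  show "isCont (\<lambda>x. fst x * \<alpha> * dirac (-1) A + (real N - fst x) * \<beta> * dirac 1 A) x"
    by (intro continuous_intros)
  show "jump_characteristic (completion (P x)) (augment (P x) F) (\<lambda>t \<omega>. fst (X t \<omega>))
     (\<lambda>t \<omega>. pos_measure (\<lambda>A. fst (left_lim (\<lambda>r. X r \<omega>) t) * \<alpha> * dirac (-1) A +
       (real N - fst (left_lim (\<lambda>r. X r \<omega>) t)) * \<beta> * dirac 1 A))"
    by (rule filtered.jump_characteristic_cong[OF filtered_P[OF x] K\<^sub>Y(2)[OF x]])
      (use space_P[OF x] in \<open>simp add: left_lim_Y\<close>)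
qed

lemma kernel_Z: "kernel_of (\<lambda>t \<omega>. snd (X t \<omega>)) (\<lambda>x. K\<^sub>Z (fst x))"
  unfolding kernel_of_def
proof (intro ballI conjI allI)
  fix x assume x: "x \<in> E"
  show "jump_kernel_measure (K\<^sub>Z (fst x))" using x by (intro K\<^sub>Z) auto
  have "isCont (\<lambda>y. K\<^sub>Z y A) (fst x)" for A :: "real set"
    using K\<^sub>Z(1) by (auto simp: affine_kernel_def intro: affine_map_continuous)
  moreover have "isCont fst x" by (intro continuous_intros)
  ultimately show "isCont (\<lambda>x. K\<^sub>Z (fst x) A) x" for A :: "real set"
    using isCont_o2 by blast
  show "jump_characteristic (completion (P x)) (augment (P x) F) (\<lambda>t \<omega>. snd (X t \<omega>))
     (\<lambda>t \<omega>. pos_measure (K\<^sub>Z (fst (left_lim (\<lambda>r. X r \<omega>) t))))"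
    by (rule filtered.jump_characteristic_cong[OF filtered_P[OF x] K\<^sub>Z(3)[OF x]])
      (use space_P[OF x] in \<open>simp add: left_lim_Y\<close>)
qed

text \<open>Reduces an inequality between kernels at \<open>x\<close> to a deterministic check of
  single jumps, from states within \<open>d\<close> of \<open>x\<close> and on paths where
  \<open>Z\<close> jumps only with \<open>Y\<close>. All probability is absorbed here.\<close>

lemma compare:
  assumes x: "x \<in> E" and V: "kernel_of V k" and V': "kernel_of V' k'"
    and B: "B \<in> relcompact_sets" "B' \<in> relcompact_sets" and d: "0 < d"
    and jumps: "\<And>\<omega> s. \<omega> \<in> space M \<Longrightarrow> 0 < s \<Longrightarrow>
      jump_times (\<lambda>t. snd (X t \<omega>)) \<subseteq> jump_times (\<lambda>t. fst (X t \<omega>)) \<Longrightarrow>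
      dist (left_lim (\<lambda>r. X r \<omega>) s) x < d \<Longrightarrow>
      jump (\<lambda>r. V r \<omega>) s \<noteq> 0 \<Longrightarrow> jump (\<lambda>r. V r \<omega>) s \<in> B \<Longrightarrow>
      jump (\<lambda>r. V' r \<omega>) s \<noteq> 0 \<and> jump (\<lambda>r. V' r \<omega>) s \<in> B'"
  shows "k x B \<le> k' x B'"
proof (rule filtered.compare_jump_intensities[OF filtered_P[OF x] _ adapted_P[OF x] _ _ _ x,
      where V = V and V' = V' and K = "\<lambda>x. pos_measure (k x)" and K' = "\<lambda>x. pos_measure (k' x)"
        and B = B and B' = B' and d = d])
  show "prob_space (completion (P x))"
    using prob_P[OF x] by (intro prob_spaceI) (simp add: prob_space.emeasure_space_1)
  show "AE \<omega> in completion (P x). X 0 \<omega> = x" by (rule AE_completion[OF start_P[OF x]])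
  show "closed E" by (rule compact_imp_closed[OF E(1)])
  show "AE \<omega> in completion (P x). \<forall>s>0. dist (left_lim (\<lambda>r. X r \<omega>) s) x < d \<longrightarrow>
      s \<in> jump_times (\<lambda>r. V r \<omega>) \<longrightarrow> jump (\<lambda>r. V r \<omega>) s \<in> B \<longrightarrow>
      s \<in> jump_times (\<lambda>r. V' r \<omega>) \<and> jump (\<lambda>r. V' r \<omega>) s \<in> B'"
    using AE_completion[OF ZY[OF x]] AE_space
    by eventually_elim (use jumps space_P[OF x] in \<open>auto simp: jump_times_def\<close>)
  show "0 \<le> k' x B'" using V' x by (auto simp: kernel_of_def jump_kernel_measure_def)
  show "emeasure (pos_measure (k y)) B = ennreal (k y B)" if "y \<in> E" for y
    using V that B by (intro emeasure_jump_kernel) (auto simp: kernel_of_def)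
  show "emeasure (pos_measure (k' y)) B' = ennreal (k' y B')" if "y \<in> E" for y
    using V' that B by (intro emeasure_jump_kernel) (auto simp: kernel_of_def)
  show "cadlag (\<lambda>t. X t \<omega>)" if "\<omega> \<in> space (completion (P x))" for \<omega>
    using that space_P[OF x] by (simp add: cadlag_X)
  show "X t \<omega> \<in> E" if "\<omega> \<in> space (completion (P x))" "0 \<le> t" for t \<omega>
    using that space_P[OF x] by (simp add: X_in_E)
  show "isCont (\<lambda>y. k y B) x" "isCont (\<lambda>y. k' y B') x"
    using V V' x unfolding kernel_of_def by blast+
  show "jump_characteristic (completion (P x)) (augment (P x) F) V (\<lambda>t \<omega>. pos_measure (k (left_lim (\<lambda>r. X r \<omega>) t)))"
    "jump_characteristic (completion (P x)) (augment (P x) F) V' (\<lambda>t \<omega>. pos_measure (k' (left_lim (\<lambda>r. X r \<omega>) t)))"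
    using V V' x unfolding kernel_of_def by blast+
qed (use B d in \<open>simp_all add: relcompact_borel\<close>)

end

section \<open>Rates and supports of the jumps of \<open>X\<close>\<close>

context jump_counter_process
begin

text \<open>A bound on the diameter of \<open>E\<close>, hence on all jumps, which makes the slices
  needed below relatively compact. It is at least 1 so that \<open>{-R..R}\<close> contains 1 and
  -1.\<close>

definition R :: real where
  "R = (SOME r. 1 \<le> r \<and> (\<forall>x\<in>E. \<forall>x'\<in>E. norm (x' - x) \<le> r))"

lemma R: "1 \<le> R" "x \<in> E \<Longrightarrow> x' \<in> E \<Longrightarrow> norm (x' - x) \<le> R"
proof -
  obtain b where b: "\<And>x. x \<in> E \<Longrightarrow> norm x \<le> b"
    using compact_imp_bounded[OF E(1)] unfolding bounded_iff by blast
  have "norm (x' - x) \<le> max 1 (2 * b)" if "x \<in> E" "x' \<in> E" for x x'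
    using b[OF that(1)] b[OF that(2)] norm_triangle_ineq4[of x' x] by linarith
  then have "\<exists>r. 1 \<le> r \<and> (\<forall>x\<in>E. \<forall>x'\<in>E. norm (x' - x) \<le> r)"
    by (intro exI[of _ "max 1 (2 * b)"]) auto
  from someI_ex[OF this, folded R_def]
  show "1 \<le> R" "x \<in> E \<Longrightarrow> x' \<in> E \<Longrightarrow> norm (x' - x) \<le> R" by blast+
qed

lemma K_nonneg: "x \<in> E \<Longrightarrow> 0 \<le> K x A"
  using K(2) by (auto simp: jump_kernel_measure_def)

lemma K_signed: "K x \<in> signed_radon"
  using K(1) unfolding affine_kernel_def by blast

lemma K_Un:
  assumes "A \<in> relcompact_sets" "B \<in> relcompact_sets" "A \<inter> B = {}"
  shows "K x (A \<union> B) = K x A + K x B"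
  by (intro signed_radon_Un K_signed assms)

lemma pair_relcompact:
  fixes a :: real and B :: "real set"
  assumes "a \<noteq> 0" "B \<in> sets borel" "bounded B"
  shows "{a} \<times> B \<in> relcompact_sets"
proof (rule relcompact_subset)
  show "{a} \<times> B \<in> sets borel" using assms(2) by (intro borel_Times) auto
  show "{a} \<times> B \<subseteq> {a} \<times> closure B" using closure_subset by auto
  show "compact ({a} \<times> closure B)" using assms(3) by (intro compact_Times) (auto simp: compact_closure)
  show "0 \<notin> {a} \<times> closure B" using assms(1) by (auto simp: zero_prod_def)
qed

lemma singleton_relcompact: "a \<noteq> 0 \<Longrightarrow> {a :: real} \<in> relcompact_sets"
  by (rule relcompact_subset[of _ "{a}"]) auto

lemma jump_in_E:
  assumes "\<omega> \<in> space M" "0 < s"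
  shows "left_lim (\<lambda>t. X t \<omega>) s \<in> E" "left_lim (\<lambda>t. X t \<omega>) s + jump (\<lambda>t. X t \<omega>) s \<in> E"
    "norm (jump (\<lambda>t. X t \<omega>) s) \<le> R"
proof -
  show E: "left_lim (\<lambda>t. X t \<omega>) s \<in> E" using assms by (intro left_lim_X) auto
  have *: "X s \<omega> \<in> E" using assms by (intro X_in_E) auto
  then show "left_lim (\<lambda>t. X t \<omega>) s + jump (\<lambda>t. X t \<omega>) s \<in> E" by (simp add: jump_def)
  show "norm (jump (\<lambda>t. X t \<omega>) s) \<le> R" using R(2)[OF E *] by (simp add: jump_def)
qed

lemma jump_bounded:
  assumes "\<omega> \<in> space M" "0 < s"
  shows "\<bar>fst (jump (\<lambda>t. X t \<omega>) s)\<bar> \<le> R" "\<bar>snd (jump (\<lambda>t. X t \<omega>) s)\<bar> \<le> R"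
  using jump_in_E(3)[OF assms] norm_fst_le[of "fst (jump (\<lambda>t. X t \<omega>) s)" "snd (jump (\<lambda>t. X t \<omega>) s)"]
    norm_snd_le[of "snd (jump (\<lambda>t. X t \<omega>) s)" "fst (jump (\<lambda>t. X t \<omega>) s)"]
  by auto

lemma jump_Y_int:
  assumes "\<omega> \<in> space M" "0 < s"
  shows "fst (jump (\<lambda>t. X t \<omega>) s) \<in> \<int>"
proof -
  have "fst (left_lim (\<lambda>t. X t \<omega>) s) \<in> \<nat>" "fst (X s \<omega>) \<in> \<nat>"
    using jump_in_E(1)[OF assms] X_in_E[OF assms(1), of s] assms(2) E(2) by auto
  then show ?thesis by (auto simp: jump_def intro!: Ints_diff dest: subsetD[OF Nats_subset_Ints])
qed

lemma fst_E: "x \<in> E \<Longrightarrow> \<exists>n\<le>N. fst x = real n"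
  using E(4) by force

text \<open>The compact set of targets \<open>x + \<xi>\<close> has positive distance
  \<open>d\<close> from the closed set \<open>E\<close>. From a state within \<open>d\<close> of
  \<open>x\<close>, a jump in \<open>B\<close> would land outside \<open>E\<close>; so the
  comparison is with the empty set.\<close>

lemma K_outside:
  assumes x: "x \<in> E" and B: "compact B" "0 \<notin> B" "\<And>\<xi>. \<xi> \<in> B \<Longrightarrow> x + \<xi> \<notin> E"
  shows "K x B = 0"
proof -
  have Br: "B \<in> relcompact_sets" using B by (intro relcompact_subset[of _ B]) (auto intro: borel_compact)
  have "compact ((+) x ` B)" using B(1) by (rule compact_translation)
  moreover have "(+) x ` B \<inter> E = {}" using B(3) by auto
  ultimately obtain d where d: "d > 0" "\<And>\<xi> x'. \<xi> \<in> B \<Longrightarrow> x' \<in> E \<Longrightarrow> d \<le> dist (x + \<xi>) x'"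
    using separate_compact_closed[OF _ compact_imp_closed[OF E(1)]] by (metis image_eqI)
  have "K x B \<le> K x {}"
  proof (rule compare[OF x kernel_X kernel_X Br _ d(1)])
    show "{} \<in> relcompact_sets" by (simp add: relcompact_sets_def)
    fix \<omega> s
    assume \<omega>: "\<omega> \<in> space M" "0 < s" and near: "dist (left_lim (\<lambda>r. X r \<omega>) s) x < d"
      and j: "jump (\<lambda>r. X r \<omega>) s \<in> B"
    have "d \<le> dist (x + jump (\<lambda>r. X r \<omega>) s) (left_lim (\<lambda>t. X t \<omega>) s + jump (\<lambda>t. X t \<omega>) s)"
      by (rule d(2)[OF j jump_in_E(2)[OF \<omega>]])
    then show "jump (\<lambda>r. X r \<omega>) s \<noteq> 0 \<and> jump (\<lambda>r. X r \<omega>) s \<in> {}"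
      using near by (simp add: dist_norm norm_minus_commute)
  qed
  then show ?thesis using K_nonneg[OF x, of B] signed_radon_empty[OF K_signed] by simp
qed

text \<open>A jump of \<open>X\<close> in \<open>{\<sigma>} \<times> B\<close> is in particular a
  jump of \<open>Y\<close> of size \<open>\<sigma>\<close>.\<close>

lemma K_dir_le:
  assumes x: "x \<in> E" and B: "B \<in> sets borel" "bounded B"
  shows "K x ({1} \<times> B) \<le> (real N - fst x) * \<beta>" "K x ({-1} \<times> B) \<le> fst x * \<alpha>"
proof -
  have *: "K x ({\<sigma>} \<times> B) \<le> fst x * \<alpha> * dirac (-1) {\<sigma>} + (real N - fst x) * \<beta> * dirac 1 {\<sigma>}"
    if "\<sigma> \<noteq> 0" for \<sigma>
    by (rule compare[OF x kernel_X kernel_Y pair_relcompact[OF that B] singleton_relcompact[OF that] zero_less_one])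
      (use that in \<open>auto simp: jump_Y\<close>)
  show "K x ({1} \<times> B) \<le> (real N - fst x) * \<beta>" "K x ({-1} \<times> B) \<le> fst x * \<alpha>"
    using *[of 1] *[of "-1"] by (simp_all add: dirac_def singleton_relcompact)
qed

text \<open>Conversely, a jump of \<open>Y\<close> of size \<open>\<sigma>\<close> is a jump of
  \<open>X\<close> whose second coordinate is bounded by \<open>R\<close>. With
  \<open>K_dir_le\<close> this fixes the total rates.\<close>

lemma K_dir:
  assumes x: "x \<in> E"
  shows "K x ({1} \<times> {-R..R}) = (real N - fst x) * \<beta>" "K x ({-1} \<times> {-R..R}) = fst x * \<alpha>"
proof -
  have *: "fst x * \<alpha> * dirac (-1) {\<sigma>} + (real N - fst x) * \<beta> * dirac 1 {\<sigma>} \<le> K x ({\<sigma>} \<times> {-R..R})"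
    if "\<sigma> \<noteq> 0" for \<sigma>
  proof (rule compare[OF x kernel_Y kernel_X singleton_relcompact[OF that] pair_relcompact[OF that] zero_less_one])
    fix \<omega> s assume \<omega>: "\<omega> \<in> space M" "0 < s" and "jump (\<lambda>t. fst (X t \<omega>)) s \<in> {\<sigma>}"
    then have "fst (jump (\<lambda>t. X t \<omega>) s) = \<sigma>" by (simp add: jump_Y)
    then show "jump (\<lambda>r. X r \<omega>) s \<noteq> 0 \<and> jump (\<lambda>r. X r \<omega>) s \<in> {\<sigma>} \<times> {-R..R}"
      using jump_bounded[OF \<omega>] that by (auto simp: mem_Times_iff abs_le_iff)
  qed auto
  show "K x ({1} \<times> {-R..R}) = (real N - fst x) * \<beta>" "K x ({-1} \<times> {-R..R}) = fst x * \<alpha>"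
    using *[of 1] *[of "-1"] K_dir_le[OF x, of "{-R..R}"] by (simp_all add: dirac_def singleton_relcompact)
qed

text \<open>\<open>Y\<close> moves along the integers, and it cannot stand still at a jump since
  \<open>Z\<close> does not jump alone. There remain jumps of \<open>Y\<close> of modulus at least
  2, which its kernel does not charge.\<close>

lemma K_other:
  assumes x: "x \<in> E" and B: "B \<in> relcompact_sets" "\<And>\<xi>. \<xi> \<in> B \<Longrightarrow> fst \<xi> \<noteq> 1 \<and> fst \<xi> \<noteq> -1"
  shows "K x B = 0"
proof -
  define B' where "B' = {v :: real. 2 \<le> \<bar>v\<bar> \<and> \<bar>v\<bar> \<le> R}"
  have "B' = {-R..-2} \<union> {2..R}" by (auto simp: B'_def)
  then have "compact B'" by (simp add: compact_Un)
  then have B': "B' \<in> relcompact_sets"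
    by (intro relcompact_subset[of _ B']) (auto simp: B'_def[symmetric] borel_compact, auto simp: B'_def)
  have "K x B \<le> fst x * \<alpha> * dirac (-1) B' + (real N - fst x) * \<beta> * dirac 1 B'"
  proof (rule compare[OF x kernel_X kernel_Y B(1) B' zero_less_one])
    fix \<omega> s
    assume \<omega>: "\<omega> \<in> space M" "0 < s"
      and sub: "jump_times (\<lambda>t. snd (X t \<omega>)) \<subseteq> jump_times (\<lambda>t. fst (X t \<omega>))"
      and j: "jump (\<lambda>r. X r \<omega>) s \<noteq> 0" "jump (\<lambda>r. X r \<omega>) s \<in> B"
    have ne: "fst (jump (\<lambda>r. X r \<omega>) s) \<noteq> 0"
    proof
      assume 0: "fst (jump (\<lambda>r. X r \<omega>) s) = 0"
      then have "snd (jump (\<lambda>r. X r \<omega>) s) \<noteq> 0" using j(1) by (auto simp: prod_eq_iff)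
      then have "s \<in> jump_times (\<lambda>t. snd (X t \<omega>))" using \<omega> by (simp add: jump_times_def jump_Z)
      then have "s \<in> jump_times (\<lambda>t. fst (X t \<omega>))" using sub by blast
      then show False using 0 \<omega> by (simp add: jump_times_def jump_Y)
    qed
    moreover obtain k :: int where "fst (jump (\<lambda>r. X r \<omega>) s) = of_int k"
      using jump_Y_int[OF \<omega>] by (auto elim: Ints_cases)
    ultimately have "k \<noteq> 0" "k \<noteq> 1" "k \<noteq> -1" using B(2)[OF j(2)] by auto
    then have "2 \<le> \<bar>k\<bar>" by linarith
    then have "2 \<le> \<bar>fst (jump (\<lambda>r. X r \<omega>) s)\<bar>"
      unfolding \<open>fst (jump (\<lambda>r. X r \<omega>) s) = of_int k\<close> by linarith
    then show "jump (\<lambda>t. fst (X t \<omega>)) s \<noteq> 0 \<and> jump (\<lambda>t. fst (X t \<omega>)) s \<in> B'"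
      using ne \<omega> jump_bounded[OF \<omega>] by (simp add: jump_Y B'_def)
  qed
  moreover have "(-1) \<notin> B'" "1 \<notin> B'" by (auto simp: B'_def)
  ultimately show ?thesis using K_nonneg[OF x, of B] by (simp add: dirac_def split: if_splits)
qed

text \<open>Both sides count the jumps of \<open>X\<close> with second coordinate in
  \<open>B\<close>. Relative compactness keeps \<open>B\<close> away from 0, and so excludes the
  jumps of \<open>X\<close> that \<open>Z\<close> does not see.\<close>

lemma K_Z_eq:
  assumes x: "x \<in> E" and B: "B \<in> relcompact_sets"
  shows "K x ({1} \<times> B) + K x ({-1} \<times> B) = K\<^sub>Z (fst x) B"
proof -
  have Bb: "B \<in> sets borel" "bounded B" "compact (closure B)" "0 \<notin> closure B"
    using B bounded_subset[OF compact_imp_bounded closure_subset] by (auto simp: relcompact_sets_def)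
  have r: "A \<times> B \<in> relcompact_sets" if "A \<in> sets borel" "A \<subseteq> {-R..R}" for A
  proof (rule relcompact_subset[of _ "{-R..R} \<times> closure B"])
    show "A \<times> B \<subseteq> {-R..R} \<times> closure B" using closure_subset[of B] that by auto
  qed (use that Bb in \<open>auto simp: borel_Times zero_prod_def intro: compact_Times\<close>)
  have "K x ({-R..R} \<times> B) \<le> K\<^sub>Z (fst x) B"
  proof (rule compare[OF x kernel_X kernel_Z r B zero_less_one])
    fix \<omega> s
    assume \<omega>: "\<omega> \<in> space M" "0 < s" and j: "jump (\<lambda>r. X r \<omega>) s \<in> {-R..R} \<times> B"
    then show "jump (\<lambda>t. snd (X t \<omega>)) s \<noteq> 0 \<and> jump (\<lambda>t. snd (X t \<omega>)) s \<in> B"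
      using Bb(4) closure_subset[of B] by (auto simp: jump_Z)
  qed auto
  moreover have "K\<^sub>Z (fst x) B \<le> K x ({-R..R} \<times> B)"
  proof (rule compare[OF x kernel_Z kernel_X B r zero_less_one])
    fix \<omega> s
    assume \<omega>: "\<omega> \<in> space M" "0 < s"
      and j: "jump (\<lambda>t. snd (X t \<omega>)) s \<in> B" "jump (\<lambda>t. snd (X t \<omega>)) s \<noteq> 0"
    then show "jump (\<lambda>r. X r \<omega>) s \<noteq> 0 \<and> jump (\<lambda>r. X r \<omega>) s \<in> {-R..R} \<times> B"
      using jump_bounded[OF \<omega>] by (auto simp: jump_Z mem_Times_iff abs_le_iff)
  qed auto
  \<comment> \<open>The strip is split by the first coordinate; the part off 1 and -1 is null by
    \<open>K_other\<close>.\<close>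
  moreover have "{-R..R} \<times> B = ({1} \<times> B \<union> {-1} \<times> B) \<union> ({-R..R} - {1, -1}) \<times> B" using R(1) by auto
  then have "K x ({-R..R} \<times> B) = K x (({1} \<times> B \<union> {-1} \<times> B) \<union> ({-R..R} - {1, -1}) \<times> B)"
    by (rule arg_cong)
  moreover have "K x (({1} \<times> B \<union> {-1} \<times> B) \<union> ({-R..R} - {1, -1}) \<times> B) =
      K x ({1} \<times> B \<union> {-1} \<times> B) + K x (({-R..R} - {1, -1}) \<times> B)"
  proof (intro K_Un r)
    have "{1, -1 :: real} \<times> B \<in> relcompact_sets" using R(1) by (intro r) auto
    then show "{1 :: real} \<times> B \<union> {-1} \<times> B \<in> relcompact_sets"
      unfolding Sigma_Un_distrib1[symmetric] by (simp add: insert_commute)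
  qed auto
  moreover have "K x ({1} \<times> B \<union> {-1} \<times> B) = K x ({1} \<times> B) + K x ({-1} \<times> B)"
    using R(1) by (intro K_Un r) auto
  moreover have "K x (({-R..R} - {1, -1}) \<times> B) = 0"
    by (intro K_other[OF x] r) auto
  ultimately show ?thesis by linarith
qed

text \<open>If the fibre over 0 were a single point, the jump counter would force \<open>E\<close> into a line.\<close>

lemma fibre_0:
  obtains p q where "(0, p) \<in> E" "(0, q) \<in> E" "p \<noteq> q"
proof -
  \<comment> \<open>Apply the counter \<open>n\<close> times: each step lowers the first coordinate
    by 1 and adds \<open>\<zeta>\<^sub>0\<close> to the second.\<close>
  have 0: "(0, z + real n * \<zeta>\<^sub>0) \<in> E" if "(real n, z) \<in> E" for n z
    using that
  proof (induction n arbitrary: z)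
    case (Suc n)
    have "(real n, z + \<zeta>\<^sub>0) \<in> E" using counter[OF Suc.prems] by simp
    from Suc.IH[OF this] show ?case by (simp add: algebra_simps)
  qed simp
  have "\<exists>p q. (0, p) \<in> E \<and> (0, q) \<in> E \<and> p \<noteq> q"
  proof (rule ccontr)
    assume no: "\<nexists>p q. (0, p) \<in> E \<and> (0, q) \<in> E \<and> p \<noteq> q"
    obtain p where p: "(0, p) \<in> E" using E(4) by force
    \<comment> \<open>The line \<open>z + \<zeta>\<^sub>0 * y = p\<close> of the points that descend
      to \<open>(0, p)\<close> in this way.\<close>
    let ?L = "{x. inner (\<zeta>\<^sub>0, 1) x = p}"
    have "E \<subseteq> ?L"
    proof safe
      fix y z assume x: "(y, z) \<in> E"
      then obtain n where "y = real n" using fst_E by force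
      then have "(0, z + y * \<zeta>\<^sub>0) \<in> E" using 0 x by blast
      then show "inner (\<zeta>\<^sub>0, 1) (y, z) = p" using no p by (auto simp: algebra_simps)
    qed
    then have "affine hull E \<subseteq> ?L" by (rule hull_minimal) (rule affine_hyperplane)
    then have "(0, p + 1) \<in> ?L" unfolding E(3) by blast
    then show False by simp
  qed
  then show ?thesis using that by blast
qed

text \<open>The state-dependent factor of the rate of jumps in direction \<open>\<sigma>\<close>,
  meant for \<open>\<sigma>\<close> equal to 1 or -1.\<close>

definition weight :: "real \<Rightarrow> real \<Rightarrow> real" where
  "weight \<sigma> y = (if \<sigma> = 1 then real N - y else y)"

lemma weight_nonneg: "x \<in> E \<Longrightarrow> 0 \<le> weight \<sigma> (fst x)"
  using fst_E[of x] by (auto simp: weight_def)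

text \<open>The affine function \<open>a + c * z\<close> over \<open>y = 0\<close> has two zeros, so
  \<open>a\<close> and \<open>c\<close> vanish. \<open>B\<close> may contain 0 here, since
  \<open>{-1} \<times> B\<close> avoids the origin in any case.\<close>

lemma K_down:
  assumes B: "B \<in> sets borel" "bounded B"
  shows "\<exists>m. \<forall>y z. K (y, z) ({-1} \<times> B) = m * y"
proof -
  have "affine_map (\<lambda>x. K x ({-1} \<times> B))" using K(1) by (simp add: affine_kernel_def)
  from affine_map_real_pair[OF this] obtain a b c where *: "\<And>y z. K (y, z) ({-1} \<times> B) = a + b * y + c * z"
    by metis
  obtain p q where pq: "(0, p) \<in> E" "(0, q) \<in> E" "p \<noteq> q" by (rule fibre_0)
  have "K x ({-1} \<times> B) = 0" if "x \<in> E" "fst x = 0" for x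
    using K_dir_le(2)[OF that(1) B] K_nonneg[OF that(1), of "{-1} \<times> B"] that(2) by simp
  from this[OF pq(1)] this[OF pq(2)] have "a + c * p = 0" "a + c * q = 0" by (simp_all add: *)
  then have "c * (p - q) = 0" unfolding right_diff_distrib by linarith
  then have "c = 0" "a = 0" using pq(3) \<open>a + c * p = 0\<close> by auto
  then show ?thesis using * by (intro exI[of _ b]) simp
qed

lemma K_up_away:
  assumes B: "B \<in> relcompact_sets"
  shows "\<exists>m. \<forall>(y, z)\<in>E. K (y, z) ({1} \<times> B) = m * (real N - y)"
proof -
  have Bb: "B \<in> sets borel" "bounded B"
    using B bounded_subset[OF compact_imp_bounded closure_subset] by (auto simp: relcompact_sets_def)
  have "affine_map (\<lambda>x. K x ({1} \<times> B))" using K(1) by (simp add: affine_kernel_def)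
  from affine_map_real_pair[OF this] obtain a b c where *: "\<And>y z. K (y, z) ({1} \<times> B) = a + b * y + c * z"
    by metis
  obtain m where m: "\<And>y z. K (y, z) ({-1} \<times> B) = m * y" using K_down[OF Bb] by blast
  obtain p q where pq: "(0, p) \<in> E" "(0, q) \<in> E" "p \<noteq> q" by (rule fibre_0)
  have "a + c * p = a + c * q" using K_Z_eq[OF pq(1) B] K_Z_eq[OF pq(2) B] by (simp add: * m)
  then have c: "c = 0" using pq(3) by simp
  have "real N \<in> fst ` E" using E(4) by simp
  then obtain z where z: "(real N, z) \<in> E" by auto
  have "K (real N, z) ({1} \<times> B) = 0"
    using K_dir_le(1)[OF z Bb] K_nonneg[OF z, of "{1} \<times> B"] by simp
  then have "a + b * real N = 0" by (simp add: * c)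
  then show ?thesis using * c by (intro exI[of _ "-b"]) (auto simp: algebra_simps)
qed

text \<open>The case missing so far is an interval around \<open>\<zeta> = 0\<close> for upward
  jumps. Its complement in \<open>{-R..R}\<close> is away from 0, so the rate is the total rate
  \<open>(N - y) * \<beta>\<close> minus a known one.\<close>

lemma K_local:
  assumes \<sigma>: "\<sigma> = 1 \<or> \<sigma> = -1" and e: "0 < \<epsilon>"
  shows "\<exists>\<delta> m. 0 < \<delta> \<and> \<delta> \<le> \<epsilon> \<and> (\<forall>(y, z)\<in>E. K (y, z) ({\<sigma>} \<times> {\<zeta>-\<delta>..\<zeta>+\<delta>}) = m * weight \<sigma> y)"
proof (cases "\<sigma> = 1")
  case False
  then have "\<sigma> = -1" using \<sigma> by simp
  moreover obtain m where "\<And>y z. K (y, z) ({-1} \<times> {\<zeta>-\<epsilon>..\<zeta>+\<epsilon>}) = m * y"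
    using K_down[of "{\<zeta>-\<epsilon>..\<zeta>+\<epsilon>}"] by auto
  ultimately show ?thesis using e by (intro exI[of _ \<epsilon>] exI[of _ m]) (auto simp: weight_def)
next
  case True
  show ?thesis
  proof (cases "\<zeta> = 0")
    case False
    \<comment> \<open>At most half of \<open>\<bar>\<zeta>\<bar>\<close>, so that the interval
      misses 0 and \<open>K_up_away\<close> applies.\<close>
    define \<delta> where "\<delta> = min \<epsilon> (\<bar>\<zeta>\<bar> / 2)"
    have \<delta>: "0 < \<delta>" "\<delta> \<le> \<epsilon>" "\<delta> < \<bar>\<zeta>\<bar>" using e False by (auto simp: \<delta>_def)
    have "{\<zeta>-\<delta>..\<zeta>+\<delta>} \<in> relcompact_sets"
      by (rule relcompact_subset[of _ "{\<zeta>-\<delta>..\<zeta>+\<delta>}"]) (use \<delta> in auto)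
    from K_up_away[OF this] \<delta> True show ?thesis by (auto simp: weight_def)
  next
    case zero: True
    define \<delta> where "\<delta> = min \<epsilon> (R / 2)"
    have \<delta>: "0 < \<delta>" "\<delta> \<le> \<epsilon>" "\<delta> < R" using e R(1) by (auto simp: \<delta>_def)
    let ?B = "{-R..R} - {-\<delta>..\<delta>}"
    have B: "?B \<in> relcompact_sets"
      by (rule relcompact_subset[of _ "{-R..-\<delta>} \<union> {\<delta>..R}"]) (use \<delta> in auto)
    from K_up_away[OF B] obtain m where m: "\<And>x. x \<in> E \<Longrightarrow> K x ({1} \<times> ?B) = m * (real N - fst x)"
      by fastforce
    have "K x ({1} \<times> {-\<delta>..\<delta>}) = (\<beta> - m) * (real N - fst x)" if x: "x \<in> E" for x
    proof -
      have "K x ({1} \<times> {-\<delta>..\<delta>} \<union> {1} \<times> ?B) = K x ({1} \<times> {-\<delta>..\<delta>}) + K x ({1} \<times> ?B)"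
        by (intro K_Un pair_relcompact) auto
      moreover have "{1} \<times> {-\<delta>..\<delta>} \<union> {1::real} \<times> ?B = {1} \<times> {-R..R}" using \<delta> by auto
      ultimately show ?thesis using K_dir(1)[OF x] m[OF x] by (simp add: algebra_simps)
    qed
    then show ?thesis using \<delta> True zero by (intro exI[of _ \<delta>] exI[of _ "\<beta> - m"]) (auto simp: weight_def)
  qed
qed

text \<open>\<open>(\<sigma>, \<zeta>)\<close> lies in the support of some jump kernel \<open>K x\<close>.\<close>

definition charged :: "real \<Rightarrow> real \<Rightarrow> bool" where
  "charged \<sigma> \<zeta> \<longleftrightarrow> (\<exists>x\<in>E. \<forall>\<epsilon>>0. 0 < K x ({\<sigma>} \<times> {\<zeta>-\<epsilon>..\<zeta>+\<epsilon>}))"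

text \<open>Near \<open>(\<sigma>, \<zeta>)\<close> the kernel is a constant multiple of
  \<open>weight \<sigma>\<close>, so a point charged from one state is charged from every state of
  positive weight. A target outside the closed set \<open>E\<close> would contradict
  \<open>K_outside\<close>.\<close>

lemma charged_shift:
  assumes \<sigma>: "\<sigma> = 1 \<or> \<sigma> = -1" and c: "charged \<sigma> \<zeta>" and x: "x \<in> E" "0 < weight \<sigma> (fst x)"
  shows "x + (\<sigma>, \<zeta>) \<in> E"
proof (rule ccontr)
  assume "x + (\<sigma>, \<zeta>) \<notin> E"
  moreover have "open (- E)" using compact_imp_closed[OF E(1)] by (simp add: open_Compl)
  ultimately obtain e where e: "0 < e" "ball (x + (\<sigma>, \<zeta>)) e \<subseteq> - E"
    using openE[of "- E" "x + (\<sigma>, \<zeta>)"] by auto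
  have "0 < e / 2" using e by simp
  obtain \<delta> m where \<delta>: "0 < \<delta>" "\<delta> \<le> e / 2"
    "\<And>y z. (y, z) \<in> E \<Longrightarrow> K (y, z) ({\<sigma>} \<times> {\<zeta>-\<delta>..\<zeta>+\<delta>}) = m * weight \<sigma> y"
    using K_local[OF \<sigma> \<open>0 < e / 2\<close>, of \<zeta>] by blast
  obtain x0 where x0: "x0 \<in> E" "0 < K x0 ({\<sigma>} \<times> {\<zeta>-\<delta>..\<zeta>+\<delta>})" using c \<delta>(1) by (auto simp: charged_def)
  have K: "K x' ({\<sigma>} \<times> {\<zeta>-\<delta>..\<zeta>+\<delta>}) = m * weight \<sigma> (fst x')" if "x' \<in> E" for x'
    using \<delta>(3)[of "fst x'" "snd x'"] that by simp
  have "0 < m" using x0(2) weight_nonneg[OF x0(1), of \<sigma>] unfolding K[OF x0(1)]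
    by (auto simp: zero_less_mult_iff)
  then have "0 < K x ({\<sigma>} \<times> {\<zeta>-\<delta>..\<zeta>+\<delta>})" using x by (simp add: K)
  moreover have "K x ({\<sigma>} \<times> {\<zeta>-\<delta>..\<zeta>+\<delta>}) = 0"
  proof (rule K_outside[OF x(1)])
    show "compact ({\<sigma>} \<times> {\<zeta>-\<delta>..\<zeta>+\<delta>})" by (intro compact_Times) auto
    show "0 \<notin> {\<sigma>} \<times> {\<zeta>-\<delta>..\<zeta>+\<delta>}" using \<sigma> by (auto simp: zero_prod_def)
    fix \<xi> assume "\<xi> \<in> {\<sigma>} \<times> {\<zeta>-\<delta>..\<zeta>+\<delta>}"
    then obtain v where v: "\<xi> = (\<sigma>, v)" "\<bar>v - \<zeta>\<bar> \<le> \<delta>" by (auto simp: abs_le_iff)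
    have "dist (x + (\<sigma>, \<zeta>)) (x + \<xi>) = \<bar>v - \<zeta>\<bar>" by (simp add: v(1) dist_Pair_Pair dist_real_def abs_minus_commute)
    then have "x + \<xi> \<in> ball (x + (\<sigma>, \<zeta>)) e" using v(2) \<delta>(2) e(1) by simp
    then show "x + \<xi> \<notin> E" using e(2) by blast
  qed
  ultimately show False by simp
qed

text \<open>An interval on the line over \<open>\<sigma>\<close> is not open in the plane, so it is
  thickened; the part added is null by \<open>K_other\<close>.\<close>

lemma null_near_uncharged:
  assumes \<sigma>: "\<sigma> = 1 \<or> \<sigma> = -1" and x: "x \<in> E" and c: "\<not> charged \<sigma> \<zeta>"
  shows "\<exists>U. open U \<and> (\<sigma>, \<zeta>) \<in> U \<and> emeasure (pos_measure (K x)) U = 0"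
proof -
  obtain e where e: "0 < e" "K x ({\<sigma>} \<times> {\<zeta>-e..\<zeta>+e}) = 0"
    using c x K_nonneg[OF x] unfolding charged_def by (metis less_eq_real_def)
  \<comment> \<open>Half-width 1/2 keeps the rectangle away from the origin and from the line over
    \<open>- \<sigma>\<close>.\<close>
  define U where "U = {\<sigma>-1/2<..<\<sigma>+1/2} \<times> {\<zeta>-e<..<\<zeta>+e}"
  define C where "C = ({\<sigma>-1/2..\<sigma>+1/2} - {\<sigma>}) \<times> {\<zeta>-e..\<zeta>+e}"
  have C: "C \<in> relcompact_sets"
  proof (rule relcompact_subset)
    show "C \<in> sets borel" unfolding C_def by (intro borel_Times) auto
    show "C \<subseteq> {\<sigma>-1/2..\<sigma>+1/2} \<times> {\<zeta>-e..\<zeta>+e}" by (auto simp: C_def)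
    show "compact ({\<sigma>-1/2..\<sigma>+1/2} \<times> {\<zeta>-e..\<zeta>+e})" by (intro compact_Times) auto
    show "0 \<notin> {\<sigma>-1/2..\<sigma>+1/2} \<times> {\<zeta>-e..\<zeta>+e}" using \<sigma> by (auto simp: zero_prod_def)
  qed
  have L: "{\<sigma>} \<times> {\<zeta>-e..\<zeta>+e} \<in> relcompact_sets" using \<sigma> by (intro pair_relcompact) auto
  have "K x C = 0" using \<sigma> by (intro K_other[OF x C]) (auto simp: C_def)
  moreover have "emeasure (pos_measure (K x)) ({\<sigma>} \<times> {\<zeta>-e..\<zeta>+e} \<union> C) = ennreal (K x ({\<sigma>} \<times> {\<zeta>-e..\<zeta>+e} \<union> C))"
    using C L by (intro emeasure_jump_kernel[OF K(2)[OF x]])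
      (auto simp: relcompact_sets_def closure_Un compact_Un)
  moreover have "K x ({\<sigma>} \<times> {\<zeta>-e..\<zeta>+e} \<union> C) = K x ({\<sigma>} \<times> {\<zeta>-e..\<zeta>+e}) + K x C"
    by (rule K_Un[OF L C]) (auto simp: C_def)
  moreover have "U \<subseteq> {\<sigma>} \<times> {\<zeta>-e..\<zeta>+e} \<union> C" by (auto simp: U_def C_def)
  then have "emeasure (pos_measure (K x)) U \<le> emeasure (pos_measure (K x)) ({\<sigma>} \<times> {\<zeta>-e..\<zeta>+e} \<union> C)"
    using C L sets_jump_kernel[OF K(2)[OF x]] by (intro emeasure_mono) (auto simp: relcompact_borel)
  ultimately have "emeasure (pos_measure (K x)) U = 0" using e(2) by simp
  moreover have "open U" unfolding U_def by (intro open_Times) auto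
  moreover have "(\<sigma>, \<zeta>) \<in> U" using e(1) by (simp add: U_def)
  ultimately show ?thesis by blast
qed

text \<open>A small closed ball avoids the origin and the lines over 1 and -1, so
  \<open>K_other\<close> applies to it.\<close>

lemma null_near_other:
  assumes x: "x \<in> E" and \<xi>: "\<xi> \<noteq> 0" "fst \<xi> \<noteq> 1" "fst \<xi> \<noteq> -1"
  shows "\<exists>U. open U \<and> \<xi> \<in> U \<and> emeasure (pos_measure (K x)) U = 0"
proof -
  have "0 < min (norm \<xi>) (min \<bar>fst \<xi> - 1\<bar> \<bar>fst \<xi> + 1\<bar>)" using \<xi> by auto
  from field_lbound_gt_zero[OF this this] obtain e
    where e: "0 < e" "e < norm \<xi>" "e < \<bar>fst \<xi> - 1\<bar>" "e < \<bar>fst \<xi> + 1\<bar>" by auto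
  have B: "cball \<xi> e \<in> relcompact_sets"
    by (rule relcompact_subset[of _ "cball \<xi> e"]) (use e in auto)
  have "\<bar>fst \<xi> - fst \<eta>\<bar> \<le> e" if "\<eta> \<in> cball \<xi> e" for \<eta>
    using that dist_fst_le[of \<xi> \<eta>] by (simp add: dist_real_def)
  then have "K x (cball \<xi> e) = 0" using e by (intro K_other[OF x B]) force
  then have "emeasure (pos_measure (K x)) (cball \<xi> e) = 0"
    by (simp add: emeasure_jump_kernel[OF K(2)[OF x] B])
  moreover have "emeasure (pos_measure (K x)) (ball \<xi> e) \<le> emeasure (pos_measure (K x)) (cball \<xi> e)"
    using sets_jump_kernel[OF K(2)[OF x]] by (intro emeasure_mono) auto
  ultimately show ?thesis using e(1) by (intro exI[of _ "ball \<xi> e"]) auto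
qed

text \<open>Upward jumps from \<open>(0, p)\<close> have the positive rate
  \<open>N * \<beta>\<close>. If every point of the line over 1 were uncharged,
  \<open>emeasure_zero_locally\<close> would make this rate 0.\<close>

lemma exists_charged:
  assumes "0 < \<beta>"
  obtains \<zeta> where "charged 1 \<zeta>"
proof -
  obtain p where p: "(0, p) \<in> E" by (rule fibre_0)
  have "emeasure (pos_measure (K (0, p))) ({1} \<times> {-R..R}) = ennreal (real N * \<beta>)"
    using K_dir(1)[OF p] by (subst emeasure_jump_kernel[OF K(2)[OF p]]) (auto intro!: pair_relcompact)
  then have "emeasure (pos_measure (K (0, p))) ({1} \<times> {-R..R}) \<noteq> 0" using N assms by simp
  moreover have "emeasure (pos_measure (K (0, p))) ({1} \<times> {-R..R}) = 0" if "\<And>\<zeta>. \<not> charged 1 \<zeta>"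
  proof (rule emeasure_zero_locally)
    show "sets (pos_measure (K (0, p))) = sets borel" by (rule sets_jump_kernel[OF K(2)[OF p]])
    show "{1 :: real} \<times> {-R..R} \<in> sets borel" by (intro borel_Times) auto
  qed (use null_near_uncharged[OF _ p that] in auto)
  ultimately show ?thesis using that by blast
qed

section \<open>Translations between the fibres of \<open>E\<close>\<close>

lemma compact_fibre: "compact {z. (y, z) \<in> E}"
proof -
  have "compact (E \<inter> {y} \<times> UNIV)" by (intro compact_Int_closed E(1) closed_Times) auto
  then have "compact (snd ` (E \<inter> {y} \<times> UNIV))"
    by (intro compact_continuous_image) (auto intro!: continuous_intros)
  also have "snd ` (E \<inter> {y} \<times> UNIV) = {z. (y, z) \<in> E}" by force
  finally show ?thesis .
qed

lemma fibre_translation: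
  assumes "\<And>z. (y, z) \<in> E \<Longrightarrow> (y, z + \<delta>) \<in> E" "(y, z0) \<in> E"
  shows "\<delta> = 0"
  using assms by (intro translation_invariant_bounded[OF compact_imp_bounded[OF compact_fibre[of y]]]) auto

lemma fibre_1: obtains z where "(1, z) \<in> E"
proof -
  have "1 \<in> fst ` E" unfolding E(4) using N by (intro image_eqI[of _ _ 1]) auto
  then show ?thesis using that by auto
qed

text \<open>A charged upward jump followed by the counter maps the fibre over 0 into itself, shifted
  by \<open>\<zeta> + \<zeta>\<^sub>0\<close>.\<close>

lemma charged_up: "charged 1 \<zeta> \<Longrightarrow> \<zeta> = - \<zeta>\<^sub>0"
proof -
  assume c: "charged 1 \<zeta>"
  obtain p where p: "(0, p) \<in> E" by (rule fibre_0)
  have "(0, z + (\<zeta> + \<zeta>\<^sub>0)) \<in> E" if z: "(0, z) \<in> E" for z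
    using counter[OF charged_shift[OF _ c z]] N by (simp add: weight_def add.assoc)
  from fibre_translation[OF this p] show ?thesis by simp
qed

text \<open>For positive \<open>\<beta>\<close> a charged upward jump exists, and it must invert the
  counter.\<close>

lemma up_shift:
  assumes "0 < \<beta>" and x: "(y, z) \<in> E" "y < real N"
  shows "(y + 1, z - \<zeta>\<^sub>0) \<in> E"
proof -
  obtain \<zeta> where c: "charged 1 \<zeta>" by (rule exists_charged[OF assms(1)])
  show ?thesis using charged_shift[OF _ c x(1)] charged_up[OF c] x(2) by (simp add: weight_def)
qed

text \<open>The loop runs through the fibre over 1, where a downward jump is possible: down by the
  charged jump, then up by \<open>up_shift\<close>.\<close>

lemma charged_down: "0 < \<beta> \<Longrightarrow> charged (-1) \<zeta> \<Longrightarrow> \<zeta> = \<zeta>\<^sub>0"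
proof -
  assume b: "0 < \<beta>" and c: "charged (-1) \<zeta>"
  obtain p where p: "(1, p) \<in> E" by (rule fibre_1)
  have "(1, z + (\<zeta> - \<zeta>\<^sub>0)) \<in> E" if z: "(1, z) \<in> E" for z
    using up_shift[OF b, of 0 "z + \<zeta>"] charged_shift[OF _ c z] N by (simp add: weight_def add_diff_eq)
  from fibre_translation[OF this p] show ?thesis by simp
qed

text \<open>\<open>counter\<close> and \<open>up_shift\<close> are inverse bijections between
  neighbouring fibres, so the shear moves every fibre onto the one over 0.\<close>

lemma image_product:
  assumes "0 < \<beta>"
  shows "(\<lambda>x. (fst x, snd x + \<zeta>\<^sub>0 * fst x)) ` E = real ` {0..N} \<times> {z. (0, z) \<in> E}"
proof -
  have *: "(real n, z) \<in> E \<longleftrightarrow> (0, z + \<zeta>\<^sub>0 * real n) \<in> E" if "n \<le> N" for n z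
    using that
  proof (induction n arbitrary: z)
    case (Suc n)
    have "(real (Suc n), z) \<in> E \<longleftrightarrow> (real n, z + \<zeta>\<^sub>0) \<in> E"
      using counter[of "(real (Suc n), z)"] up_shift[OF assms, of "real n" "z + \<zeta>\<^sub>0"] Suc.prems
      by (auto simp: add.commute)
    also have "\<dots> \<longleftrightarrow> (0, z + \<zeta>\<^sub>0 + \<zeta>\<^sub>0 * real n) \<in> E" using Suc by simp
    finally show ?case by (simp add: algebra_simps)
  qed simp
  show ?thesis
  proof safe
    fix y z assume x: "(y, z) \<in> E"
    then obtain n where n: "n \<le> N" "y = real n" using fst_E[OF x] by auto
    then show "fst (y, z) \<in> real ` {0..N}" "(0, snd (y, z) + \<zeta>\<^sub>0 * fst (y, z)) \<in> E"
      using x *[OF n(1)] by auto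
  next
    fix n z assume "n \<in> {0..N}" "(0, z) \<in> E"
    then have "(real n, z - \<zeta>\<^sub>0 * real n) \<in> E" using *[of n "z - \<zeta>\<^sub>0 * real n"] by simp
    then show "(real n, z) \<in> (\<lambda>x. (fst x, snd x + \<zeta>\<^sub>0 * fst x)) ` E"
      by (intro image_eqI[of _ _ "(real n, z - \<zeta>\<^sub>0 * real n)"]) auto
  qed
qed

text \<open>The functional \<open>z + \<zeta>\<^sub>0 * y\<close> vanishes on both jumps that can be
  charged.\<close>

lemma continuous_transformed:
  assumes b: "0 < \<beta>"
  shows "continuous_process E P (\<lambda>t \<omega>. snd (X t \<omega>) + \<zeta>\<^sub>0 * fst (X t \<omega>))"
  unfolding continuous_process_def
proof
  fix x assume x: "x \<in> E"
  interpret filtered "completion (P x)" "augment (P x) F" by (rule filtered_P[OF x])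
  \<comment> \<open>The origin is left out too: \<open>null_near_other\<close> gives no null
    neighbourhood there, and a zero jump is harmless.\<close>
  define bad :: "(real \<times> real) set" where "bad = - {0, (1, - \<zeta>\<^sub>0), (-1, \<zeta>\<^sub>0)}"
  have bad: "bad \<in> sets borel" unfolding bad_def by auto
  have null: "emeasure (pos_measure (K x')) bad = 0" if x': "x' \<in> E" for x'
  proof (rule emeasure_zero_locally[OF sets_jump_kernel[OF K(2)[OF x']] bad])
    fix \<xi> assume \<xi>: "\<xi> \<in> bad"
    obtain a v where av: "\<xi> = (a, v)" by (cases \<xi>)
    consider "a = 1" | "a = -1" | "a \<noteq> 1" "a \<noteq> -1" by blast
    then show "\<exists>U. open U \<and> \<xi> \<in> U \<and> emeasure (pos_measure (K x')) U = 0"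
    proof cases
      case 1
      then have "\<not> charged 1 v" using charged_up[of v] \<xi> by (auto simp: bad_def av)
      then show ?thesis using null_near_uncharged[OF _ x', of 1 v] 1 by (simp add: av)
    next
      case 2
      then have "\<not> charged (-1) v" using charged_down[OF b, of v] \<xi> by (auto simp: bad_def av)
      then show ?thesis using null_near_uncharged[OF _ x', of "-1" v] 2 by (simp add: av)
    next
      case 3
      then show ?thesis using null_near_other[OF x', of \<xi>] \<xi> by (auto simp: bad_def av)
    qed
  qed
  let ?V = "\<lambda>t \<omega>. snd (X t \<omega>) + \<zeta>\<^sub>0 * fst (X t \<omega>)"
  have V: "?V t \<in> borel_measurable (completion (P x))" if "0 \<le> t" for t
  proof -
    have "(\<lambda>x. snd x + \<zeta>\<^sub>0 * fst x) \<in> borel_measurable (borel :: (real \<times> real) measure)"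
      by (intro borel_measurable_continuous_onI continuous_intros)
    from measurable_compose[OF adapted_measurable[OF adapted_P[OF x] that] this] show ?thesis by simp
  qed
  have cadlag_V: "cadlag (\<lambda>t. ?V t \<omega>)" if "\<omega> \<in> space (completion (P x))" for \<omega>
    using cadlag_compose[OF cadlag_X, of \<omega> "\<lambda>x. snd x + \<zeta>\<^sub>0 * fst x"] that space_P[OF x]
    by (simp add: continuous_intros)
  obtain D where D: "Measurable.pred (completion (P x)) D"
    "\<forall>\<omega>\<in>space (completion (P x)). jump_times (\<lambda>t. ?V t \<omega>) = {} \<longrightarrow> D \<omega>"
    "\<forall>\<omega>\<in>space (completion (P x)). D \<omega> \<longrightarrow> continuous_on {0..} (\<lambda>t. ?V t \<omega>)"
    using continuity_event[OF V cadlag_V] by blast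
  have "AE \<omega> in completion (P x). D \<omega>"
  proof (rule AE_no_jumps[OF K(3)[OF x] bad _ D(1)])
    show "emeasure (pos_measure (K (left_lim (\<lambda>r. X r \<omega>) t))) bad = 0"
      if "0 \<le> t" "\<omega> \<in> space (completion (P x))" for t \<omega>
      using that space_P[OF x] by (intro null left_lim_X) auto
    fix \<omega> assume \<omega>: "\<omega> \<in> space (completion (P x))"
      and no: "\<And>s. 0 < s \<Longrightarrow> jump (\<lambda>r. X r \<omega>) s \<noteq> 0 \<Longrightarrow> jump (\<lambda>r. X r \<omega>) s \<notin> bad"
    have "jump (\<lambda>t. ?V t \<omega>) s = 0" if s: "0 \<le> s" for s
    proof -
      have "bounded_linear (\<lambda>x. snd x + \<zeta>\<^sub>0 * fst x)" by (intro bounded_linear_intros)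
      moreover have "cadlag (\<lambda>t. X t \<omega>)" using \<omega> space_P[OF x] by (simp add: cadlag_X)
      ultimately have "jump (\<lambda>t. ?V t \<omega>) s = snd (jump (\<lambda>t. X t \<omega>) s) + \<zeta>\<^sub>0 * fst (jump (\<lambda>t. X t \<omega>) s)"
        using jump_linear s by fast
      moreover have "jump (\<lambda>r. X r \<omega>) s \<notin> bad"
        using no[of s] s by (cases "s = 0") (auto simp: bad_def)
      ultimately show ?thesis by (auto simp: bad_def)
    qed
    then show "D \<omega>" by (intro D(2)[rule_format, OF \<omega>]) (simp add: jump_times_def)
  qed
  with AE_space have "AE \<omega> in completion (P x). continuous_on {0..} (\<lambda>t. ?V t \<omega>)"
    by eventually_elim (rule D(3)[rule_format])
  then show "AE \<omega> in P x. continuous_on {0..} (\<lambda>t. ?V t \<omega>)" by (simp add: AE_completion_iff)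
qed

lemma few_jumps:
  assumes b: "\<beta> = 0" and x: "x \<in> E"
  shows "AE \<omega> in P x. finite (jump_times (\<lambda>t. snd (X t \<omega>))) \<and>
    real (card (jump_times (\<lambda>t. snd (X t \<omega>)))) \<le> fst x"
proof -
  interpret filtered "completion (P x)" "augment (P x) F" by (rule filtered_P[OF x])
  let ?Y = "\<lambda>\<omega> t. fst (X t \<omega>)"
  \<comment> \<open>An upward jump of \<open>Y\<close> is an integer, hence at least 1, and it is at
    most \<open>R\<close>; so this relatively compact set catches all of them.\<close>
  have rel: "{1..R} \<in> relcompact_sets" by (rule relcompact_subset[of _ "{1..R}"]) auto
  have null: "emeasure (pos_measure (\<lambda>A. y * \<alpha> * dirac (-1) A + (real N - y) * \<beta> * dirac 1 A)) {1..R} = 0"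
    if "y \<in> fst ` E" for y
    by (subst emeasure_jump_kernel[OF K\<^sub>Y(1)[OF that] rel]) (simp add: b dirac_def)
  have Y: "(\<lambda>\<omega>. fst (X t \<omega>)) \<in> borel_measurable (completion (P x))" if "0 \<le> t" for t
  proof -
    have "fst \<in> borel_measurable (borel :: (real \<times> real) measure)"
      by (intro borel_measurable_continuous_onI continuous_intros)
    from measurable_compose[OF adapted_measurable[OF adapted_P[OF x] that] this] show ?thesis by simp
  qed
  have cY: "cadlag (?Y \<omega>)" if "\<omega> \<in> space (completion (P x))" for \<omega>
    using that space_P[OF x] by (simp add: cadlag_Y)
  have iY: "fst (X t \<omega>) \<in> \<int>" if "\<omega> \<in> space (completion (P x))" "0 \<le> t" for \<omega> t
    using fst_E[OF X_in_E[of \<omega> t]] that space_P[OF x] by auto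
  obtain D where D: "Measurable.pred (completion (P x)) D"
    "\<forall>\<omega>\<in>space (completion (P x)). (\<forall>s>0. jump (?Y \<omega>) s \<le> 0) \<longrightarrow> D \<omega>"
    "\<forall>\<omega>\<in>space (completion (P x)). D \<omega> \<longrightarrow> (\<forall>s\<ge>0. \<forall>t\<ge>s. ?Y \<omega> t \<le> ?Y \<omega> s)"
    using antimono_event[OF Y cY iY] by blast
  have "AE \<omega> in completion (P x). D \<omega>"
  proof (rule AE_no_jumps[OF K\<^sub>Y(2)[OF x] relcompact_borel[OF rel] _ D(1)])
    show "emeasure (pos_measure (\<lambda>A. left_lim (?Y \<omega>) t * \<alpha> * dirac (-1) A +
        (real N - left_lim (?Y \<omega>) t) * \<beta> * dirac 1 A)) {1..R} = 0"
      if "0 \<le> t" "\<omega> \<in> space (completion (P x))" for t \<omega>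
      using that space_P[OF x] left_lim_X by (intro null) (simp add: left_lim_Y)
    fix \<omega> assume \<omega>': "\<omega> \<in> space (completion (P x))"
      and no: "\<And>s. 0 < s \<Longrightarrow> jump (?Y \<omega>) s \<noteq> 0 \<Longrightarrow> jump (?Y \<omega>) s \<notin> {1..R}"
    then have \<omega>: "\<omega> \<in> space M" using space_P[OF x] by simp
    have "jump (?Y \<omega>) s \<le> 0" if s: "0 < s" for s
    proof -
      obtain k :: int where k: "jump (?Y \<omega>) s = of_int k"
        using jump_Y_int[OF \<omega> s] s \<omega> by (auto simp: jump_Y elim: Ints_cases)
      moreover have "jump (?Y \<omega>) s \<le> R" using jump_bounded(1)[OF \<omega> s] s \<omega> by (simp add: jump_Y)
      ultimately show ?thesis using no[OF s] by (cases "k \<le> 0") auto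
    qed
    then show "D \<omega>" using D(2) \<omega>' by blast
  qed
  with AE_space have "AE \<omega> in completion (P x). \<forall>s\<ge>0. \<forall>t\<ge>s. fst (X t \<omega>) \<le> fst (X s \<omega>)"
    by eventually_elim (use D(3) in blast)
  then have "AE \<omega> in P x. \<forall>s\<ge>0. \<forall>t\<ge>s. fst (X t \<omega>) \<le> fst (X s \<omega>)"
    by (simp add: AE_completion_iff)
  with ZY[OF x] start_P[OF x] AE_space show ?thesis
  proof eventually_elim
    case (elim \<omega>)
    have \<omega>: "\<omega> \<in> space M" using elim space_P[OF x] by simp
    have "finite (jump_times (?Y \<omega>)) \<and> real (card (jump_times (?Y \<omega>))) \<le> fst (X 0 \<omega>)"
      using elim(4) fst_E[OF X_in_E[OF \<omega>]]
      by (intro antimono_integer_path_jumps cadlag_Y[OF \<omega>]) force+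
    moreover from this have "card (jump_times (\<lambda>t. snd (X t \<omega>))) \<le> card (jump_times (?Y \<omega>))"
      using elim(1) by (intro card_mono) auto
    ultimately show ?case using elim finite_subset[OF elim(1)] by auto
  qed
qed

end

section \<open>Martingales\<close>

lemma cadlag_cong:
  fixes f :: "real \<Rightarrow> 'a::topological_space"
  assumes "cadlag f" "\<And>t. 0 \<le> t \<Longrightarrow> f t = g t"
  shows "cadlag g"
  unfolding cadlag_def
proof (intro conjI allI impI)
  fix t :: real assume t: "0 \<le> t"
  have "eventually (\<lambda>s. f s = g s) (at_right t)"
    using t assms(2) by (auto simp: eventually_at_right_field intro!: exI[of _ "t + 1"])
  then show "(g \<longlongrightarrow> g t) (at_right t)"
    using assms(1) t by (auto simp: cadlag_def assms(2)[symmetric] elim!: Lim_transform_eventually)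
next
  fix t :: real assume t: "0 < t"
  have "eventually (\<lambda>s. f s = g s) (at_left t)"
    using t assms(2) by (auto simp: eventually_at_left_field intro!: exI[of _ 0])
  moreover obtain l where "(f \<longlongrightarrow> l) (at_left t)" using assms(1) t by (auto simp: cadlag_def)
  ultimately show "\<exists>l. (g \<longlongrightarrow> l) (at_left t)" using Lim_transform_eventually by blast
qed

text \<open>A true martingale, tested on sets of the past, is localized by the constant times
  \<open>n\<close>.\<close>

lemma (in filtered) local_martingaleI:
  assumes Q: "finite_measure Q" and ad: "adapted F X" and c: "\<And>\<omega>. \<omega> \<in> space Q \<Longrightarrow> cadlag (\<lambda>t. X t \<omega>)"
    and i: "\<And>t. 0 \<le> t \<Longrightarrow> integrable Q (X t)"
    and m: "\<And>s t A. 0 \<le> s \<Longrightarrow> s \<le> t \<Longrightarrow> A \<in> sets (F s) \<Longrightarrow>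
      set_lebesgue_integral Q A (X t) = set_lebesgue_integral Q A (X s)"
  shows "local_martingale Q F X"
  unfolding local_martingale_def
proof (intro conjI ballI exI[of _ "\<lambda>n \<omega>. real n"] allI)
  show "adapted F X" by (rule ad)
  show "cadlag (\<lambda>t. X t \<omega>)" if "\<omega> \<in> space Q" for \<omega> by (rule c[OF that])
  show "stopping_time F (\<lambda>\<omega>. real n)" for n by (rule stopping_time_const)
  have "incseq real" by (simp add: incseq_def)
  then show "AE \<omega> in Q. incseq (\<lambda>n. real n) \<and> filterlim (\<lambda>n. real n) at_top sequentially"
    by (intro AE_I2 conjI filterlim_real_sequentially)
  fix n :: nat
  show "martingale Q F (\<lambda>t \<omega>. X (min t (real n)) \<omega>)"
    unfolding martingale_def
  proof (intro conjI allI impI)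
    show "adapted F (\<lambda>t \<omega>. X (min t (real n)) \<omega>)"
      unfolding adapted_def
    proof (intro allI impI)
      fix t :: real assume t: "0 \<le> t"
      have "subalgebra (F t) (F (min t (real n)))"
        unfolding subalgebra_def using t sets_F_mono[of "min t (real n)" t] by (simp add: space_F)
      moreover have "X (min t (real n)) \<in> borel_measurable (F (min t (real n)))"
        using ad t unfolding adapted_def by simp
      ultimately show "X (min t (real n)) \<in> borel_measurable (F t)"
        by (rule measurable_from_subalg)
    qed
    show "integrable Q (\<lambda>\<omega>. X (min t (real n)) \<omega>)" if "0 \<le> t" for t
      using that by (intro i) simp
    fix s t :: real assume st: "0 \<le> s" "s \<le> t"
    interpret finite_measure_subalgebra Q "F s"
      by (intro finite_measure_subalgebra.intro finite_measure_subalgebra_axioms.intro Q subalg st)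
    show "AE \<omega> in Q. real_cond_exp Q (F s) (\<lambda>\<omega>. X (min t (real n)) \<omega>) \<omega> = X (min s (real n)) \<omega>"
    proof (rule real_cond_exp_charact)
      show "integrable Q (X (min t (real n)))" "integrable Q (X (min s (real n)))" using st by (auto intro!: i)
      have "subalgebra (F s) (F (min s (real n)))"
        unfolding subalgebra_def using st sets_F_mono[of "min s (real n)" s] by (simp add: space_F)
      moreover have "X (min s (real n)) \<in> borel_measurable (F (min s (real n)))"
        using ad st unfolding adapted_def by simp
      ultimately show "X (min s (real n)) \<in> borel_measurable (F s)"
        by (rule measurable_from_subalg)
      fix A assume A: "A \<in> sets (F s)"
      show "set_lebesgue_integral Q A (X (min t (real n))) = set_lebesgue_integral Q A (X (min s (real n)))"
      proof (cases "s \<le> real n")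
        case True
        then show ?thesis using m[OF st(1) _ A, of "min t (real n)"] st by (simp add: min_def)
      next
        case False
        then show ?thesis using st by (simp add: min_def)
      qed
    qed
  qed
qed simp_all

lemma (in filtered) local_martingale_zero:
  assumes Q: "finite_measure Q" and z: "\<And>t \<omega>. 0 \<le> t \<Longrightarrow> \<omega> \<in> space Q \<Longrightarrow> X t \<omega> = 0"
  shows "local_martingale Q F X"
proof (rule local_martingaleI[OF Q])
  show "adapted F X" unfolding adapted_def
  proof (intro allI impI)
    fix t :: real assume t: "0 \<le> t"
    have "X t \<in> borel_measurable (F t) \<longleftrightarrow> (\<lambda>\<omega>. 0 :: real) \<in> borel_measurable (F t)"
      by (rule measurable_cong) (simp add: space_F t z)
    then show "X t \<in> borel_measurable (F t)" by simp
  qed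
  show "cadlag (\<lambda>t. X t \<omega>)" if "\<omega> \<in> space Q" for \<omega>
    by (rule cadlag_cong[of "\<lambda>_. 0"]) (use that z in \<open>auto simp: cadlag_def\<close>)
  show "integrable Q (X t)" if "0 \<le> t" for t
    by (subst Bochner_Integration.integrable_cong[of Q Q _ "\<lambda>_. 0"]) (auto simp: z that)
  show "set_lebesgue_integral Q A (X t) = set_lebesgue_integral Q A (X s)"
    if "0 \<le> s" "s \<le> t" for s t A
    unfolding set_lebesgue_integral_def using that z by (intro Bochner_Integration.integral_cong) auto
qed

lemma (in filtered) fv_process_zero: "fv_process Q F (\<lambda>_ _. 0)"
  by (auto simp: fv_process_def adapted_def cadlag_def finite_variation_def)

lemma (in filtered) predictable_const: "predictable Q F (\<lambda>_ _. c)"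
  by (simp add: predictable_def)

text \<open>A process of finite variation is, up to its initial value, its own finite variation
  part, with both martingale parts zero.\<close>

lemma (in filtered) continuous_part_zero:
  assumes Q: "finite_measure Q" and A: "fv_process Q F (\<lambda>t \<omega>. X t \<omega> - X 0 \<omega>)"
  shows "continuous_martingale_part Q F X (\<lambda>_ _. 0)"
  unfolding continuous_martingale_part_def
proof (intro conjI ballI)
  show "continuous_local_martingale Q F (\<lambda>_ _. 0)"
    by (auto simp: continuous_local_martingale_def intro: local_martingale_zero[OF Q])
  have "purely_discontinuous Q F (\<lambda>_ _. 0)"
    by (auto simp: purely_discontinuous_def intro: local_martingale_zero[OF Q])
  then show "\<exists>M A. purely_discontinuous Q F M \<and> fv_process Q F A \<and>
      (AE \<omega> in Q. \<forall>t\<ge>0. X t \<omega> = X 0 \<omega> + 0 + M t \<omega> + A t \<omega>)"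
    using A by - (rule exI[of _ "\<lambda>_ _. 0"], rule exI[of _ "\<lambda>t \<omega>. X t \<omega> - X 0 \<omega>"], auto)
qed simp

lemma (in filtered) semimartingale_fv:
  assumes Q: "finite_measure Q" and "adapted F X" "\<And>\<omega>. \<omega> \<in> space Q \<Longrightarrow> cadlag (\<lambda>t. X t \<omega>)"
    and A: "fv_process Q F (\<lambda>t \<omega>. X t \<omega> - X 0 \<omega>)"
  shows "real_semimartingale Q F X"
  unfolding real_semimartingale_def
proof (intro conjI ballI)
  have "local_martingale Q F (\<lambda>_ _. 0)" by (rule local_martingale_zero[OF Q]) simp
  then show "\<exists>M A. local_martingale Q F M \<and> (\<forall>\<omega>\<in>space Q. M 0 \<omega> = 0) \<and> fv_process Q F A \<and>
      (AE \<omega> in Q. \<forall>t\<ge>0. X t \<omega> = X 0 \<omega> + M t \<omega> + A t \<omega>)"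
    using A by - (rule exI[of _ "\<lambda>_ _. 0"], rule exI[of _ "\<lambda>t \<omega>. X t \<omega> - X 0 \<omega>"], auto)
qed (use assms in auto)

text \<open>The sign \<open>\<epsilon>\<close> treats increasing and decreasing functions together;
  the sum of increments telescopes.\<close>

lemma finite_variation_mono:
  assumes "\<And>s t. 0 \<le> s \<Longrightarrow> s \<le> t \<Longrightarrow> \<epsilon> * f s \<le> \<epsilon> * f t" and \<epsilon>: "\<bar>\<epsilon>\<bar> = 1"
  shows "finite_variation f"
  unfolding finite_variation_def
proof (intro allI impI exI)
  fix t :: real and n :: nat and p :: "nat \<Rightarrow> real"
  assume t: "0 \<le> t" and p: "mono p \<and> range p \<subseteq> {0..t}"
  have "p k \<in> {0..t}" for k using p by blast
  then have p0: "0 \<le> p k" "p k \<le> t" for k by auto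
  have "\<bar>f (p (Suc k)) - f (p k)\<bar> = \<epsilon> * f (p (Suc k)) - \<epsilon> * f (p k)" for k
  proof -
    have "\<epsilon> * f (p k) \<le> \<epsilon> * f (p (Suc k))" using p p0 by (intro assms) (auto dest: monoD[of p k "Suc k"])
    then have "\<bar>\<epsilon> * (f (p (Suc k)) - f (p k))\<bar> = \<epsilon> * f (p (Suc k)) - \<epsilon> * f (p k)" by (simp add: algebra_simps)
    then show ?thesis using \<epsilon> by (simp add: abs_mult)
  qed
  then have "(\<Sum>k<n. \<bar>f (p (Suc k)) - f (p k)\<bar>) = \<epsilon> * f (p n) - \<epsilon> * f (p 0)"
    by (simp add: sum_lessThan_telescope[of "\<lambda>k. \<epsilon> * f (p k)"])
  also have "\<dots> \<le> \<epsilon> * f t - \<epsilon> * f 0" using p0[of n] p0[of 0] by (intro diff_mono assms) auto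
  finally show "(\<Sum>k<n. \<bar>f (p (Suc k)) - f (p k)\<bar>) \<le> \<epsilon> * f t - \<epsilon> * f 0" .
qed

section \<open>Multiples of Dirac measures\<close>

lemma radon_scaled_dirac:
  "u \<noteq> 0 \<Longrightarrow> radon_measure (scale_measure (ennreal c) (return borel (u :: 'a::euclidean_space)))"
  unfolding radon_measure_def
  by (auto simp: indicator_def ennreal_mult_less_top emeasure_return borel_compact)

lemma pos_measure_dirac:
  assumes "u \<noteq> (0 :: 'a::euclidean_space)" "0 \<le> c"
  shows "pos_measure (\<lambda>A. c * dirac u A) = scale_measure (ennreal c) (return borel u)"
  using radon_scaled_dirac[OF assms(1)]
  by (rule pos_measure_eqI) (auto simp: dirac_def relcompact_borel indicator_def emeasure_return)

text \<open>The coefficient may be negative, because an affine kernel is given on the whole space.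
  \<open>ennreal\<close> cuts negative numbers to 0, so scaling by \<open>c\<close> and by
  \<open>-c\<close> yields the positive and the negative part.\<close>

lemma signed_radon_dirac:
  assumes "u \<noteq> (0 :: 'a::euclidean_space)"
  shows "(\<lambda>A. c * dirac u A) \<in> signed_radon"
proof -
  let ?m = "\<lambda>c. scale_measure (ennreal c) (return borel u)"
  have "measure (?m d) A = max 0 d * indicator A u" if "A \<in> relcompact_sets" for A d
    using relcompact_borel[OF that]
    by (cases "0 \<le> d") (auto simp: measure_def emeasure_return ennreal_neg indicator_def)
  then have "(\<lambda>A. c * dirac u A) =
      (\<lambda>A. if A \<in> relcompact_sets then measure (?m c) A - measure (?m (-c)) A else 0)"
    by (auto simp: fun_eq_iff dirac_def max_def)
  then show ?thesis
    unfolding signed_radon_def using radon_scaled_dirac[OF assms] by blast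
qed

lemma jump_kernel_dirac:
  assumes "u \<noteq> (0 :: 'a::euclidean_space)" "0 \<le> c"
  shows "jump_kernel_measure (\<lambda>A. c * dirac u A)"
  unfolding jump_kernel_measure_def pos_measure_dirac[OF assms]
proof (intro conjI allI)
  show "(\<lambda>A. c * dirac u A) \<in> signed_radon" by (rule signed_radon_dirac[OF assms(1)])
  show "0 \<le> c * dirac u A" for A using assms(2) by (simp add: dirac_def)
  have "(\<integral>\<^sup>+\<xi>. ennreal (min ((norm \<xi>)\<^sup>2) 1) \<partial>scale_measure (ennreal c) (return borel u)) =
      ennreal c * ennreal (min ((norm u)\<^sup>2) 1)"
    by (simp add: nn_integral_scale_measure nn_integral_return)
  also have "\<dots> < \<infinity>" by (simp add: ennreal_mult_less_top)
  finally show "(\<integral>\<^sup>+\<xi>. ennreal (min ((norm \<xi>)\<^sup>2) 1) \<partial>scale_measure (ennreal c) (return borel u)) < \<infinity>" .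
qed

lemma affine_kernel_dirac:
  fixes f :: "'a::real_vector \<Rightarrow> real"
  assumes u: "u \<noteq> (0 :: 'b::euclidean_space)" and f: "linear f"
  shows "affine_kernel (\<lambda>x A. f x * dirac u A)"
  unfolding affine_kernel_def
proof (intro conjI allI signed_radon_dirac u)
  fix A
  have "linear (\<lambda>x. f x * dirac u A)"
    using linear_compose[OF f, of "\<lambda>y. y * dirac u A"] by (simp add: o_def linear_iff algebra_simps)
  then show "affine_map (\<lambda>x. f x * dirac u A)" unfolding affine_map_def by (intro exI[of _ 0] exI) auto
qed

section \<open>A process with a single jump\<close>

locale single_jump =
  fixes M :: "'w measure" and \<tau> :: "'w \<Rightarrow> real"
  assumes \<tau> [measurable]: "\<tau> \<in> borel_measurable M"
begin

text \<open>The maximum with 0 makes the filtration constant before time 0.\<close>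

definition alive :: "real \<Rightarrow> 'w set" where
  "alive t = {\<omega> \<in> space M. max 0 t < \<tau> \<omega>}"

text \<open>Before the jump only survival is observed, afterwards everything: \<open>alive t\<close>
  is an atom, and off it all of \<open>M\<close> is available. Right continuity and the dichotomies
  below are read off from this explicit form.\<close>

definition Filt :: "real \<Rightarrow> 'w measure" where
  "Filt t = sigma (space M) {A \<in> sets M. alive t \<subseteq> A \<or> alive t \<inter> A = {}}"

text \<open>The sign of \<open>\<tau>\<close> selects the path on nonnegative times: a jump from
  \<open>a\<close> to \<open>b\<close> at a positive \<open>\<tau>\<close>, constantly
  \<open>b\<close> if \<open>\<tau> = 0\<close>, constantly \<open>c\<close> if
  \<open>\<tau> < 0\<close>.\<close>

definition step :: "'a \<Rightarrow> 'a \<Rightarrow> 'a \<Rightarrow> real \<Rightarrow> 'w \<Rightarrow> 'a" where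
  "step a b c t \<omega> = (if t < \<tau> \<omega> then a else if 0 \<le> \<tau> \<omega> then b else c)"

lemma alive_sets [measurable]: "alive t \<in> sets M"
  unfolding alive_def by measurable

lemma sets_Filt: "sets (Filt t) = {A \<in> sets M. alive t \<subseteq> A \<or> alive t \<inter> A = {}}"
proof -
  let ?G = "{A \<in> sets M. alive t \<subseteq> A \<or> alive t \<inter> A = {}}"
  have "sigma_algebra (space M) ?G"
    unfolding sigma_algebra_iff2
  proof (intro conjI ballI allI impI)
    show "?G \<subseteq> Pow (space M)" using sets.sets_into_space by auto
    show "{} \<in> ?G" by simp
    show "space M - A \<in> ?G" if "A \<in> ?G" for A
      using that by (auto simp: alive_def)
    show "(\<Union>i. A i) \<in> ?G" if "range A \<subseteq> ?G" for A :: "nat \<Rightarrow> 'w set"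
    proof -
      have *: "A i \<in> sets M" "alive t \<subseteq> A i \<or> alive t \<inter> A i = {}" for i using that by auto
      then have "(\<Union>i. A i) \<in> sets M" by blast
      moreover have "alive t \<subseteq> (\<Union>i. A i) \<or> alive t \<inter> (\<Union>i. A i) = {}"
        using *(2) by blast
      ultimately show ?thesis by simp
    qed
  qed
  then show ?thesis unfolding Filt_def
    by (subst sets_measure_of) (auto simp: sigma_algebra.sigma_sets_eq dest: sets.sets_into_space)
qed

lemma space_Filt [simp]: "space (Filt t) = space M"
  by (simp add: Filt_def space_measure_of_conv)

lemma alive_mono: "s \<le> t \<Longrightarrow> alive t \<subseteq> alive s"
  by (auto simp: alive_def)

lemma filtration_Filt: "filtration (space M) Filt"
proof
  show "sets (Filt s) \<subseteq> sets (Filt t)" if "s \<le> t" for s t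
    using alive_mono[OF that] by (auto simp: sets_Filt)
qed simp

lemma subalgebra_Filt: "subalgebra M (Filt t)"
  by (auto simp: subalgebra_def sets_Filt)

text \<open>If a set splits \<open>alive t\<close>, two witnesses survive a little beyond
  \<open>t\<close>, so it also splits \<open>alive s\<close> for some \<open>s > t\<close>.\<close>

lemma right_continuous_Filt:
  assumes t: "0 \<le> t"
  shows "sets (Filt t) = (\<Inter>s\<in>{t<..}. sets (Filt s))"
proof
  show "sets (Filt t) \<subseteq> (\<Inter>s\<in>{t<..}. sets (Filt s))"
    by (intro INT_greatest filtration.sets_F_mono[OF filtration_Filt]) simp
  show "(\<Inter>s\<in>{t<..}. sets (Filt s)) \<subseteq> sets (Filt t)"
  proof
    fix A assume "A \<in> (\<Inter>s\<in>{t<..}. sets (Filt s))"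
    then have A: "A \<in> sets (Filt s)" if "t < s" for s using that by auto
    then have "A \<in> sets M" using subalgebra_Filt[of "t + 1"] by (force simp: subalgebra_def)
    moreover have "alive t \<subseteq> A \<or> alive t \<inter> A = {}"
    proof (rule ccontr)
      assume "\<not> ?thesis"
      then obtain v w where vw: "v \<in> alive t" "v \<notin> A" "w \<in> alive t" "w \<in> A" by blast
      define s where "s = (t + min (\<tau> v) (\<tau> w)) / 2"
      have "t < s" "s < \<tau> v" "s < \<tau> w" using vw t by (auto simp: s_def alive_def)
      then have "v \<in> alive s" "w \<in> alive s" using vw t by (auto simp: alive_def)
      then show False using A[OF \<open>t < s\<close>] vw by (auto simp: sets_Filt)
    qed
    ultimately show "A \<in> sets (Filt t)" by (simp add: sets_Filt)
  qed
qed

lemma step_measurable_M: "step a b c t \<in> borel_measurable M"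
  unfolding step_def by measurable

lemma measurable_FiltI:
  fixes f :: "'w \<Rightarrow> 'a::topological_space"
  assumes "f \<in> borel_measurable M" "\<And>\<omega>. \<omega> \<in> alive t \<Longrightarrow> f \<omega> = a"
  shows "f \<in> borel_measurable (Filt t)"
proof (rule measurableI)
  fix B :: "'a set" assume B: "B \<in> sets borel"
  have "f -` B \<inter> space M \<in> sets M" by (rule measurable_sets[OF assms(1) B])
  moreover have "alive t \<subseteq> f -` B \<inter> space M \<or> alive t \<inter> (f -` B \<inter> space M) = {}"
    using assms(2) by (cases "a \<in> B") (auto simp: alive_def)
  ultimately show "f -` B \<inter> space (Filt t) \<in> sets (Filt t)" by (simp add: sets_Filt)
qed simp

lemma adapted_step: "adapted Filt (step (a :: 'a::topological_space) b c)"
  unfolding adapted_def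
  by (intro allI impI measurable_FiltI[where a = a] step_measurable_M) (auto simp: alive_def step_def)

lemma cadlag_left_lim_step:
  fixes a b c :: "'a::t2_space"
  shows "cadlag (\<lambda>t. step a b c t \<omega>)"
    and "0 \<le> t \<Longrightarrow> left_lim (\<lambda>t. step a b c t \<omega>) t =
      (if t \<le> \<tau> \<omega> \<and> 0 < \<tau> \<omega> then a else if 0 \<le> \<tau> \<omega> then b else c)"
proof -
  have l: "((\<lambda>t. step a b c t \<omega>) \<longlongrightarrow> (if t \<le> \<tau> \<omega> then a else if 0 \<le> \<tau> \<omega> then b else c)) (at_left t)" for t
  proof (cases "t \<le> \<tau> \<omega>")
    case True
    have "eventually (\<lambda>s. t - 1 < s \<and> s < t) (at_left t)" by (rule eventually_at_left_gt) simp
    then have "eventually (\<lambda>s. a = step a b c s \<omega>) (at_left t)"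
      by (rule eventually_mono) (use True in \<open>auto simp: step_def\<close>)
    then show ?thesis using True Lim_transform_eventually[OF tendsto_const] by fastforce
  next
    case False
    then have "eventually (\<lambda>s. \<tau> \<omega> < s \<and> s < t) (at_left t)" by (intro eventually_at_left_gt) simp
    then have "eventually (\<lambda>s. (if 0 \<le> \<tau> \<omega> then b else c) = step a b c s \<omega>) (at_left t)"
      by (rule eventually_mono) (auto simp: step_def)
    then show ?thesis using False Lim_transform_eventually[OF tendsto_const] by fastforce
  qed
  have r: "((\<lambda>t. step a b c t \<omega>) \<longlongrightarrow> step a b c t \<omega>) (at_right t)" for t
  proof (cases "t < \<tau> \<omega>")
    case True
    then have "eventually (\<lambda>s. step a b c t \<omega> = step a b c s \<omega>) (at_right t)"
      by (auto simp: step_def eventually_at_right_field)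
    then show ?thesis by (rule Lim_transform_eventually[OF tendsto_const])
  next
    case False
    then have "eventually (\<lambda>s. step a b c t \<omega> = step a b c s \<omega>) (at_right t)"
      by (auto simp: step_def eventually_at_right_field intro!: exI[of _ "t + 1"])
    then show ?thesis by (rule Lim_transform_eventually[OF tendsto_const])
  qed
  show "cadlag (\<lambda>t. step a b c t \<omega>)" unfolding cadlag_def using l r by blast
  show "left_lim (\<lambda>t. step a b c t \<omega>) t =
      (if t \<le> \<tau> \<omega> \<and> 0 < \<tau> \<omega> then a else if 0 \<le> \<tau> \<omega> then b else c)" if "0 \<le> t"
  proof (cases "t = 0")
    case False
    then show ?thesis using left_lim_eqI[OF _ l, of t] that by auto
  qed (auto simp: step_def)
qed

lemma jump_step:
  fixes a b c :: "'a::real_normed_vector"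
  shows "0 \<le> t \<Longrightarrow> jump (\<lambda>t. step a b c t \<omega>) t = (if t = \<tau> \<omega> \<and> 0 < \<tau> \<omega> then b - a else 0)"
  unfolding jump_def by (subst cadlag_left_lim_step(2)) (auto simp: step_def)

end

text \<open>The assumption \<open>intensity\<close> covers the exponential law as well as all laws with \<open>\<tau> \<le> 0\<close>, for which
  the process is constant.\<close>

locale single_jump_law = single_jump M \<tau> + prob_space Q
  for M :: "'w measure" and \<tau> :: "'w \<Rightarrow> real" and Q :: "'w measure" +
  assumes sets_Q: "sets Q = sets M"
    and intensity: "\<And>w :: real \<Rightarrow> ennreal. w \<in> borel_measurable borel \<Longrightarrow>
      (\<integral>\<^sup>+\<omega>. w (\<tau> \<omega>) * indicator {0<..} (\<tau> \<omega>) \<partial>Q) = (\<integral>\<^sup>+\<omega>. (\<integral>\<^sup>+s. w s * indicator {0<..\<tau> \<omega>} s \<partial>lborel) \<partial>Q)"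
    and memoryless: "\<And>s t. 0 \<le> s \<Longrightarrow> 0 \<le> t \<Longrightarrow>
      measure Q {\<omega> \<in> space Q. s + t < \<tau> \<omega>} = exp (-t) * measure Q {\<omega> \<in> space Q. s < \<tau> \<omega>}"
begin

abbreviation cQ :: "'w measure" where "cQ \<equiv> completion Q"
abbreviation aF :: "real \<Rightarrow> 'w measure" where "aF \<equiv> augment Q Filt"

lemma space_Q: "space Q = space M"
  by (rule sets_eq_imp_space_eq[OF sets_Q])

lemma \<tau>_Q [measurable]: "\<tau> \<in> borel_measurable Q"
  using \<tau> unfolding measurable_cong_sets[OF sets_Q refl] .

lemma subalgebra_Q: "subalgebra Q (Filt t)"
  using subalgebra_Filt[of t] by (simp add: subalgebra_def space_Q sets_Q)

sublocale filt: filtered cQ aF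
  using filtration_Filt subalgebra_Q by (intro filtered_augment) (auto simp: space_Q)

lemma prob_cQ: "prob_space cQ"
  by (intro prob_spaceI) (simp add: emeasure_space_1)

lemma finite_cQ: "finite_measure cQ"
  by (rule prob_space.finite_measure[OF prob_cQ])

lemma adapted_augment: "adapted Filt X \<Longrightarrow> adapted aF X"
  unfolding adapted_def by (simp add: measurable_augment[of Q Filt, OF subalgebra_Q])

text \<open>The dichotomy defining \<open>Filt\<close> survives the augmentation up to a null set,
  because countably many null sets may be discarded in a union.\<close>

lemma augment_dichotomy:
  assumes "A \<in> sets (aF t)"
  shows "\<exists>L\<in>null_sets cQ. alive t - L \<subseteq> A \<or> (alive t - L) \<inter> A = {}"
  using assms unfolding sets_augment[of Q Filt t, OF subalgebra_Q]
proof induction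
  case (Basic A)
  then show ?case
  proof
    assume "A \<in> sets (Filt t)"
    then show ?thesis by (intro bexI[of _ "{}"]) (auto simp: sets_Filt)
  next
    assume "A \<in> null_sets (completion Q)"
    then show ?thesis by (intro bexI[of _ A]) auto
  qed
next
  case Empty
  show ?case by (intro bexI[of _ "{}"]) auto
next
  case (Compl A)
  then obtain L where "L \<in> null_sets cQ" "alive t - L \<subseteq> A \<or> (alive t - L) \<inter> A = {}" by blast
  then show ?case by (intro bexI[of _ L]) (auto simp: alive_def space_Q)
next
  case (Union A)
  show ?case
  proof (cases "\<exists>i. \<exists>L\<in>null_sets cQ. alive t - L \<subseteq> A i")
    case True
    then obtain i L where "L \<in> null_sets cQ" "alive t - L \<subseteq> A i" by blast
    then show ?thesis by (intro bexI[of _ L]) auto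
  next
    case False
    then have "\<exists>L\<in>null_sets cQ. (alive t - L) \<inter> A i = {}" for i using Union.IH[of i] by blast
    then obtain L where L: "\<And>i. L i \<in> null_sets cQ" "\<And>i. (alive t - L i) \<inter> A i = {}" by metis
    have "(alive t - (\<Union>i. L i)) \<inter> (\<Union>i. A i) = {}" using L(2) by blast
    moreover have "(\<Union>i. L i) \<in> null_sets cQ" using L(1) by (rule null_sets_UN)
    ultimately show ?thesis by blast
  qed
qed

text \<open>Before the jump nothing but survival is observed, so a predictable set depends on time
  alone up to and including \<open>\<tau>\<close>. The generators \<open>{s<..t} \<times> A\<close>
  are open at \<open>s\<close>; hence a time after \<open>s\<close> and not after
  \<open>\<tau>\<close> forces survival at \<open>s\<close>.\<close>

lemma predictable_set_deterministic:
  assumes "G \<in> sets (predictable_sigma cQ aF)"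
  shows "\<exists>L\<in>null_sets cQ. \<exists>D\<in>sets borel. \<forall>\<omega>\<in>space Q - L. \<forall>s. 0 < s \<and> s \<le> \<tau> \<omega> \<longrightarrow> ((s, \<omega>) \<in> G \<longleftrightarrow> s \<in> D)"
  using assms unfolding filt.sets_predictable
proof induction
  case (Basic G)
  then show ?case
  proof
    assume "G \<in> {{0} \<times> A | A. A \<in> sets (aF 0)}"
    then show ?thesis by (intro bexI[of _ "{}"] bexI[of _ "{}"]) auto
  next
    assume "G \<in> {{s<..t} \<times> A | s t A. 0 \<le> s \<and> s \<le> t \<and> A \<in> sets (aF s)}"
    then obtain s t A where G: "G = {s<..t} \<times> A" "0 \<le> s" "A \<in> sets (aF s)" by blast
    obtain L where L: "L \<in> null_sets cQ" "alive s - L \<subseteq> A \<or> (alive s - L) \<inter> A = {}"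
      using augment_dichotomy[OF G(3)] by blast
    have al: "\<omega> \<in> alive s" if "\<omega> \<in> space Q" "s < r" "r \<le> \<tau> \<omega>" for \<omega> r
      using that G(2) by (auto simp: alive_def space_Q)
    from L(2) show ?thesis
    proof
      assume "alive s - L \<subseteq> A"
      then show ?thesis using L(1) al unfolding G(1)
        by (intro bexI[of _ L] bexI[of _ "{s<..t}"]) auto
    next
      assume "(alive s - L) \<inter> A = {}"
      then show ?thesis using L(1) al unfolding G(1)
        by (intro bexI[of _ L] bexI[of _ "{}"]) auto
    qed
  qed
next
  case Empty
  show ?case by (intro bexI[of _ "{}"] bexI[of _ "{}"]) auto
next
  case (Compl G)
  then obtain L D where L: "L \<in> null_sets cQ" and D: "D \<in> sets borel"
    and "\<forall>\<omega>\<in>space Q - L. \<forall>s. 0 < s \<and> s \<le> \<tau> \<omega> \<longrightarrow> ((s, \<omega>) \<in> G \<longleftrightarrow> s \<in> D)" by blast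
  then have "\<forall>\<omega>\<in>space Q - L. \<forall>s. 0 < s \<and> s \<le> \<tau> \<omega> \<longrightarrow>
      ((s, \<omega>) \<in> {0..} \<times> space cQ - G \<longleftrightarrow> s \<in> - D)" by auto
  moreover have "- D \<in> sets borel" using D by auto
  ultimately show ?case using L by blast
next
  case (Union G)
  let ?P = "\<lambda>i L D. \<forall>\<omega>\<in>space Q - L. \<forall>s. 0 < s \<and> s \<le> \<tau> \<omega> \<longrightarrow> ((s, \<omega>) \<in> G i \<longleftrightarrow> s \<in> D)"
  have "\<forall>i. \<exists>LD. fst LD \<in> null_sets cQ \<and> snd LD \<in> sets borel \<and> ?P i (fst LD) (snd LD)"
    using Union.IH by (simp add: Bex_def)
  from choice[OF this] obtain LD where LD:
    "\<forall>i. fst (LD i) \<in> null_sets cQ \<and> snd (LD i) \<in> sets borel \<and> ?P i (fst (LD i)) (snd (LD i))" ..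
  define L where "L i = fst (LD i)" for i
  define D where "D i = snd (LD i)" for i
  have L: "\<And>i. L i \<in> null_sets cQ" and D: "\<And>i. D i \<in> sets borel" and *: "\<And>i. ?P i (L i) (D i)"
    using LD by (simp_all add: L_def D_def)
  have "\<forall>\<omega>\<in>space Q - (\<Union>i. L i). \<forall>s. 0 < s \<and> s \<le> \<tau> \<omega> \<longrightarrow> ((s, \<omega>) \<in> (\<Union>i. G i) \<longleftrightarrow> s \<in> (\<Union>i. D i))"
    using * by blast
  moreover have "(\<Union>i. D i) \<in> sets borel" using D by blast
  moreover have "(\<Union>i. L i) \<in> null_sets cQ" using L by (rule null_sets_UN)
  ultimately show ?case by - (rule bexI[of _ "\<Union>i. L i"], rule bexI[of _ "\<Union>i. D i"])
qed

text \<open>Extends the previous lemma to functions by the standard induction, merging countably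
  many null sets.\<close>

lemma predictable_deterministic:
  assumes "f \<in> borel_measurable (predictable_sigma cQ aF)"
  shows "\<exists>L\<in>null_sets cQ. \<exists>w\<in>borel_measurable borel. \<forall>\<omega>\<in>space Q - L. \<forall>s. 0 < s \<and> s \<le> \<tau> \<omega> \<longrightarrow>
    (f (s, \<omega>) :: ennreal) = w s"
  using assms
proof (induction rule: borel_measurable_induct)
  case (cong f g)
  then show ?case by (auto simp: space_Q)
next
  case (set A)
  obtain L D where "L \<in> null_sets cQ" "D \<in> sets borel"
    "\<forall>\<omega>\<in>space Q - L. \<forall>s. 0 < s \<and> s \<le> \<tau> \<omega> \<longrightarrow> ((s, \<omega>) \<in> A \<longleftrightarrow> s \<in> D)"
    using predictable_set_deterministic[OF set] by blast
  then show ?case by (intro bexI[of _ L] bexI[of _ "indicator D"]) (auto simp: indicator_def)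
next
  case (mult u c)
  then obtain L w where "L \<in> null_sets cQ" "w \<in> borel_measurable borel"
    "\<forall>\<omega>\<in>space Q - L. \<forall>s. 0 < s \<and> s \<le> \<tau> \<omega> \<longrightarrow> u (s, \<omega>) = w s" by blast
  then show ?case by (intro bexI[of _ L] bexI[of _ "\<lambda>s. c * w s"]) auto
next
  case (add u v)
  obtain L w where 1: "L \<in> null_sets cQ" "w \<in> borel_measurable borel"
    "\<forall>\<omega>\<in>space Q - L. \<forall>s. 0 < s \<and> s \<le> \<tau> \<omega> \<longrightarrow> u (s, \<omega>) = w s" using add.IH(1) by blast
  obtain L' w' where 2: "L' \<in> null_sets cQ" "w' \<in> borel_measurable borel"
    "\<forall>\<omega>\<in>space Q - L'. \<forall>s. 0 < s \<and> s \<le> \<tau> \<omega> \<longrightarrow> v (s, \<omega>) = w' s" using add.IH(2) by blast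
  show ?case by (intro bexI[of _ "L \<union> L'"] bexI[of _ "\<lambda>s. w s + w' s"]) (use 1 2 in auto)
next
  case (seq U)
  then obtain L w where L: "\<And>i. L i \<in> null_sets cQ" and w: "\<And>i. w i \<in> borel_measurable borel"
    and *: "\<And>i. \<forall>\<omega>\<in>space Q - L i. \<forall>s. 0 < s \<and> s \<le> \<tau> \<omega> \<longrightarrow> U i (s, \<omega>) = w i s" by metis
  have "\<forall>\<omega>\<in>space Q - (\<Union>i. L i). \<forall>s. 0 < s \<and> s \<le> \<tau> \<omega> \<longrightarrow> (SUP i. U i) (s, \<omega>) = (SUP i. w i s)"
    using * by (simp add: SUP_apply image_image)
  moreover have "(\<lambda>s. SUP i. w i s) \<in> borel_measurable borel" using w by measurable
  moreover have "(\<Union>i. L i) \<in> null_sets cQ" using L by (rule null_sets_UN)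
  ultimately show ?case by - (rule bexI[of _ "\<Union>i. L i"], rule bexI[of _ "\<lambda>s. SUP i. w i s"])
qed

end

section \<open>Characteristics of the process with a single jump\<close>

context single_jump_law
begin

text \<open>At the jump a predictable integrand is a deterministic \<open>w\<close> evaluated at
  \<open>\<tau>\<close>, so the identity reduces to \<open>intensity\<close>. The left limit of
  \<open>step 1 0 0\<close> is 1 as long as a jump is pending, up to and including
  \<open>\<tau>\<close>, and 0 otherwise: the rate is 1.\<close>

lemma jump_characteristic_step:
  fixes a b c :: "'a::euclidean_space"
  assumes ab: "a \<noteq> b"
  shows "jump_characteristic cQ aF (step a b c)
    (\<lambda>t \<omega>. scale_measure (ennreal (left_lim (\<lambda>r. step 1 0 0 r \<omega>) t)) (return borel (b - a)))"
  unfolding jump_characteristic_def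
proof (intro conjI allI ballI impI)
  let ?l = "\<lambda>t \<omega>. left_lim (\<lambda>r. step (1::real) 0 0 r \<omega>) t"
  have "predictable cQ aF ?l"
    by (rule filt.predictable_left_lim[OF adapted_augment[OF adapted_step] cadlag_left_lim_step(1)])
  then have l: "(\<lambda>(t, \<omega>). ennreal (?l t \<omega>)) \<in> borel_measurable (predictable_sigma cQ aF)"
    unfolding predictable_def by (simp add: case_prod_unfold)
  show "predictable cQ aF (\<lambda>t \<omega>. emeasure (scale_measure (ennreal (?l t \<omega>)) (return borel (b - a))) A)"
    if "A \<in> sets borel" for A
  proof -
    have "(\<lambda>x. (\<lambda>(t, \<omega>). ennreal (?l t \<omega>)) x * indicator A (b - a)) \<in> borel_measurable (predictable_sigma cQ aF)"
      by (rule borel_measurable_times_ennreal[OF l]) simp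
    then show ?thesis using that unfolding predictable_def
      by (simp add: case_prod_unfold emeasure_return)
  qed
  fix W :: "(real \<times> 'w) \<times> 'a \<Rightarrow> ennreal"
  assume W[measurable]: "W \<in> borel_measurable (predictable_sigma cQ aF \<Otimes>\<^sub>M borel)"
  define f where "f x = W (x, b - a)" for x
  have "f \<in> borel_measurable (predictable_sigma cQ aF)" unfolding f_def by measurable
  then obtain L w where L: "L \<in> null_sets cQ" and w[measurable]: "w \<in> borel_measurable borel"
    and fw: "\<forall>\<omega>\<in>space Q - L. \<forall>s. 0 < s \<and> s \<le> \<tau> \<omega> \<longrightarrow> f (s, \<omega>) = w s"
    using predictable_deterministic by blast
  have inner: "(\<integral>\<^sup>+s. W ((s, \<omega>), jump (\<lambda>r. step a b c r \<omega>) s) * indicator (jump_times (\<lambda>r. step a b c r \<omega>)) s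
      \<partial>count_space {0<..}) = w (\<tau> \<omega>) * indicator {0<..} (\<tau> \<omega>)" if \<omega>: "\<omega> \<in> space Q - L" for \<omega>
  proof -
    have "(\<integral>\<^sup>+s. W ((s, \<omega>), jump (\<lambda>r. step a b c r \<omega>) s) * indicator (jump_times (\<lambda>r. step a b c r \<omega>)) s
      \<partial>count_space {0<..}) = (\<integral>\<^sup>+s. w (\<tau> \<omega>) * indicator {\<tau> \<omega>} s \<partial>count_space {0<..})"
    proof (rule nn_integral_cong)
      fix s :: real assume "s \<in> space (count_space {0<..})"
      then have s: "0 < s" by simp
      then show "W ((s, \<omega>), jump (\<lambda>r. step a b c r \<omega>) s) * indicator (jump_times (\<lambda>r. step a b c r \<omega>)) s =
          w (\<tau> \<omega>) * indicator {\<tau> \<omega>} s"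
        using fw[rule_format, OF \<omega>, of s] ab by (auto simp: jump_step jump_times_def indicator_def f_def)
    qed
    also have "\<dots> = w (\<tau> \<omega>) * indicator {0<..} (\<tau> \<omega>)"
    proof (cases "0 < \<tau> \<omega>")
      case True
      then show ?thesis by (subst nn_integral_cmult_indicator) auto
    next
      case False
      then have "(\<integral>\<^sup>+s. w (\<tau> \<omega>) * indicator {\<tau> \<omega>} s \<partial>count_space {0<..}) =
          (\<integral>\<^sup>+s. 0 \<partial>count_space {0::real<..})"
        by (intro nn_integral_cong) (auto simp: indicator_def)
      then show ?thesis using False by simp
    qed
    finally show ?thesis .
  qed
  have AE_L: "AE \<omega> in cQ. \<omega> \<in> space Q - L"
    using AE_not_in[OF L] AE_space[of cQ] by eventually_elim simp
  have "(\<integral>\<^sup>+\<omega>. (\<integral>\<^sup>+s. W ((s, \<omega>), jump (\<lambda>r. step a b c r \<omega>) s) *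
      indicator (jump_times (\<lambda>r. step a b c r \<omega>)) s \<partial>count_space {0<..}) \<partial>cQ) =
      (\<integral>\<^sup>+\<omega>. w (\<tau> \<omega>) * indicator {0<..} (\<tau> \<omega>) \<partial>cQ)"
    by (intro nn_integral_cong_AE eventually_mono[OF AE_L] inner)
  also have "\<dots> = (\<integral>\<^sup>+\<omega>. (\<integral>\<^sup>+s. w s * indicator {0<..\<tau> \<omega>} s \<partial>lborel) \<partial>cQ)"
    unfolding nn_integral_completion by (rule intensity[OF w])
  also have "\<dots> = (\<integral>\<^sup>+\<omega>. (\<integral>\<^sup>+s. (\<integral>\<^sup>+\<xi>. W ((s, \<omega>), \<xi>)
      \<partial>scale_measure (ennreal (?l s \<omega>)) (return borel (b - a))) * indicator {0..} s \<partial>lborel) \<partial>cQ)"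
    using AE_L
  proof (intro nn_integral_cong_AE, eventually_elim)
    fix \<omega> assume \<omega>: "\<omega> \<in> space Q - L"
    have "(\<integral>\<^sup>+\<xi>. W ((s, \<omega>), \<xi>) \<partial>scale_measure (ennreal (?l s \<omega>)) (return borel (b - a))) =
        ennreal (?l s \<omega>) * W ((s, \<omega>), b - a)" if s: "0 \<le> s" for s
    proof -
      have "(s, \<omega>) \<in> space (predictable_sigma cQ aF)" using s \<omega> by simp
      from measurable_Pair2[OF W this] have "(\<lambda>\<xi>. W ((s, \<omega>), \<xi>)) \<in> borel_measurable borel" .
      then show ?thesis by (simp add: nn_integral_scale_measure nn_integral_return)
    qed
    then have "w s * indicator {0<..\<tau> \<omega>} s = (\<integral>\<^sup>+\<xi>. W ((s, \<omega>), \<xi>)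
        \<partial>scale_measure (ennreal (?l s \<omega>)) (return borel (b - a))) * indicator {0..} s" if "s \<noteq> 0" for s
      using fw[rule_format, OF \<omega>, of s] that
      by (auto simp: indicator_def cadlag_left_lim_step(2) f_def)
    \<comment> \<open>Time 0 belongs to the indicator on the right but not to the one on the left;
      it is a null set.\<close>
    then have "AE s in lborel. w s * indicator {0<..\<tau> \<omega>} s = (\<integral>\<^sup>+\<xi>. W ((s, \<omega>), \<xi>)
        \<partial>scale_measure (ennreal (?l s \<omega>)) (return borel (b - a))) * indicator {0..} s"
      using AE_lborel_singleton[of 0] by (auto elim!: eventually_mono)
    then show "(\<integral>\<^sup>+s. w s * indicator {0<..\<tau> \<omega>} s \<partial>lborel) = (\<integral>\<^sup>+s. (\<integral>\<^sup>+\<xi>. W ((s, \<omega>), \<xi>)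
        \<partial>scale_measure (ennreal (?l s \<omega>)) (return borel (b - a))) * indicator {0..} s \<partial>lborel)"
      by (rule nn_integral_cong_AE)
  qed
  finally show "(\<integral>\<^sup>+\<omega>. (\<integral>\<^sup>+s. W ((s, \<omega>), jump (\<lambda>r. step a b c r \<omega>) s) *
      indicator (jump_times (\<lambda>r. step a b c r \<omega>)) s \<partial>count_space {0<..}) \<partial>cQ) =
    (\<integral>\<^sup>+\<omega>. (\<integral>\<^sup>+s. (\<integral>\<^sup>+\<xi>. W ((s, \<omega>), \<xi>)
      \<partial>scale_measure (ennreal (?l s \<omega>)) (return borel (b - a))) * indicator {0..} s \<partial>lborel) \<partial>cQ)" .
qed simp

lemma fv_step:
  fixes a b c :: real
  shows "fv_process cQ aF (\<lambda>t \<omega>. step a b c t \<omega> - step a b c 0 \<omega>)"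
  unfolding fv_process_def
proof (intro conjI ballI)
  have "adapted Filt (\<lambda>t \<omega>. step a b c t \<omega> - step a b c 0 \<omega>)"
    unfolding adapted_def
    by (intro allI impI measurable_FiltI[where a = 0] borel_measurable_diff step_measurable_M)
      (auto simp: alive_def step_def)
  then show "adapted aF (\<lambda>t \<omega>. step a b c t \<omega> - step a b c 0 \<omega>)" by (rule adapted_augment)
  fix \<omega>
  show "cadlag (\<lambda>t. step a b c t \<omega> - step a b c 0 \<omega>)"
    using cadlag_compose[OF cadlag_left_lim_step(1), of "\<lambda>x. x - step a b c 0 \<omega>" a b c \<omega>]
    by (simp add: continuous_intros)
  show "finite_variation (\<lambda>t. step a b c t \<omega> - step a b c 0 \<omega>)"
    by (rule finite_variation_mono[of "if a \<le> b then 1 else -1"]) (auto simp: step_def)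
qed simp

text \<open>The martingale part of \<open>step 1 0 0\<close>.\<close>

definition comp :: "real \<Rightarrow> 'w \<Rightarrow> real" where
  "comp t \<omega> = min t (max 0 (\<tau> \<omega>)) - (if 0 < \<tau> \<omega> \<and> \<tau> \<omega> \<le> t then 1 else 0)"

lemma comp_measurable [measurable]: "comp t \<in> borel_measurable Q"
  unfolding comp_def by measurable

lemma comp_bound: "0 \<le> t \<Longrightarrow> \<bar>comp t \<omega>\<bar> \<le> t + 1"
  by (auto simp: comp_def min_def max_def)

lemma comp_integrable: "0 \<le> t \<Longrightarrow> integrable Q (comp t)"
  using comp_bound by (intro integrable_const_bound[where B = "t + 1"]) auto

text \<open>Take \<open>indicator {..t}\<close> for \<open>w\<close> in \<open>intensity\<close>:
  the inner integral becomes \<open>min t (max 0 (\<tau> \<omega>))\<close>.\<close>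

lemma comp_expectation:
  assumes t: "0 \<le> t"
  shows "integral\<^sup>L Q (comp t) = 0"
proof -
  let ?J = "\<lambda>\<omega>. if 0 < \<tau> \<omega> \<and> \<tau> \<omega> \<le> t then 1 else (0 :: real)"
  let ?m = "\<lambda>\<omega>. min t (max 0 (\<tau> \<omega>))"
  have J: "integrable Q ?J" by (intro integrable_const_bound[where B = 1]) auto
  have m: "integrable Q ?m" using t by (intro integrable_const_bound[where B = t]) auto
  have "(\<integral>\<^sup>+\<omega>. ennreal (?J \<omega>) \<partial>Q) = (\<integral>\<^sup>+\<omega>. indicator {..t} (\<tau> \<omega>) * indicator {0<..} (\<tau> \<omega>) \<partial>Q)"
    by (intro nn_integral_cong) (auto simp: indicator_def)
  also have "\<dots> = (\<integral>\<^sup>+\<omega>. (\<integral>\<^sup>+s. indicator {..t} s * indicator {0<..\<tau> \<omega>} s \<partial>lborel) \<partial>Q)"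
    by (rule intensity) simp
  also have "\<dots> = (\<integral>\<^sup>+\<omega>. (\<integral>\<^sup>+s. indicator {0<..?m \<omega>} s \<partial>lborel) \<partial>Q)"
    by (intro nn_integral_cong) (auto simp: indicator_def)
  also have "\<dots> = (\<integral>\<^sup>+\<omega>. ennreal (?m \<omega>) \<partial>Q)" using t by (intro nn_integral_cong) simp
  finally have "(\<integral>\<^sup>+\<omega>. ennreal (?J \<omega>) \<partial>Q) = (\<integral>\<^sup>+\<omega>. ennreal (?m \<omega>) \<partial>Q)" .
  then have "ennreal (integral\<^sup>L Q ?J) = ennreal (integral\<^sup>L Q ?m)"
    using t by (simp add: nn_integral_eq_integral[OF J] nn_integral_eq_integral[OF m])
  moreover have "0 \<le> integral\<^sup>L Q ?J" "0 \<le> integral\<^sup>L Q ?m"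
    using t by (auto intro!: Bochner_Integration.integral_nonneg)
  ultimately have "integral\<^sup>L Q ?J = integral\<^sup>L Q ?m" by (simp add: ennreal_inj)
  then show ?thesis unfolding comp_def using J m by (simp add: Bochner_Integration.integral_diff)
qed

text \<open>Outside \<open>alive s\<close> the jump is past or never comes, so \<open>comp\<close>
  is frozen.\<close>

lemma comp_increment: "0 \<le> s \<Longrightarrow> s \<le> t \<Longrightarrow> \<omega> \<in> space Q \<Longrightarrow> \<omega> \<notin> alive s \<Longrightarrow> comp t \<omega> = comp s \<omega>"
  by (auto simp: comp_def alive_def space_Q min_def max_def)

lemma adapted_comp: "adapted aF comp"
proof (rule adapted_augment)
  have "comp t \<in> borel_measurable M" for t unfolding comp_def by measurable
  then show "adapted Filt comp" unfolding adapted_def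
    by (intro allI impI measurable_FiltI[where a = "_ :: real"]) (auto simp: comp_def alive_def min_def)
qed

lemma cadlag_comp: "cadlag (\<lambda>t. comp t \<omega>)"
proof -
  have c: "((\<lambda>t. min t (max 0 (\<tau> \<omega>))) \<longlongrightarrow> min t (max 0 (\<tau> \<omega>))) (at t within S)" for t S
    by (intro tendsto_intros)
  have *: "comp t \<omega> = min t (max 0 (\<tau> \<omega>)) - step 0 (if 0 < \<tau> \<omega> then 1 else 0) 0 t \<omega>" for t
    by (auto simp: comp_def step_def)
  show ?thesis
    unfolding cadlag_def *
  proof (intro conjI allI impI)
    fix t :: real
    show "((\<lambda>t. min t (max 0 (\<tau> \<omega>)) - step 0 (if 0 < \<tau> \<omega> then 1 else 0) 0 t \<omega>) \<longlongrightarrow>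
        min t (max 0 (\<tau> \<omega>)) - step 0 (if 0 < \<tau> \<omega> then 1 else 0) 0 t \<omega>) (at_right t)" if "0 \<le> t"
      using that cadlag_left_lim_step(1)[of 0 "if 0 < \<tau> \<omega> then 1 else 0" 0 \<omega>] c
      by (intro tendsto_diff) (auto simp: cadlag_def)
    show "\<exists>l. ((\<lambda>t. min t (max 0 (\<tau> \<omega>)) - step 0 (if 0 < \<tau> \<omega> then 1 else 0) 0 t \<omega>) \<longlongrightarrow> l) (at_left t)"
      if "0 < t"
      using tendsto_diff[OF c tendsto_left_lim[OF cadlag_left_lim_step(1) that]] by blast
  qed
qed

text \<open>The increment lives on \<open>alive s\<close>, which \<open>A\<close> contains or misses
  up to a null set. So its integral over \<open>A\<close> is its full expectation 0, or trivially
  0.\<close>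

lemma comp_set_integral:
  assumes st: "0 \<le> s" "s \<le> t" and A: "A \<in> sets (aF s)"
  shows "set_lebesgue_integral cQ A (comp t) = set_lebesgue_integral cQ A (comp s)"
proof -
  have A': "A \<in> sets cQ" using filt.sets_F[OF st(1)] A by blast
  have i: "integrable cQ (comp r)" if "0 \<le> r" for r
    using comp_integrable[OF that] by (subst integrable_completion) simp
  have e: "integral\<^sup>L cQ (comp r) = 0" if "0 \<le> r" for r
    using comp_expectation[OF that] by (subst integral_completion) simp
  have t: "0 \<le> t" using st by simp
  obtain L where L: "L \<in> null_sets cQ" "alive s - L \<subseteq> A \<or> (alive s - L) \<inter> A = {}"
    using augment_dichotomy[OF A] by blast
  have iA: "integrable cQ (\<lambda>\<omega>. indicator A \<omega> *\<^sub>R comp r \<omega>)" if "0 \<le> r" for r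
    by (rule integrable_mult_indicator[OF A' i[OF that]])
  have "(\<integral>\<omega>. indicator A \<omega> *\<^sub>R comp t \<omega> \<partial>cQ) - (\<integral>\<omega>. indicator A \<omega> *\<^sub>R comp s \<omega> \<partial>cQ) =
      (\<integral>\<omega>. indicator A \<omega> *\<^sub>R comp t \<omega> - indicator A \<omega> *\<^sub>R comp s \<omega> \<partial>cQ)"
    by (rule Bochner_Integration.integral_diff[symmetric, OF iA[OF t] iA[OF st(1)]])
  also have "\<dots> = 0"
    using L(2)
  proof
    assume sub: "alive s - L \<subseteq> A"
    have "(\<integral>\<omega>. indicator A \<omega> *\<^sub>R comp t \<omega> - indicator A \<omega> *\<^sub>R comp s \<omega> \<partial>cQ) = (\<integral>\<omega>. comp t \<omega> - comp s \<omega> \<partial>cQ)"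
    proof (rule integral_cong_AE)
      show "AE \<omega> in cQ. indicator A \<omega> *\<^sub>R comp t \<omega> - indicator A \<omega> *\<^sub>R comp s \<omega> = comp t \<omega> - comp s \<omega>"
        using AE_not_in[OF L(1)] AE_space
        by eventually_elim (use sub comp_increment[OF st] in \<open>auto simp: indicator_def\<close>)
    qed (use iA i st t in \<open>auto intro!: borel_measurable_integrable Bochner_Integration.integrable_diff\<close>)
    also have "\<dots> = 0" using i e st t by (subst Bochner_Integration.integral_diff) auto
    finally show ?thesis .
  next
    assume dis: "(alive s - L) \<inter> A = {}"
    have "AE \<omega> in cQ. indicator A \<omega> *\<^sub>R comp t \<omega> - indicator A \<omega> *\<^sub>R comp s \<omega> = 0"
      using AE_not_in[OF L(1)] AE_space
      by eventually_elim (use dis comp_increment[OF st] in \<open>auto simp: indicator_def\<close>)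
    then show ?thesis by (rule integral_eq_zero_AE)
  qed
  finally show ?thesis unfolding set_lebesgue_integral_def by simp
qed

lemma local_martingale_comp:
  assumes eq: "\<And>t \<omega>. 0 \<le> t \<Longrightarrow> X t \<omega> = comp t \<omega>"
  shows "local_martingale cQ aF X"
proof (rule filt.local_martingaleI[OF finite_cQ])
  have X: "X t = comp t" if "0 \<le> t" for t using eq[OF that] by (rule ext)
  show "adapted aF X" using adapted_comp X by (simp add: adapted_def)
  show "cadlag (\<lambda>t. X t \<omega>)" for \<omega> by (rule cadlag_cong[OF cadlag_comp]) (simp add: eq)
  show "integrable cQ (X t)" if "0 \<le> t" for t
    unfolding X[OF that] using comp_integrable[OF that] by (subst integrable_completion) simp
  fix s t A assume "0 \<le> s" "s \<le> t" "A \<in> sets (aF s)"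
  then show "set_lebesgue_integral cQ A (X t) = set_lebesgue_integral cQ A (X s)"
    using comp_set_integral[of s t A] by (simp add: X)
qed

end

lemma truncation_unit: "truncation_function (unit_truncation :: 'a::euclidean_space \<Rightarrow> 'a)"
  unfolding truncation_function_def
proof (intro conjI)
  show "(unit_truncation :: 'a \<Rightarrow> 'a) \<in> borel_measurable borel"
    unfolding unit_truncation_def by measurable
  show "bounded (range (unit_truncation :: 'a \<Rightarrow> 'a))"
    unfolding bounded_iff by (intro exI[of _ 1]) (auto simp: unit_truncation_def)
  have "eventually (\<lambda>\<xi>. \<xi> \<in> ball (0 :: 'a) 1) (nhds 0)" by (rule eventually_nhds_in_open) auto
  then show "\<forall>\<^sub>F \<xi> in nhds 0. unit_truncation \<xi> = (\<xi> :: 'a)"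
    by eventually_elim (simp add: unit_truncation_def)
qed

context single_jump
begin

lemma step_inner: "step a b c t \<omega> \<bullet> i = step (a \<bullet> i) (b \<bullet> i) (c \<bullet> i) t \<omega>"
  by (simp add: step_def)

text \<open>Used for \<open>Y\<close>: its jump -1 has norm exactly 1 and therefore survives
  \<open>unit_truncation\<close>.\<close>

lemma big_jumps_removed_small:
  assumes "norm (b - a) \<le> 1"
  shows "big_jumps_removed unit_truncation (step a b c) t \<omega> = step a b c t \<omega>"
proof -
  have "{s. 0 < s \<and> s \<le> t \<and> unit_truncation (jump (\<lambda>r. step a b c r \<omega>) s) \<noteq> jump (\<lambda>r. step a b c r \<omega>) s} = {}"
    using assms by (auto simp: jump_step unit_truncation_def)
  then show ?thesis by (simp add: big_jumps_removed_def Let_def)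
qed

text \<open>Used for \<open>X\<close>: the jump \<open>(-1, 1)\<close> has norm
  \<open>sqrt 2\<close> and is removed, so nothing moves and the drift relative to
  \<open>unit_truncation\<close> is 0.\<close>

lemma big_jumps_removed_large:
  assumes "1 < norm (b - a)" "0 \<le> t"
  shows "big_jumps_removed unit_truncation (step a b c) t \<omega> = step a b c 0 \<omega>"
proof -
  have *: "{s. 0 < s \<and> s \<le> t \<and> unit_truncation (jump (\<lambda>r. step a b c r \<omega>) s) \<noteq> jump (\<lambda>r. step a b c r \<omega>) s} =
      (if 0 < \<tau> \<omega> \<and> \<tau> \<omega> \<le> t then {\<tau> \<omega>} else {})"
    using assms(1) by (auto simp: jump_step unit_truncation_def split: if_splits)
  have eq: "big_jumps_removed unit_truncation (step a b c) t \<omega> = step a b c t \<omega> -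
      (\<Sum>s\<in>(if 0 < \<tau> \<omega> \<and> \<tau> \<omega> \<le> t then {\<tau> \<omega>} else {}).
        jump (\<lambda>r. step a b c r \<omega>) s - unit_truncation (jump (\<lambda>r. step a b c r \<omega>) s))"
    unfolding big_jumps_removed_def Let_def * ..
  show ?thesis
  proof (cases "0 < \<tau> \<omega> \<and> \<tau> \<omega> \<le> t")
    case True
    then have j: "jump (\<lambda>r. step a b c r \<omega>) (\<tau> \<omega>) = b - a" by (simp add: jump_step)
    have "unit_truncation (b - a) = 0" using assms(1) by (simp add: unit_truncation_def)
    then show ?thesis unfolding eq using True by (simp add: j) (simp add: step_def)
  next
    case False
    then have "step a b c t \<omega> = step a b c 0 \<omega>" using assms(2) by (auto simp: step_def)
    then show ?thesis unfolding eq if_not_P[OF False] by simp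
  qed
qed

end

context single_jump_law
begin

lemma adapted_step_augment:
  fixes a b c :: "'b::topological_space"
  shows "adapted aF (step a b c)"
  by (rule adapted_augment[OF adapted_step])

lemma fv_step_inner:
  fixes a b c :: "'b::euclidean_space"
  shows "fv_process cQ aF (\<lambda>t \<omega>. step a b c t \<omega> \<bullet> i - step a b c 0 \<omega> \<bullet> i)"
  unfolding step_inner by (rule fv_step)

lemma semimartingale_step:
  fixes a b c :: "'b::euclidean_space"
  shows "semimartingale cQ aF (step a b c)"
  unfolding semimartingale_def
proof
  fix i :: 'b
  show "real_semimartingale cQ aF (\<lambda>t \<omega>. step a b c t \<omega> \<bullet> i)"
  proof (rule filt.semimartingale_fv[OF finite_cQ])
    show "adapted aF (\<lambda>t \<omega>. step a b c t \<omega> \<bullet> i)"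
      unfolding step_inner by (rule adapted_step_augment)
    show "cadlag (\<lambda>t. step a b c t \<omega> \<bullet> i)" for \<omega>
      unfolding step_inner by (rule cadlag_left_lim_step(1))
  qed (rule fv_step_inner)
qed

text \<open>Paths of finite variation have no continuous martingale part, whence the second
  characteristic is 0; the drift is left to each application.\<close>

lemma characteristics_step:
  fixes a b c :: "'b::euclidean_space"
  assumes "a \<noteq> b"
    and B: "\<And>i. predictable cQ aF (\<lambda>t \<omega>. B t \<omega> \<bullet> i)" "\<And>i. fv_process cQ aF (\<lambda>t \<omega>. B t \<omega> \<bullet> i)"
      "\<And>i. i \<in> Basis \<Longrightarrow> local_martingale cQ aF
        (\<lambda>t \<omega>. (big_jumps_removed unit_truncation (step a b c) t \<omega> - step a b c 0 \<omega> - B t \<omega>) \<bullet> i)"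
    and K: "\<And>t \<omega>. 0 \<le> t \<Longrightarrow>
      K t \<omega> = scale_measure (ennreal (left_lim (\<lambda>r. step 1 0 0 r \<omega>) t)) (return borel (b - a))"
  shows "characteristics cQ aF unit_truncation (step a b c) B (\<lambda>i j t \<omega>. 0) K"
  unfolding characteristics_def
proof (intro conjI ballI truncation_unit semimartingale_step B)
  have z: "local_martingale cQ aF (\<lambda>_ _. 0)" by (rule filt.local_martingale_zero[OF finite_cQ]) simp
  have "continuous_martingale_part cQ aF (\<lambda>t \<omega>. step a b c t \<omega> \<bullet> i) (\<lambda>_ _. 0)" for i
    by (rule filt.continuous_part_zero[OF finite_cQ fv_step_inner])
  moreover have "predictable_covariation cQ aF (\<lambda>_ _. 0) (\<lambda>_ _. 0) (\<lambda>_ _. 0)"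
    unfolding predictable_covariation_def using z filt.fv_process_zero filt.predictable_const by simp
  ultimately show "\<exists>N. (\<forall>i\<in>Basis. continuous_martingale_part cQ aF (\<lambda>t \<omega>. step a b c t \<omega> \<bullet> i) (N i)) \<and>
      (\<forall>i\<in>Basis. \<forall>j\<in>Basis. predictable_covariation cQ aF (N i) (N j) (\<lambda>t \<omega>. 0))"
    by (intro exI[of _ "\<lambda>_ _ _. 0"]) blast
  show "jump_characteristic cQ aF (step a b c) K"
    by (rule filt.jump_characteristic_cong[OF jump_characteristic_step[OF assms(1)]]) (simp add: K)
qed

lemma left_lim_step_cases: "0 \<le> t \<Longrightarrow> left_lim (\<lambda>r. step (1::real) 0 0 r \<omega>) t \<in> {0, 1}"
  by (simp add: cadlag_left_lim_step(2))

lemma pos_measure_step: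
  assumes "u \<noteq> (0 :: 'b::euclidean_space)" "0 \<le> t"
  shows "pos_measure (\<lambda>A. left_lim (\<lambda>r. step 1 0 0 r \<omega>) t * dirac u A) =
    scale_measure (ennreal (left_lim (\<lambda>r. step 1 0 0 r \<omega>) t)) (return borel u)"
  by (rule pos_measure_dirac[OF assms(1)]) (use left_lim_step_cases[OF assms(2), of \<omega>] in auto)

lemma characteristics_X:
  "characteristics cQ aF unit_truncation (step (1, 0) (0, 1) (0, 0 :: real))
    (\<lambda>t \<omega>. LBINT s:{0..t}. (0 :: real \<times> real)) (\<lambda>i j t \<omega>. LBINT s:{0..t}. 0)
    (\<lambda>t \<omega>. pos_measure (\<lambda>A. fst (left_lim (\<lambda>r. step (1, 0) (0, 1) (0, 0 :: real) r \<omega>) t) * dirac (-1, 1) A))"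
proof -
  have n: "1 < norm ((0, 1) - (1, 0) :: real \<times> real)" by (simp add: norm_Pair)
  have "characteristics cQ aF unit_truncation (step (1 :: real, 0) (0, 1) (0, 0 :: real))
    (\<lambda>t \<omega>. 0) (\<lambda>i j t \<omega>. 0)
    (\<lambda>t \<omega>. pos_measure (\<lambda>A. fst (left_lim (\<lambda>r. step (1 :: real, 0) (0, 1) (0, 0 :: real) r \<omega>) t) * dirac (-1, 1) A))"
  proof (rule characteristics_step)
    fix i :: "real \<times> real"
    show "predictable cQ aF (\<lambda>t \<omega>. (0 :: real \<times> real) \<bullet> i)" "fv_process cQ aF (\<lambda>t \<omega>. (0 :: real \<times> real) \<bullet> i)"
      using filt.fv_process_zero filt.predictable_const by simp_all
    have "big_jumps_removed unit_truncation (step (1, 0) (0, 1) (0, 0)) t \<omega> - step (1, 0) (0, 1) (0, 0) 0 \<omega> -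
        (0 :: real \<times> real) = 0" if "0 \<le> t" for t \<omega>
      using that by (simp add: big_jumps_removed_large[OF n])
    then show "local_martingale cQ aF (\<lambda>t \<omega>. (big_jumps_removed unit_truncation
        (step (1, 0) (0, 1) (0, 0 :: real)) t \<omega> - step (1, 0) (0, 1) (0, 0) 0 \<omega> - 0) \<bullet> i)"
      by (intro filt.local_martingale_zero[OF finite_cQ]) simp
  next
    fix t :: real and \<omega> assume t: "0 \<le> t"
    have "fst (left_lim (\<lambda>r. step (1 :: real, 0 :: real) (0, 1) (0, 0) r \<omega>) t) = left_lim (\<lambda>r. step 1 0 0 r \<omega>) t"
      by (simp add: cadlag_left_lim_step(2)[OF t])
    then show "pos_measure (\<lambda>A. fst (left_lim (\<lambda>r. step (1 :: real, 0) (0, 1) (0, 0 :: real) r \<omega>) t) *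
        dirac (-1, 1) A) =
      scale_measure (ennreal (left_lim (\<lambda>r. step 1 0 0 r \<omega>) t)) (return borel ((0, 1) - (1, 0 :: real) :: real \<times> real))"
      using pos_measure_step[OF _ t, of "(-1, 1) :: real \<times> real" \<omega>] by (simp add: zero_prod_def)
  qed simp
  then show ?thesis by simp
qed

lemma compensator_Y:
  assumes "0 \<le> t"
  shows "(LBINT s:{0..t}. - left_lim (\<lambda>r. step (1 :: real) 0 0 r \<omega>) s) = - min t (max 0 (\<tau> \<omega>))"
proof (cases "0 < \<tau> \<omega>")
  case True
  have "(LBINT s:{0..t}. - left_lim (\<lambda>r. step (1 :: real) 0 0 r \<omega>) s) = (\<integral>s. - indicator {0..min t (\<tau> \<omega>)} s \<partial>lborel)"
    unfolding set_lebesgue_integral_def using True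
    by (intro Bochner_Integration.integral_cong) (auto simp: indicator_def cadlag_left_lim_step(2))
  then show ?thesis using True assms by simp
next
  case False
  have "(LBINT s:{0..t}. - left_lim (\<lambda>r. step (1 :: real) 0 0 r \<omega>) s) = (\<integral>s. 0 \<partial>(lborel :: real measure))"
    unfolding set_lebesgue_integral_def using False
    by (intro Bochner_Integration.integral_cong) (auto simp: indicator_def cadlag_left_lim_step(2))
  then show ?thesis using False assms by simp
qed

text \<open>The truncation keeps the jump -1, so the drift is \<open>-Y\<close>; after its removal
  the martingale \<open>comp\<close> remains.\<close>

lemma characteristics_Y:
  "characteristics cQ aF unit_truncation (step 1 0 0)
    (\<lambda>t \<omega>. LBINT s:{0..t}. - left_lim (\<lambda>r. step (1 :: real) 0 0 r \<omega>) s) (\<lambda>i j t \<omega>. LBINT s:{0..t}. 0)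
    (\<lambda>t \<omega>. pos_measure (\<lambda>A. left_lim (\<lambda>r. step 1 0 0 r \<omega>) t * dirac (-1) A))"
proof -
  define B where "B t \<omega> = (LBINT s:{0..t}. - left_lim (\<lambda>r. step (1 :: real) 0 0 r \<omega>) s)" for t \<omega>
  have B: "B t \<omega> = - min t (max 0 (\<tau> \<omega>))" if "0 \<le> t" for t \<omega>
    unfolding B_def by (rule compensator_Y[OF that])
  \<comment> \<open>An explicit form of the drift at nonnegative times. It is continuous in
    \<open>t\<close>, hence equal to its left limit, and \<open>predictable_left_lim\<close>
    applies.\<close>
  let ?m = "\<lambda>i t \<omega>. - (min t (max 0 (\<tau> \<omega>)) * (i :: real))"
  have m: "continuous_on UNIV (\<lambda>t. ?m i t \<omega>)" for i \<omega> by (intro continuous_intros)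
  have id: "cadlag (\<lambda>t :: real. t)" by (auto simp: cadlag_def)
  have cm: "cadlag (\<lambda>t. ?m i t \<omega>)" for i \<omega> by (rule cadlag_compose[OF id m])
  have lm: "left_lim (\<lambda>t. ?m i t \<omega>) t = ?m i t \<omega>" if "0 \<le> t" for i t \<omega>
  proof -
    have "left_lim (\<lambda>t. t) t = t"
      using that by (cases "t = 0") (auto intro: left_lim_eqI)
    then show ?thesis using left_lim_compose[OF id m that] by simp
  qed
  have "adapted Filt (?m i)" for i
    unfolding adapted_def
  proof (intro allI impI measurable_FiltI)
    show "(\<lambda>\<omega>. ?m i t \<omega>) \<in> borel_measurable M" for t by measurable
    show "?m i t \<omega> = - (t * i)" if "0 \<le> t" "\<omega> \<in> alive t" for t \<omega>
      using that by (auto simp: alive_def min_def)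
  qed
  then have am: "adapted aF (?m i)" for i by (rule adapted_augment)
  have "characteristics cQ aF unit_truncation (step 1 0 0) B (\<lambda>i j t \<omega>. 0)
    (\<lambda>t \<omega>. pos_measure (\<lambda>A. left_lim (\<lambda>r. step 1 0 0 r \<omega>) t * dirac (-1) A))"
  proof (rule characteristics_step)
    fix i :: real
    have "predictable cQ aF (\<lambda>t \<omega>. left_lim (\<lambda>r. ?m i r \<omega>) t)"
      by (rule filt.predictable_left_lim[OF am cm])
    then show "predictable cQ aF (\<lambda>t \<omega>. B t \<omega> \<bullet> i)"
      unfolding predictable_def
      by (subst (asm) measurable_cong[where g = "\<lambda>(t, \<omega>). B t \<omega> \<bullet> i"]) (auto simp: lm B)
    show "fv_process cQ aF (\<lambda>t \<omega>. B t \<omega> \<bullet> i)"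
      unfolding fv_process_def
    proof (intro conjI ballI)
      show "adapted aF (\<lambda>t \<omega>. B t \<omega> \<bullet> i)" using am[of i] by (simp add: adapted_def B)
      show "B 0 \<omega> \<bullet> i = 0" for \<omega> by (simp add: B)
      show "cadlag (\<lambda>t. B t \<omega> \<bullet> i)" for \<omega> by (rule cadlag_cong[OF cm[of \<omega> i]]) (simp add: B)
      show "finite_variation (\<lambda>t. B t \<omega> \<bullet> i)" for \<omega>
      proof (rule finite_variation_mono[of "if 0 \<le> i then -1 else 1"])
        fix s t :: real assume st: "0 \<le> s" "s \<le> t"
        then have "min s (max 0 (\<tau> \<omega>)) \<le> min t (max 0 (\<tau> \<omega>))" by auto
        then show "(if 0 \<le> i then -1 else 1) * (B s \<omega> \<bullet> i) \<le> (if 0 \<le> i then -1 else 1) * (B t \<omega> \<bullet> i)"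
          using st by (auto simp: B mult_right_mono mult_right_mono_neg)
      qed simp
    qed
    have "big_jumps_removed unit_truncation (step 1 0 0) t \<omega> - step 1 0 0 0 \<omega> - B t \<omega> = comp t \<omega>"
      if "0 \<le> t" for t \<omega>
      using that by (subst big_jumps_removed_small) (auto simp: B comp_def step_def)
    moreover assume "i \<in> Basis"
    ultimately show "local_martingale cQ aF
        (\<lambda>t \<omega>. (big_jumps_removed unit_truncation (step 1 0 0) t \<omega> - step 1 0 0 0 \<omega> - B t \<omega>) \<bullet> i)"
      by (intro local_martingale_comp) simp
  next
    fix t :: real and \<omega> assume "0 \<le> t"
    then show "pos_measure (\<lambda>A. left_lim (\<lambda>r. step 1 0 0 r \<omega>) t * dirac (- 1) A) =
      scale_measure (ennreal (left_lim (\<lambda>r. step 1 0 0 r \<omega>) t)) (return borel (0 - 1 :: real))"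
      by (simp add: pos_measure_step)
  qed simp
  then show ?thesis unfolding B_def[abs_def] by simp
qed

lemma jump_characteristic_Z:
  "jump_characteristic cQ aF (step 0 1 0)
    (\<lambda>t \<omega>. pos_measure (\<lambda>A. left_lim (\<lambda>r. step 1 0 0 r \<omega>) t * dirac (1 :: real) A))"
  by (rule filt.jump_characteristic_cong[OF jump_characteristic_step]) (simp_all add: pos_measure_step)

text \<open>State 1 survives a time \<open>t\<close> with probability \<open>exp (-t)\<close>; every
  other argument is treated as the absorbing state 0.\<close>

definition trans :: "real \<Rightarrow> real \<Rightarrow> real measure" where
  "trans t y = distr (measure_pmf (bernoulli_pmf (if y = 1 then exp (-t) else 0)))
    (restrict_space borel {0, 1}) (\<lambda>b. if b then 1 else 0)"

lemma measure_trans: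
  assumes "0 \<le> t" "A \<in> sets (restrict_space borel {0, 1 :: real})"
  shows "measure (trans t y) A = indicator A 0 + (indicator A 1 - indicator A 0) * (if y = 1 then exp (-t) else 0)"
proof -
  define q where "q = (if y = 1 then exp (-t) else 0)"
  have q: "0 \<le> q" "q \<le> 1" using assms(1) by (auto simp: q_def)
  have "measure (trans t y) A = measure (measure_pmf (bernoulli_pmf q)) ((\<lambda>b. if b then 1 else 0) -` A)"
    unfolding trans_def q_def[symmetric]
    by (subst measure_distr) (use assms(2) in \<open>auto simp: measurable_restrict_space2_iff\<close>)
  also have "\<dots> = measure_pmf.expectation (bernoulli_pmf q) (indicator ((\<lambda>b. if b then 1 else 0) -` A))"
    by simp
  also have "\<dots> = indicator A 0 + (indicator A 1 - indicator A 0) * q"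
    using q by (subst integral_bernoulli_pmf) (auto simp: indicator_def algebra_simps)
  finally show ?thesis unfolding q_def .
qed

lemma integrable_step: "integrable Q (\<lambda>\<omega>. step (1 :: real) 0 0 t \<omega>)"
proof (rule integrable_const_bound[where B = 1])
  show "(\<lambda>\<omega>. step (1 :: real) 0 0 t \<omega>) \<in> borel_measurable Q"
    using step_measurable_M by (simp add: measurable_cong_sets[OF sets_Q refl])
qed (auto simp: step_def)

text \<open>On the values 0 and 1 an indicator is affine in the value, so only a conditional mean is
  needed. A set of the past contains or misses \<open>alive s\<close>: the first case is
  \<open>memoryless\<close>, in the second both integrals vanish.\<close>

lemma markov_step:
  assumes st: "0 \<le> s" "0 \<le> t" and A: "A \<in> sets (restrict_space borel {0, 1 :: real})"
  shows "AE \<omega> in Q. real_cond_exp Q (Filt s) (\<lambda>\<omega>. indicator A (step 1 0 0 (s + t) \<omega>)) \<omega> =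
    measure (trans t (step 1 0 0 s \<omega>)) A"
proof -
  interpret S: finite_measure_subalgebra Q "Filt s"
    by (intro finite_measure_subalgebra.intro finite_measure_subalgebra_axioms.intro finite_measure_axioms subalgebra_Q)
  let ?d = "indicator A 1 - indicator A 0 :: real"
  let ?Y = "\<lambda>t \<omega>. step (1 :: real) 0 0 t \<omega>"
  have f: "(\<lambda>\<omega>. indicator A (?Y (s + t) \<omega>)) = (\<lambda>\<omega>. indicator A 0 + ?d * ?Y (s + t) \<omega>)"
    by (auto simp: step_def fun_eq_iff)
  have g: "(\<lambda>\<omega>. measure (trans t (?Y s \<omega>)) A) = (\<lambda>\<omega>. indicator A 0 + ?d * (exp (-t) * ?Y s \<omega>))"
    by (auto simp: fun_eq_iff measure_trans[OF st(2) A] step_def)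
  have "AE \<omega> in Q. real_cond_exp Q (Filt s) (\<lambda>\<omega>. indicator A 0 + ?d * ?Y (s + t) \<omega>) \<omega> =
      (\<lambda>\<omega>. indicator A 0 + ?d * (exp (-t) * ?Y s \<omega>)) \<omega>"
  proof (rule S.real_cond_exp_charact)
    show i: "integrable Q (\<lambda>\<omega>. indicator A 0 + ?d * ?Y (s + t) \<omega>)"
      "integrable Q (\<lambda>\<omega>. indicator A 0 + ?d * (exp (-t) * ?Y s \<omega>))"
      by (intro Bochner_Integration.integrable_add integrable_const integrable_mult_right integrable_step)+
    have "?Y s \<in> borel_measurable (Filt s)" using adapted_step st(1) by (auto simp: adapted_def)
    then show "(\<lambda>\<omega>. indicator A 0 + ?d * (exp (-t) * ?Y s \<omega>)) \<in> borel_measurable (Filt s)" by simp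
    fix B assume B: "B \<in> sets (Filt s)"
    then have BQ: "B \<in> sets Q" and dich: "alive s \<subseteq> B \<or> alive s \<inter> B = {}"
      by (auto simp: sets_Filt sets_Q)
    have iB: "integrable Q (\<lambda>\<omega>. indicator B \<omega> * ?Y r \<omega>)" for r
      using integrable_mult_indicator[OF BQ integrable_step[of r]] by simp
    have iI: "integrable Q (indicator B :: 'w \<Rightarrow> real)"
      using BQ by (intro integrable_real_indicator) (auto simp: emeasure_eq_measure)
    have ev: "{\<omega> \<in> space Q. r < \<tau> \<omega>} \<in> sets Q" for r by measurable
    have Y: "(\<integral>\<omega>. indicator B \<omega> * ?Y (s + t) \<omega> \<partial>Q) = exp (-t) * (\<integral>\<omega>. indicator B \<omega> * ?Y s \<omega> \<partial>Q)"
      using dich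
    proof
      assume sub: "alive s \<subseteq> B"
      have "(\<integral>\<omega>. indicator B \<omega> * ?Y r \<omega> \<partial>Q) = measure Q {\<omega> \<in> space Q. r < \<tau> \<omega>}" if "s \<le> r" for r
      proof -
        have "(\<integral>\<omega>. indicator B \<omega> * ?Y r \<omega> \<partial>Q) = (\<integral>\<omega>. indicator {\<omega> \<in> space Q. r < \<tau> \<omega>} \<omega> \<partial>Q)"
          using sub st(1) that
          by (intro Bochner_Integration.integral_cong) (auto simp: indicator_def step_def alive_def space_Q)
        then show ?thesis using ev by simp
      qed
      then show ?thesis using memoryless[OF st] st by simp
    next
      assume dis: "alive s \<inter> B = {}"
      have "(\<integral>\<omega>. indicator B \<omega> * ?Y r \<omega> \<partial>Q) = (\<integral>\<omega>. 0 \<partial>Q)" if "s \<le> r" for r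
        using dis st(1) that
        by (intro Bochner_Integration.integral_cong) (auto simp: indicator_def step_def alive_def space_Q)
      then show ?thesis using st by simp
    qed
    have "(\<integral>\<omega>. indicator B \<omega> * (indicator A 0 + ?d * (e * ?Y r \<omega>)) \<partial>Q) =
        (\<integral>\<omega>. indicator B \<omega> * indicator A 0 \<partial>Q) + ?d * (e * (\<integral>\<omega>. indicator B \<omega> * ?Y r \<omega> \<partial>Q))" for e r
    proof -
      have "(\<integral>\<omega>. indicator B \<omega> * (indicator A 0 + ?d * (e * ?Y r \<omega>)) \<partial>Q) =
        (\<integral>\<omega>. indicator B \<omega> * indicator A 0 + (?d * e) * (indicator B \<omega> * ?Y r \<omega>) \<partial>Q)"
        by (intro Bochner_Integration.integral_cong) (auto simp: algebra_simps)
      also have "\<dots> = (\<integral>\<omega>. indicator B \<omega> * indicator A 0 \<partial>Q) + (\<integral>\<omega>. (?d * e) * (indicator B \<omega> * ?Y r \<omega>) \<partial>Q)"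
        by (intro Bochner_Integration.integral_add integrable_mult_right integrable_mult_left iI iB)
      finally show ?thesis by simp
    qed
    from this[of 1 "s + t"] this[of "exp (-t)" s]
    show "(\<integral>\<omega>\<in>B. indicator A 0 + ?d * ?Y (s + t) \<omega> \<partial>Q) =
        (\<integral>\<omega>\<in>B. indicator A 0 + ?d * (exp (-t) * ?Y s \<omega>) \<partial>Q)"
      unfolding set_lebesgue_integral_def by (simp add: Y)
  qed
  then show ?thesis unfolding f g[symmetric] by (simp add: fun_cong[OF g])
qed

end

section \<open>A discontinuous example for \<open>\<beta> = 0\<close>\<close>

text \<open>\<open>g\<close> is a right inverse of \<open>\<tau>\<close>, so \<open>\<tau>\<close>
  has law \<open>\<mu>\<close> under the image measure, and the requirements become conditions on a
  law on the line.\<close>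

lemma single_jump_law_distr:
  fixes M :: "'w measure" and \<mu> :: "real measure"
  assumes M: "single_jump M \<tau>" and g: "g \<in> measurable borel M" "\<And>r. \<tau> (g r) = r"
    and \<mu>: "prob_space \<mu>" "sets \<mu> = sets borel"
    and int: "\<And>w :: real \<Rightarrow> ennreal. w \<in> borel_measurable borel \<Longrightarrow>
      (\<integral>\<^sup>+r. w r * indicator {0<..} r \<partial>\<mu>) = (\<integral>\<^sup>+r. (\<integral>\<^sup>+s. w s * indicator {0<..r} s \<partial>lborel) \<partial>\<mu>)"
    and mem: "\<And>s t. 0 \<le> s \<Longrightarrow> 0 \<le> t \<Longrightarrow> measure \<mu> {s + t<..} = exp (-t) * measure \<mu> {s<..}"
  shows "single_jump_law M \<tau> (distr \<mu> M g)"
proof -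
  interpret single_jump M \<tau> by (rule M)
  have g\<mu>[measurable]: "g \<in> measurable \<mu> M" using g(1) by (simp add: measurable_cong_sets[OF \<mu>(2) refl])
  show ?thesis
  proof (intro single_jump_law.intro single_jump_law_axioms.intro M prob_space.prob_space_distr[OF \<mu>(1) g\<mu>])
    show "sets (distr \<mu> M g) = sets M" by simp
    fix w :: "real \<Rightarrow> ennreal" assume w[measurable]: "w \<in> borel_measurable borel"
    have "(\<lambda>r. \<integral>\<^sup>+s. w s * indicator {0<..r} s \<partial>lborel) \<in> borel_measurable (borel :: real measure)"
    proof -
      have "Measurable.pred (borel \<Otimes>\<^sub>M borel) (\<lambda>x :: real \<times> real. 0 < snd x \<and> snd x \<le> fst x)" by measurable
      then have "(\<lambda>x :: real \<times> real. w (snd x) * (if 0 < snd x \<and> snd x \<le> fst x then 1 else 0)) \<in>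
          borel_measurable (borel \<Otimes>\<^sub>M lborel)"
        by measurable
      also have "(\<lambda>x :: real \<times> real. w (snd x) * (if 0 < snd x \<and> snd x \<le> fst x then 1 else 0)) =
          (\<lambda>(r, s). w s * indicator {0<..r} s)"
        by (auto simp: indicator_def fun_eq_iff)
      finally show ?thesis by (rule lborel.borel_measurable_nn_integral)
    qed
    from measurable_compose[OF \<tau> this] have
      "(\<lambda>\<omega>. \<integral>\<^sup>+s. w s * indicator {0<..\<tau> \<omega>} s \<partial>lborel) \<in> borel_measurable M" .
    then show "(\<integral>\<^sup>+\<omega>. w (\<tau> \<omega>) * indicator {0<..} (\<tau> \<omega>) \<partial>distr \<mu> M g) =
        (\<integral>\<^sup>+\<omega>. (\<integral>\<^sup>+s. w s * indicator {0<..\<tau> \<omega>} s \<partial>lborel) \<partial>distr \<mu> M g)"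
      by (simp add: nn_integral_distr g(2) int)
  next
    fix s t :: real assume st: "0 \<le> s" "0 \<le> t"
    have "measure (distr \<mu> M g) {\<omega> \<in> space (distr \<mu> M g). r < \<tau> \<omega>} = measure \<mu> {r<..}" for r
    proof -
      have "{\<omega> \<in> space M. r < \<tau> \<omega>} \<in> sets M" by measurable
      then have "measure (distr \<mu> M g) {\<omega> \<in> space M. r < \<tau> \<omega>} = measure \<mu> (g -` {\<omega> \<in> space M. r < \<tau> \<omega>} \<inter> space \<mu>)"
        by (intro measure_distr) auto
      also have "g -` {\<omega> \<in> space M. r < \<tau> \<omega>} \<inter> space \<mu> = {r<..}"
        using measurable_space[OF g(1)] sets_eq_imp_space_eq[OF \<mu>(2)] by (auto simp: g(2))
      finally show ?thesis by simp
    qed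
    then show "measure (distr \<mu> M g) {\<omega> \<in> space (distr \<mu> M g). s + t < \<tau> \<omega>} =
        exp (-t) * measure (distr \<mu> M g) {\<omega> \<in> space (distr \<mu> M g). s < \<tau> \<omega>}"
      using mem[OF st] by simp
  qed
qed

lemma emeasure_exponential_Ici:
  assumes "0 \<le> s"
  shows "(\<integral>\<^sup>+r. ennreal (exponential_density 1 r) * indicator {s..} r \<partial>lborel) = ennreal (exp (- s))"
proof -
  have "(\<integral>\<^sup>+r. ennreal (exponential_density 1 r) * indicator {s..} r \<partial>lborel) =
      (\<integral>\<^sup>+r. ennreal (exp (- r)) * indicator {s..} r \<partial>lborel)"
    using assms by (intro nn_integral_cong) (auto simp: exponential_density_def indicator_def)
  also have "\<dots> = ennreal (0 - (- exp (- s)))"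
  proof (rule nn_integral_FTC_atLeast)
    show "DERIV (\<lambda>r. - exp (- r)) r :> exp (- r)" for r :: real
      by (auto intro!: derivative_eq_intros)
    show "((\<lambda>r :: real. - exp (- r)) \<longlongrightarrow> 0) at_top"
      using tendsto_minus[OF filterlim_compose[OF exp_at_bot filterlim_uminus_at_bot_at_top]] by simp
  qed auto
  finally show ?thesis by simp
qed

text \<open>By Fubini the right side integrates \<open>w s\<close> against the tail beyond
  \<open>s\<close>, and for the exponential law of rate 1 the tail \<open>exp (-s)\<close> is also
  the density.\<close>

lemma exponential_intensity:
  fixes w :: "real \<Rightarrow> ennreal"
  assumes [measurable]: "w \<in> borel_measurable borel"
  shows "(\<integral>\<^sup>+r. w r * indicator {0<..} r \<partial>density lborel (exponential_density 1)) =
    (\<integral>\<^sup>+r. (\<integral>\<^sup>+s. w s * indicator {0<..r} s \<partial>lborel) \<partial>density lborel (exponential_density 1))"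
proof -
  let ?d = "\<lambda>r. ennreal (exponential_density 1 r)"
  define h :: "real \<Rightarrow> real \<Rightarrow> ennreal" where
    "h r s = ?d r * w s * (if 0 < s \<and> s \<le> r then 1 else 0)" for r s
  have h: "h r s = ?d r * (w s * indicator {0<..r} s)" for r s
    by (auto simp: h_def indicator_def mult.assoc)
  have hm[measurable]: "(\<lambda>(r, s). h r s) \<in> borel_measurable (lborel \<Otimes>\<^sub>M lborel)"
    unfolding h_def case_prod_unfold by measurable
  have m: "(\<lambda>r. \<integral>\<^sup>+s. w s * indicator {0<..r} s \<partial>lborel) \<in> borel_measurable lborel"
  proof -
    have "(\<lambda>(r, s :: real). w s * (if 0 < s \<and> s \<le> r then 1 else 0)) \<in> borel_measurable (lborel \<Otimes>\<^sub>M lborel)"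
      unfolding case_prod_unfold by measurable
    also have "(\<lambda>(r, s :: real). w s * (if 0 < s \<and> s \<le> r then 1 else 0)) = (\<lambda>(r, s). w s * indicator {0<..r} s)"
      by (auto simp: indicator_def fun_eq_iff)
    finally show ?thesis by (rule lborel.borel_measurable_nn_integral)
  qed
  have "(\<integral>\<^sup>+r. (\<integral>\<^sup>+s. w s * indicator {0<..r} s \<partial>lborel) \<partial>density lborel ?d) =
      (\<integral>\<^sup>+r. ?d r * (\<integral>\<^sup>+s. w s * indicator {0<..r} s \<partial>lborel) \<partial>lborel)"
    using m by (intro nn_integral_density) auto
  also have "\<dots> = (\<integral>\<^sup>+r. (\<integral>\<^sup>+s. h r s \<partial>lborel) \<partial>lborel)"
    unfolding h by (intro nn_integral_cong nn_integral_cmult[symmetric]) measurable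
  also have "\<dots> = (\<integral>\<^sup>+s. (\<integral>\<^sup>+r. h r s \<partial>lborel) \<partial>lborel)"
    by (rule lborel_pair.Fubini'[OF hm, symmetric])
  also have "\<dots> = (\<integral>\<^sup>+s. ?d s * (w s * indicator {0<..} s) \<partial>lborel)"
  proof (intro nn_integral_cong)
    fix s :: real
    have "(\<integral>\<^sup>+r. h r s \<partial>lborel) = (\<integral>\<^sup>+r. (w s * indicator {0<..} s) * (?d r * indicator {s..} r) \<partial>lborel)"
      by (intro nn_integral_cong) (auto simp: h_def indicator_def mult.commute)
    also have "\<dots> = (w s * indicator {0<..} s) * (\<integral>\<^sup>+r. ?d r * indicator {s..} r \<partial>lborel)"
      by (rule nn_integral_cmult) measurable
    also have "\<dots> = ?d s * (w s * indicator {0<..} s)"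
      using emeasure_exponential_Ici[of s]
      by (cases "0 < s") (auto simp: exponential_density_def mult.commute)
    finally show "(\<integral>\<^sup>+r. h r s \<partial>lborel) = ?d s * (w s * indicator {0<..} s)" .
  qed
  also have "\<dots> = (\<integral>\<^sup>+r. w r * indicator {0<..} r \<partial>density lborel ?d)"
    by (rule nn_integral_density[symmetric]) auto
  finally show ?thesis by simp
qed

lemma exponential_memoryless:
  assumes "0 \<le> s" "0 \<le> t"
  shows "measure (density lborel (exponential_density 1)) {s + t<..} =
    exp (-t) * measure (density lborel (exponential_density 1)) {s<..}"
proof -
  have "measure (density lborel (exponential_density 1)) {r<..} = exp (- r)" if "0 \<le> r" for r
  proof -
    have "emeasure (density lborel (exponential_density 1)) {r<..} =
        (\<integral>\<^sup>+x. ennreal (exponential_density 1 x) * indicator {r<..} x \<partial>lborel)"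
      by (rule emeasure_density) auto
    also have "\<dots> = (\<integral>\<^sup>+x. ennreal (exponential_density 1 x) * indicator {r..} x \<partial>lborel)"
    proof (rule nn_integral_cong_AE)
      show "AE x in lborel. ennreal (exponential_density 1 x) * indicator {r<..} x =
          ennreal (exponential_density 1 x) * indicator {r..} x"
        using AE_lborel_singleton[of r] by eventually_elim (simp add: indicator_def)
    qed
    finally show ?thesis using emeasure_exponential_Ici[OF that] by (simp add: measure_def)
  qed
  then show ?thesis using assms by (simp add: mult_exp_exp)
qed

lemma degenerate_intensity:
  fixes c :: real and w :: "real \<Rightarrow> ennreal"
  assumes "c \<le> 0" and [measurable]: "w \<in> borel_measurable borel"
  shows "(\<integral>\<^sup>+r. w r * indicator {0<..} r \<partial>return borel c) =
    (\<integral>\<^sup>+r. (\<integral>\<^sup>+s. w s * indicator {0<..r} s \<partial>lborel) \<partial>return borel c)"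
proof -
  have "AE r in return borel c. r \<le> 0" using assms(1) by (subst AE_return) auto
  then have "AE r in return borel c. (\<integral>\<^sup>+s. w s * indicator {0<..r} s \<partial>lborel) = 0"
    by eventually_elim simp
  then have "(\<integral>\<^sup>+r. (\<integral>\<^sup>+s. w s * indicator {0<..r} s \<partial>lborel) \<partial>return borel c) = (\<integral>\<^sup>+r. 0 \<partial>return borel c)"
    by (rule nn_integral_cong_AE)
  then show ?thesis using assms(1) by (simp add: nn_integral_return)
qed

text \<open>The first state jumps to the second; the third is absorbing and makes the affine hull
  the whole plane.\<close>

definition E_ex :: "(real \<times> real) set" where "E_ex = {(1, 0), (0, 1), (0, 0)}"

text \<open>Laws of \<open>\<tau>\<close>: the values 0 and -1 select the constant paths of
  \<open>step\<close> at \<open>(0, 1)\<close> and \<open>(0, 0)\<close>.\<close>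

definition \<mu>_ex :: "real \<times> real \<Rightarrow> real measure" where
  "\<mu>_ex x = (if x = (1, 0) then density lborel (exponential_density 1)
    else if x = (0, 1) then return borel 0 else return borel (-1))"

lemma \<mu>_ex:
  shows "prob_space (\<mu>_ex x)" "sets (\<mu>_ex x) = sets borel"
    and "w \<in> borel_measurable borel \<Longrightarrow>
      (\<integral>\<^sup>+r. w r * indicator {0<..} r \<partial>\<mu>_ex x) = (\<integral>\<^sup>+r. (\<integral>\<^sup>+s. w s * indicator {0<..r} s \<partial>lborel) \<partial>\<mu>_ex x)"
    and "0 \<le> s \<Longrightarrow> 0 \<le> t \<Longrightarrow> measure (\<mu>_ex x) {s + t<..} = exp (-t) * measure (\<mu>_ex x) {s<..}"
    and "x = (1, 0) \<Longrightarrow> AE r in \<mu>_ex x. 0 < r" "x = (0, 1) \<Longrightarrow> AE r in \<mu>_ex x. r = 0"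
      "x = (0, 0) \<Longrightarrow> AE r in \<mu>_ex x. r = -1"
proof -
  show "prob_space (\<mu>_ex x)" "sets (\<mu>_ex x) = sets borel"
    using prob_space_exponential_density[of 1] by (auto simp: \<mu>_ex_def prob_space_return)
  show "w \<in> borel_measurable borel \<Longrightarrow>
      (\<integral>\<^sup>+r. w r * indicator {0<..} r \<partial>\<mu>_ex x) = (\<integral>\<^sup>+r. (\<integral>\<^sup>+s. w s * indicator {0<..r} s \<partial>lborel) \<partial>\<mu>_ex x)"
    unfolding \<mu>_ex_def using exponential_intensity degenerate_intensity[of 0] degenerate_intensity[of "-1"] by simp
  show "0 \<le> s \<Longrightarrow> 0 \<le> t \<Longrightarrow> measure (\<mu>_ex x) {s + t<..} = exp (-t) * measure (\<mu>_ex x) {s<..}"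
    unfolding \<mu>_ex_def using exponential_memoryless by (auto simp: measure_return indicator_def)
  show "AE r in \<mu>_ex x. 0 < r" if "x = (1, 0)"
  proof -
    have "AE r in lborel. 0 < ennreal (exponential_density 1 r) \<longrightarrow> 0 < r"
      using AE_lborel_singleton[of 0] by eventually_elim (auto simp: exponential_density_def)
    then have "AE r in density lborel (exponential_density 1). 0 < r" by (subst AE_density) auto
    then show ?thesis unfolding that \<mu>_ex_def by simp
  qed
  show "AE r in \<mu>_ex x. r = 0" if "x = (0, 1)"
  proof -
    have "AE r in return borel 0. r = (0 :: real)" by (subst AE_return) auto
    then show ?thesis unfolding that \<mu>_ex_def by simp
  qed
  show "AE r in \<mu>_ex x. r = -1" if "x = (0, 0)"
  proof -
    have "AE r in return borel (-1). r = (-1 :: real)" by (subst AE_return) auto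
    then show ?thesis unfolding that \<mu>_ex_def by simp
  qed
qed

lemma affine_hull_E_ex: "affine hull E_ex = UNIV"
proof -
  have "x \<in> affine hull E_ex" for x :: "real \<times> real"
  proof -
    have "x = fst x *\<^sub>R (1, 0) + snd x *\<^sub>R (0, 1) + (1 - fst x - snd x) *\<^sub>R (0, 0)" by (simp add: prod_eq_iff)
    then show ?thesis unfolding E_ex_def affine_hull_3
      by (intro CollectI exI[of _ "fst x"] exI[of _ "snd x"] exI[of _ "1 - fst x - snd x"]) auto
  qed
  then show ?thesis by blast
qed

context single_jump
begin

lemma setting_example:
  fixes g :: "real \<Rightarrow> 'w"
  assumes g: "g \<in> measurable borel M" "\<And>r. \<tau> (g r) = r"
  defines "P \<equiv> \<lambda>x. distr (\<mu>_ex x) M g"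
  shows "jump_counter_setting M Filt E_ex P (step (1, 0) (0, 1) (0, 0)) 1 1 0"
    and "\<not> continuous_process E_ex P (\<lambda>t \<omega>. snd (step (1 :: real, 0 :: real) (0, 1) (0, 0) t \<omega>))"
proof -
  let ?X = "step (1 :: real, 0 :: real) (0, 1) (0, 0)"
  have law: "single_jump_law M \<tau> (P x)" for x
    unfolding P_def by (intro single_jump_law_distr single_jump_axioms g \<mu>_ex)
  have sP: "sets (P x) = sets M" for x by (simp add: P_def)
  have gm: "g \<in> measurable (\<mu>_ex x) M" for x using g(1) by (simp add: measurable_cong_sets[OF \<mu>_ex(2) refl])
  have ae: "AE \<omega> in P x. R (\<tau> \<omega>)" if "AE r in \<mu>_ex x. R r" "Measurable.pred borel R" for x R
    unfolding P_def using that measurable_compose[OF \<tau> that(2)]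
    by (subst AE_distr_iff[OF gm]) (auto simp: g(2) pred_def)
  have start: "AE \<omega> in P x. ?X 0 \<omega> = x" if "x \<in> E_ex" for x
  proof -
    consider "x = (1, 0)" | "x = (0, 1)" | "x = (0, 0)" using \<open>x \<in> E_ex\<close> by (auto simp: E_ex_def)
    then show ?thesis
    proof cases
      case 1
      have "AE \<omega> in P x. 0 < \<tau> \<omega>" by (rule ae[OF \<mu>_ex(5)[OF 1]]) measurable
      then show ?thesis by eventually_elim (simp add: step_def 1)
    next
      case 2
      have "AE \<omega> in P x. \<tau> \<omega> = 0" by (rule ae[OF \<mu>_ex(6)[OF 2]]) measurable
      then show ?thesis by eventually_elim (simp add: step_def 2)
    next
      case 3
      have "AE \<omega> in P x. \<tau> \<omega> = -1" by (rule ae[OF \<mu>_ex(7)[OF 3]]) measurable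
      then show ?thesis by eventually_elim (simp add: step_def 3)
    qed
  qed
  have Y: "(\<lambda>t \<omega>. fst (?X t \<omega>)) = step 1 0 0" and Z: "(\<lambda>t \<omega>. snd (?X t \<omega>)) = step 0 1 0"
    by (auto simp: step_def fun_eq_iff)
  have u: "(-1, 1) \<noteq> (0 :: real \<times> real)" by (simp add: zero_prod_def)
  have family: "semimartingale_family M Filt E_ex P ?X"
    unfolding semimartingale_family_def
  proof (intro conjI ballI allI impI)
    show "E_ex \<noteq> {}" "E_ex \<in> sets borel" by (auto simp: E_ex_def)
    show "?X t \<omega> \<in> E_ex" for t \<omega> by (simp add: step_def E_ex_def)
    show "prob_space (P x)" for x by (rule single_jump_law.axioms(2)[OF law])
    show "semimartingale (completion (P x)) (augment (P x) Filt) ?X" for x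
      by (rule single_jump_law.semimartingale_step[OF law])
    show "filtration (space M) Filt" by (rule filtration_Filt)
    show "subalgebra M (Filt t)" for t by (rule subalgebra_Filt)
    show "sets (Filt t) = (\<Inter>s\<in>{t<..}. sets (Filt s))" if "0 \<le> t" for t by (rule right_continuous_Filt[OF that])
    show "adapted Filt ?X" by (rule adapted_step)
    show "cadlag (\<lambda>t. ?X t \<omega>)" for \<omega> by (rule cadlag_left_lim_step(1))
    show "sets (P x) = sets M" for x by (rule sP)
    show "AE \<omega> in P x. ?X 0 \<omega> = x" if "x \<in> E_ex" for x by (rule start[OF that])
  qed
  have kernel: "jump_kernel_measure (\<lambda>A. fst x * dirac (-1 :: real, 1 :: real) A)" if "x \<in> E_ex" for x
    using that by (intro jump_kernel_dirac u) (auto simp: E_ex_def)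
  have fstE: "fst ` E_ex = {0, 1}" by (auto simp: E_ex_def)
  have triplet_X: "affine_triplet Filt (P ` E_ex) E_ex ?X (\<lambda>_. 0) (\<lambda>_ _ _. 0) (\<lambda>x A. fst x * dirac (-1, 1) A)"
    unfolding affine_triplet_def
  proof (intro conjI ballI allI)
    show "affine_map (\<lambda>x :: real \<times> real. 0 :: real \<times> real)" "affine_map (\<lambda>x :: real \<times> real. 0 :: real)"
      unfolding affine_map_def by (intro exI[of _ "\<lambda>_. 0"] exI[of _ 0], simp add: linear_zero)+
    show "affine_kernel (\<lambda>(x :: real \<times> real) A. fst x * dirac (-1 :: real, 1 :: real) A)"
      by (intro affine_kernel_dirac u) (rule bounded_linear.linear[OF bounded_linear_fst])
    show "pos_semidef (\<lambda>_ _. 0 :: real)" for x :: "real \<times> real" by (simp add: pos_semidef_def)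
    fix Q assume "Q \<in> P ` E_ex"
    then obtain x where "Q = P x" by auto
    then show "characteristics (completion Q) (augment Q Filt) unit_truncation ?X (\<lambda>t \<omega>. LBINT s:{0..t}. 0)
      (\<lambda>i j t \<omega>. LBINT s:{0..t}. 0) (\<lambda>t \<omega>. pos_measure (\<lambda>A. fst (left_lim (\<lambda>r. ?X r \<omega>) t) * dirac (-1, 1) A))"
      using single_jump_law.characteristics_X[OF law] by simp
  qed (use kernel in simp_all)
  have counter: "normalized_jump_counter E_ex (\<lambda>x A. fst x * dirac (-1, 1) A) fst"
    unfolding normalized_jump_counter_def
  proof (intro bexI conjI)
    \<comment> \<open>Within \<open>E_ex\<close> the function \<open>fst\<close> is positive only at
      \<open>(1, 0)\<close>, from where \<open>(-1, 1)\<close> leads to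
      \<open>(0, 1)\<close>.\<close>
    show "jump_counter E_ex (-1, 1) fst"
      unfolding jump_counter_def
    proof (intro conjI ballI impI)
      show "affine_map (fst :: real \<times> real \<Rightarrow> real)"
        unfolding affine_map_def
        by (intro exI[of _ fst] exI[of _ 0]) (simp add: bounded_linear.linear[OF bounded_linear_fst])
      have "fst (1 :: real, 0 :: real) \<noteq> 0" by simp
      then show "fst \<noteq> (\<lambda>x :: real \<times> real. 0 :: real)" by metis
    qed (auto simp: E_ex_def)
    show "(-1, 1) \<in> jump_sizes E_ex (\<lambda>x A. fst x * dirac (-1, 1 :: real) A)"
      unfolding jump_sizes_def
    proof (intro DiffI UN_I)
      show "(1, 0) \<in> E_ex" by (simp add: E_ex_def)
      have "pos_measure (\<lambda>A. 1 * dirac (-1 :: real, 1 :: real) A) =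
          scale_measure (ennreal 1) (return borel (-1 :: real, 1 :: real))"
        by (rule pos_measure_dirac[OF u]) simp
      then show "(-1, 1) \<in> measure_support (pos_measure (\<lambda>A. fst (1 :: real, 0 :: real) * dirac (-1 :: real, 1 :: real) A))"
        by (simp add: measure_support_def emeasure_return)
    qed (use u in simp)
  qed simp
  have triplet_Y: "affine_triplet Filt (P ` E_ex) (fst ` E_ex) (step 1 0 0) (\<lambda>y. - y) (\<lambda>_ _ _. 0)
      (\<lambda>y A. y * dirac (-1) A)"
    unfolding affine_triplet_def
  proof (intro conjI ballI allI)
    show "affine_map (\<lambda>x :: real. 0 :: real)"
      unfolding affine_map_def by (intro exI[of _ "\<lambda>_. 0"] exI[of _ 0]) (simp add: linear_zero)
    have "linear (\<lambda>y :: real. - y)" by (simp add: linear_iff)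
    then show "affine_map (\<lambda>y :: real. - y)"
      unfolding affine_map_def by (intro exI[of _ "\<lambda>y. - y"] exI[of _ 0]) simp
    show "affine_kernel (\<lambda>y A. y * dirac (-1 :: real) A :: real)"
      by (intro affine_kernel_dirac) (auto simp: linear_iff)
    show "pos_semidef (\<lambda>_ _. 0 :: real)" for x :: real by (simp add: pos_semidef_def)
    show "jump_kernel_measure (\<lambda>A. y * dirac (-1 :: real) A)" if "y \<in> fst ` E_ex" for y
      using that by (intro jump_kernel_dirac) (auto simp: fstE)
    fix Q assume "Q \<in> P ` E_ex"
    then obtain x where "Q = P x" by auto
    then show "characteristics (completion Q) (augment Q Filt) unit_truncation (step 1 0 0)
      (\<lambda>t \<omega>. LBINT s:{0..t}. - left_lim (\<lambda>r. step (1 :: real) 0 0 r \<omega>) s)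
      (\<lambda>i j t \<omega>. LBINT s:{0..t}. 0) (\<lambda>t \<omega>. pos_measure (\<lambda>A. left_lim (\<lambda>r. step 1 0 0 r \<omega>) t * dirac (-1) A))"
      using single_jump_law.characteristics_Y[OF law] by simp
  qed simp
  have markov: "markov_process Filt (P ` E_ex) (fst ` E_ex) (step 1 0 0)"
    unfolding markov_process_def fstE
  proof (intro exI[of _ "single_jump_law.trans"] conjI allI impI ballI)
    \<comment> \<open>On a two-point space every set is measurable, so measurability of the
      transition function is automatic.\<close>
    have fin: "sets (restrict_space borel {0, 1 :: real}) = Pow {0, 1}"
    proof
      show "sets (restrict_space borel {0, 1 :: real}) \<subseteq> Pow {0, 1}"
        using sets.space_closed[of "restrict_space borel {0, 1 :: real}"] by (simp add: space_restrict_space)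
      show "Pow {0, 1} \<subseteq> sets (restrict_space borel {0, 1 :: real})"
      proof
        fix A :: "real set" assume A: "A \<in> Pow {0, 1}"
        then have "finite A" by (auto intro: finite_subset)
        then have "A \<in> sets borel" by (intro borel_closed finite_imp_closed)
        then show "A \<in> sets (restrict_space borel {0, 1})" using A by (simp add: sets_restrict_space_iff)
      qed
    qed
    fix t :: real assume "0 \<le> t"
    show "single_jump_law.trans t \<in> measurable (restrict_space borel {0, 1}) (prob_algebra (restrict_space borel {0, 1}))"
    proof (rule measurableI)
      fix y :: real
      show "single_jump_law.trans t y \<in> space (prob_algebra (restrict_space borel {0, 1}))"
        unfolding single_jump_law.trans_def[OF law] space_prob_algebra
        by (auto intro!: prob_space.prob_space_distr measure_pmf.prob_space_axioms simp: measurable_restrict_space2_iff)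
    next
      fix A :: "real measure set"
      show "single_jump_law.trans t -` A \<inter> space (restrict_space borel {0, 1}) \<in> sets (restrict_space borel {0, 1})"
        unfolding fin by (auto simp: space_restrict_space)
    qed
  next
    fix Q s t A assume "Q \<in> P ` E_ex" "0 \<le> (s :: real)" "0 \<le> (t :: real)"
      and A: "A \<in> sets (restrict_space borel {0, 1 :: real})"
    then obtain x where Q: "Q = P x" by auto
    show "AE \<omega> in Q. real_cond_exp Q (Filt s) (\<lambda>\<omega>. indicator A (step 1 0 0 (s + t) \<omega>)) \<omega> =
        measure (single_jump_law.trans t (step 1 0 0 s \<omega>)) A"
      unfolding Q by (rule single_jump_law.markov_step[OF law \<open>0 \<le> s\<close> \<open>0 \<le> t\<close> A])
  qed
  have jumps: "jump_times (\<lambda>t. step 0 1 (0 :: real) t \<omega>) \<subseteq> jump_times (\<lambda>t. step 1 0 (0 :: real) t \<omega>)" for \<omega>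
    by (auto simp: jump_times_def jump_step split: if_splits)
  have kernel_Z: "affine_kernel (\<lambda>(y :: real) A. y * dirac (1 :: real) A)"
    by (intro affine_kernel_dirac) (auto simp: linear_iff)
  have jump_kernel_Z: "\<forall>y\<in>fst ` E_ex. jump_kernel_measure (\<lambda>A. y * dirac (1 :: real) A)"
    unfolding fstE by (intro ballI jump_kernel_dirac) auto
  show "jump_counter_setting M Filt E_ex P ?X 1 1 0"
    unfolding jump_counter_setting_def Let_def Y Z
  proof (intro conjI)
    show "compact E_ex" "E_ex \<subseteq> \<nat> \<times> UNIV" by (auto simp: E_ex_def)
    show "affine hull E_ex = UNIV" by (rule affine_hull_E_ex)
    show "\<exists>b c K. affine_process M Filt E_ex P ?X b c K \<and> normalized_jump_counter E_ex K fst"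
      unfolding affine_process_def using family triplet_X counter by blast
    show "fst ` E_ex = real ` {0..1}" by (force simp: E_ex_def image_iff)
    show "\<exists>b c. affine_triplet Filt (P ` E_ex) (fst ` E_ex) (step 1 0 0) b c
        (\<lambda>y A. y * 1 * dirac (-1) A + (real 1 - y) * 0 * dirac 1 A)"
      using triplet_Y by auto
    show "markov_process Filt (P ` E_ex) (fst ` E_ex) (step 1 0 0)" by (rule markov)
    show "\<forall>x\<in>E_ex. AE \<omega> in P x.
        jump_times (\<lambda>t. step 0 1 (0 :: real) t \<omega>) \<subseteq> jump_times (\<lambda>t. step 1 0 (0 :: real) t \<omega>)"
      using jumps by simp
    show "\<exists>K\<^sub>Z :: real \<Rightarrow> real set \<Rightarrow> real. affine_kernel K\<^sub>Z \<and>
        (\<forall>y\<in>fst ` E_ex. jump_kernel_measure (K\<^sub>Z y)) \<and>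
        (\<forall>x\<in>E_ex. jump_characteristic (completion (P x)) (augment (P x) Filt) (step 0 1 0)
          (\<lambda>t \<omega>. pos_measure (K\<^sub>Z (left_lim (\<lambda>r. step 1 0 0 r \<omega>) t))))"
      using kernel_Z jump_kernel_Z single_jump_law.jump_characteristic_Z[OF law]
      by (intro exI[of _ "\<lambda>y A. y * dirac (1 :: real) A"]) blast
  qed simp_all
  show "\<not> continuous_process E_ex P (\<lambda>t \<omega>. snd (?X t \<omega>))"
  proof
    assume "continuous_process E_ex P (\<lambda>t \<omega>. snd (?X t \<omega>))"
    then have "continuous_process E_ex P (step (0 :: real) 1 0)" unfolding Z .
    moreover have "(1, 0) \<in> E_ex" by (simp add: E_ex_def)
    ultimately have "AE \<omega> in P (1, 0). continuous_on {0..} (\<lambda>t. step (0 :: real) 1 0 t \<omega>)"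
      unfolding continuous_process_def by blast
    \<comment> \<open>Started at \<open>(1, 0)\<close>, almost every path of \<open>Z\<close> jumps
      by 1 at the positive time \<open>\<tau>\<close>.\<close>
    moreover have "AE \<omega> in P (1, 0). 0 < \<tau> \<omega>" by (rule ae[OF \<mu>_ex(5)[OF refl]]) measurable
    ultimately have "AE \<omega> in P (1, 0). False"
    proof eventually_elim
      case (elim \<omega>)
      let ?f = "\<lambda>t. step (0 :: real) 1 0 t \<omega>"
      have "(?f \<longlongrightarrow> ?f (\<tau> \<omega>)) (at (\<tau> \<omega>))"
        using elim continuous_on_interior[of "{0..}" ?f "\<tau> \<omega>"] by (simp add: isCont_def)
      then have "left_lim ?f (\<tau> \<omega>) = ?f (\<tau> \<omega>)"
        using elim(2) by (intro left_lim_eqI tendsto_within_subset[of ?f _ "\<tau> \<omega>" UNIV "{..<\<tau> \<omega>}"]) auto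
      then have "jump ?f (\<tau> \<omega>) = 0" by (simp add: jump_def)
      then show False using elim by (simp add: jump_step)
    qed
    then show False using prob_space.not_empty prob_space.AE_False[OF single_jump_law.axioms(2)[OF law]] by simp
  qed
qed

end

section \<open>The theorem\<close>

lemma jump_counter_settingE:
  assumes "jump_counter_setting M F E P X N \<alpha> \<beta>"
  obtains K K\<^sub>Z \<zeta>\<^sub>0 where "jump_counter_process M F E P X N \<alpha> \<beta> K K\<^sub>Z \<zeta>\<^sub>0"
proof -
  have *: "N \<noteq> 0" "0 < \<alpha>" "0 \<le> \<beta>" "compact E" "E \<subseteq> \<nat> \<times> UNIV" "affine hull E = UNIV" "fst ` E = real ` {0..N}"
    and ex_X: "\<exists>b c K. affine_process M F E P X b c K \<and> normalized_jump_counter E K fst"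
    and ex_Y: "\<exists>b c. affine_triplet F (P ` E) (fst ` E) (\<lambda>t \<omega>. fst (X t \<omega>)) b c
        (\<lambda>y A. y * \<alpha> * dirac (-1) A + (real N - y) * \<beta> * dirac 1 A)"
    and ZY: "\<forall>x\<in>E. AE \<omega> in P x. jump_times (\<lambda>t. snd (X t \<omega>)) \<subseteq> jump_times (\<lambda>t. fst (X t \<omega>))"
    and ex_Z: "\<exists>K\<^sub>Z :: real \<Rightarrow> real set \<Rightarrow> real. affine_kernel K\<^sub>Z \<and>
      (\<forall>y\<in>fst ` E. jump_kernel_measure (K\<^sub>Z y)) \<and>
      (\<forall>x\<in>E. jump_characteristic (completion (P x)) (augment (P x) F) (\<lambda>t \<omega>. snd (X t \<omega>))
        (\<lambda>t \<omega>. pos_measure (K\<^sub>Z (left_lim (\<lambda>r. fst (X r \<omega>)) t))))"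
    using assms unfolding jump_counter_setting_def Let_def by - (elim conjE, assumption)+
  obtain b c K where K: "affine_process M F E P X b c K" "normalized_jump_counter E K fst" using ex_X by (elim exE conjE)
  obtain u where u: "jump_counter E u fst" "fst u = -1"
    using K(2) by (auto simp: normalized_jump_counter_def)
  obtain b' c' where Y: "affine_triplet F (P ` E) (fst ` E) (\<lambda>t \<omega>. fst (X t \<omega>)) b' c'
        (\<lambda>y A. y * \<alpha> * dirac (-1) A + (real N - y) * \<beta> * dirac 1 A)" using ex_Y by (elim exE)
  obtain K\<^sub>Z :: "real \<Rightarrow> real set \<Rightarrow> real" where Z: "affine_kernel K\<^sub>Z"
    "\<forall>y\<in>fst ` E. jump_kernel_measure (K\<^sub>Z y)"
    "\<forall>x\<in>E. jump_characteristic (completion (P x)) (augment (P x) F) (\<lambda>t \<omega>. snd (X t \<omega>))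
          (\<lambda>t \<omega>. pos_measure (K\<^sub>Z (left_lim (\<lambda>r. fst (X r \<omega>)) t)))" using ex_Z by (elim exE conjE)
  have "jump_counter_process M F E P X N \<alpha> \<beta> K K\<^sub>Z (snd u)"
  proof
    show "semimartingale_family M F E P X" using K(1) by (simp add: affine_process_def)
    show "N \<noteq> 0" "0 < \<alpha>" "0 \<le> \<beta>" "compact E" "E \<subseteq> \<nat> \<times> UNIV" "affine hull E = UNIV" "fst ` E = real ` {0..N}"
      by (rule *)+
    show "affine_kernel K" using K(1) by (simp add: affine_process_def affine_triplet_def)
    show "jump_kernel_measure (K x)" if "x \<in> E" for x
      using K(1) that by (simp add: affine_process_def affine_triplet_def)
    show "jump_characteristic (completion (P x)) (augment (P x) F) X (\<lambda>t \<omega>. pos_measure (K (left_lim (\<lambda>r. X r \<omega>) t)))"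
      if "x \<in> E" for x
      using K(1) that by (simp add: affine_process_def affine_triplet_def characteristics_def)
    show "jump_kernel_measure (\<lambda>A :: real set. y * \<alpha> * dirac (-1) A + (real N - y) * \<beta> * dirac 1 A)"
      if "y \<in> fst ` E" for y
      using Y that unfolding affine_triplet_def by blast
    show "jump_characteristic (completion (P x)) (augment (P x) F) (\<lambda>t \<omega>. fst (X t \<omega>))
          (\<lambda>t \<omega>. pos_measure (\<lambda>A. left_lim (\<lambda>r. fst (X r \<omega>)) t * \<alpha> * dirac (-1) A +
            (real N - left_lim (\<lambda>r. fst (X r \<omega>)) t) * \<beta> * dirac 1 A))" if "x \<in> E" for x
      using Y that unfolding affine_triplet_def characteristics_def by blast
    show "affine_kernel K\<^sub>Z" "\<And>y. y \<in> fst ` E \<Longrightarrow> jump_kernel_measure (K\<^sub>Z y)"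
      "\<And>x. x \<in> E \<Longrightarrow> jump_characteristic (completion (P x)) (augment (P x) F) (\<lambda>t \<omega>. snd (X t \<omega>))
          (\<lambda>t \<omega>. pos_measure (K\<^sub>Z (left_lim (\<lambda>r. fst (X r \<omega>)) t)))" using Z by blast+
    show "AE \<omega> in P x. jump_times (\<lambda>t. snd (X t \<omega>)) \<subseteq> jump_times (\<lambda>t. fst (X t \<omega>))" if "x \<in> E" for x
      using ZY that by blast
    show "x + (-1, snd u) \<in> E" if "x \<in> E" "0 < fst x" for x
    proof -
      have "x + u \<in> E" using u(1) that by (simp add: jump_counter_def)
      moreover have "u = (-1, snd u)" using u(2) by (simp add: prod_eq_iff)
      ultimately show ?thesis by simp
    qed
  qed
  then show ?thesis by (rule that)
qed

theorem proposition5p2: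
  shows
    "(\<forall>(M :: 'w measure) F E P X N \<alpha> \<beta>. jump_counter_setting M F E P X N \<alpha> \<beta> \<longrightarrow>
        (0 < \<beta> \<longrightarrow>
          (\<exists>A :: real \<times> real \<Rightarrow> real \<times> real. affine_map A \<and> bij A \<and>
            continuous_process E P (\<lambda>t \<omega>. snd (A (X t \<omega>))) \<and>
            (\<exists>E\<^sub>Z. compact E\<^sub>Z \<and> A ` E = real ` {0..N} \<times> E\<^sub>Z))) \<and>
        (\<beta> = 0 \<longrightarrow>
          (\<forall>(y, z)\<in>E. AE \<omega> in P (y, z).
            finite (jump_times (\<lambda>t. snd (X t \<omega>))) \<and>
            real (card (jump_times (\<lambda>t. snd (X t \<omega>)))) \<le> y))) \<and>
      (\<exists>(M :: (real \<Rightarrow> real \<times> real) measure) F E P X N \<alpha>.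
        jump_counter_setting M F E P X N \<alpha> 0 \<and>
        \<not> continuous_process E P (\<lambda>t \<omega>. snd (X t \<omega>)))"
proof (intro conjI allI impI)
  fix M :: "'w measure" and F E P X N \<alpha> \<beta>
  assume "jump_counter_setting M F E P X N \<alpha> \<beta>"
  then obtain K K\<^sub>Z \<zeta>\<^sub>0 where "jump_counter_process M F E P X N \<alpha> \<beta> K K\<^sub>Z \<zeta>\<^sub>0"
    by (rule jump_counter_settingE)
  then interpret jump_counter_process M F E P X N \<alpha> \<beta> K K\<^sub>Z \<zeta>\<^sub>0 .
  show "\<exists>A :: real \<times> real \<Rightarrow> real \<times> real. affine_map A \<and> bij A \<and>
            continuous_process E P (\<lambda>t \<omega>. snd (A (X t \<omega>))) \<and>
            (\<exists>E\<^sub>Z. compact E\<^sub>Z \<and> A ` E = real ` {0..N} \<times> E\<^sub>Z)" if b: "0 < \<beta>"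
  proof (intro exI conjI)
    \<comment> \<open>This shear turns the two possible jumps \<open>(1, - \<zeta>\<^sub>0)\<close>
      and \<open>(-1, \<zeta>\<^sub>0)\<close> into \<open>(1, 0)\<close> and
      \<open>(-1, 0)\<close>.\<close>
    let ?A = "\<lambda>x. (fst x, snd x + \<zeta>\<^sub>0 * fst x)"
    have "linear ?A" by (simp add: linear_iff algebra_simps)
    then show "affine_map ?A"
      unfolding affine_map_def by (intro exI[of _ ?A] exI[of _ 0]) (simp add: zero_prod_def)
    show "bij ?A"
      by (rule o_bij[of "\<lambda>x. (fst x, snd x - \<zeta>\<^sub>0 * fst x)"]) (auto simp: fun_eq_iff)
    show "continuous_process E P (\<lambda>t \<omega>. snd (?A (X t \<omega>)))" using continuous_transformed[OF b] by simp
    show "compact {z. (0, z) \<in> E}" by (rule compact_fibre)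
    show "?A ` E = real ` {0..N} \<times> {z. (0, z) \<in> E}" by (rule image_product[OF b])
  qed
  show "\<forall>(y, z)\<in>E. AE \<omega> in P (y, z). finite (jump_times (\<lambda>t. snd (X t \<omega>))) \<and>
      real (card (jump_times (\<lambda>t. snd (X t \<omega>)))) \<le> y" if "\<beta> = 0"
    using few_jumps[OF that] by fastforce
next
  \<comment> \<open>The sample space only has to carry one real random variable. On path space it is
    read from the first coordinate at time 0, and \<open>?g\<close> sends a number to a constant
    path.\<close>
  let ?\<tau> = "\<lambda>\<omega> :: real \<Rightarrow> real \<times> real. fst (\<omega> 0)"
  let ?M = "vimage_algebra UNIV ?\<tau> borel"
  let ?g = "\<lambda>r _ :: real. (r, 0) :: real \<times> real"
  interpret single_jump ?M ?\<tau>
    by standard (rule measurable_vimage_algebra1, simp)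
  have "?g \<in> measurable borel ?M" by (rule measurable_vimage_algebra2) auto
  moreover have "?\<tau> (?g r) = r" for r by simp
  ultimately have "jump_counter_setting ?M Filt E_ex (\<lambda>x. distr (\<mu>_ex x) ?M ?g) (step (1, 0) (0, 1) (0, 0)) 1 1 0"
    "\<not> continuous_process E_ex (\<lambda>x. distr (\<mu>_ex x) ?M ?g) (\<lambda>t \<omega>. snd (step (1 :: real, 0 :: real) (0, 1) (0, 0) t \<omega>))"
    by (rule setting_example)+
  then
  show "\<exists>(M :: (real \<Rightarrow> real \<times> real) measure) F E P X N \<alpha>.
        jump_counter_setting M F E P X N \<alpha> 0 \<and>
        \<not> continuous_process E P (\<lambda>t \<omega>. snd (X t \<omega>))"
    by blast
qed

end
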